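(* Let $G$ be an arbitrary finite group. There exists an étale map $f: R \to S$ of $G$-Tambara functors for which the induced map $\mathrm{Spec}(S) \to \mathrm{Spec}(R)$ on Nakaoka spectra is not open. If $G$ is Dedekind, then such an $f$ may moreover be chosen so that the induced map on Nakaoka spectra is closed.
   Context: A Dedekind group is a group all of whose subgroups are normal. Tambara functors are evaluated on transitive $G$-sets and extended by $R(X \sqcup Y) = R(X) \times R(Y)$. A Tambara ideal $I$ of a $G$-Tambara functor $R$ is a collection of ideals $I(G/H) \subseteq R(G/H)$ closed under all transfers, norms, restrictions and conjugations. The product $I\cdot J$ is the smallest Tambara ideal containing all $I(G/H)\cdot J(G/H)$. A Tambara ideal $\mathfrak{p}$ is prime if $\mathfrak{p}\neq R$ and $I\cdot J\subseteq \mathfrak{p}$ implies $I\subseteq\mathfrak{p}$ or $J\subseteq\mathfrak{p}$. The Nakaoka spectrum $\mathrm{Spec}(R)$ is the set of prime Tambara ideals with closed sets $V(I)=\{\mathfrak{p}: I\subseteq\mathfrak{p}\}$. A map $f:R\to S$ induces $\mathrm{Spec}(S)\to\mathrm{Spec}(R)$ by taking (levelwise) preimages of prime ideals. A map $R\to S$ of $G$-Tambara functors is étale if: (a) $S$ is finitely presented as an $R$-algebra in $G$-Tambara functors (a coequalizer of a pair of maps between free Tambara $R$-algebras on finitely many generators, each generator living at some level $G/H$); (b) $S$ is flat as an $R$-module, i.e. the relative box product $S\boxtimes_R -$ is exact on $R$-modules (modules over the underlying Green functor); and (c) the genuine Kähler differentials $\Omega^{1,G}_{S/R}=I/I^{>1}$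 vanish, where $I$ is the kernel of the multiplication $S\boxtimes_R S\to S$ and $I^{>1}$ is the Tambara ideal generated by all norms $N_h(a)$ of elements $a\in I(X)$ along maps $h:X\to Y$ of finite $G$-sets all of whose fibers have at least two elements.
   Formalization: The group is assumed nontrivial: for the trivial group étale maps are flat, finitely presented ring maps, hence open on spectra. Modules and algebras testing étaleness range over those with levels in one arbitrary infinite set; a cardinality argument gives the general notion. *)

theory Defs
  imports
    "HOL-Library.FuncSet"
    "HOL-Library.Infinite_Typeclass"
    "HOL-Analysis.Abstract_Topology"
    "HOL-Algebra.Coset"
    "HOL-Algebra.Group_Action"
    "HOL-Algebra.Ideal_Product"
    "HOL-Algebra.Module"
begin

section \<open>Finite G-sets\<close>

text \<open>Every finite \<open>G\<close>-set is isomorphic to one whose points are natural numbers, so the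
  category below is equivalent to that of all finite \<open>G\<close>-sets. In particular every orbit \<open>G/H\<close> is isomorphic to a transitive \<open>G\<close>-set in the sense below, and a datum
  indexed by the \<open>G/H\<close> and compatible with conjugation is a datum indexed by the transitive \<open>G\<close>-sets
  and compatible with all isomorphisms.\<close>

record 'g gset =
  pts :: "nat set"
  act :: "'g \<Rightarrow> nat \<Rightarrow> nat"

definition fin_gset :: "'g monoid \<Rightarrow> 'g gset \<Rightarrow> bool" where
  "fin_gset G X \<longleftrightarrow>
     finite (pts X) \<and> group_action G (pts X) (act X) \<and> act X \<in> extensional (carrier G)"

definition trans_gset :: "'g monoid \<Rightarrow> 'g gset \<Rightarrow> bool" where
  "trans_gset G X \<longleftrightarrow>
     fin_gset G X \<and> pts X \<noteq> {} \<and> transitive_action G (pts X) (act X)"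

text \<open>Maps are extensional functions, so that equality of maps is equality of functions.\<close>

definition gmap :: "'g monoid \<Rightarrow> 'g gset \<Rightarrow> 'g gset \<Rightarrow> (nat \<Rightarrow> nat) \<Rightarrow> bool" where
  "gmap G X Y f \<longleftrightarrow>
     fin_gset G X \<and> fin_gset G Y \<and> f \<in> pts X \<rightarrow>\<^sub>E pts Y \<and>
     (\<forall>g\<in>carrier G. \<forall>x\<in>pts X. f (act X g x) = act Y g (f x))"

definition gcoproduct ::
  "'g monoid \<Rightarrow> 'g gset \<Rightarrow> 'g gset \<Rightarrow> 'g gset \<Rightarrow> (nat \<Rightarrow> nat) \<Rightarrow> (nat \<Rightarrow> nat) \<Rightarrow> bool" where
  "gcoproduct G X Y Z i j \<longleftrightarrow>
     gmap G X Z i \<and> gmap G Y Z j \<and> inj_on i (pts X) \<and> inj_on j (pts Y) \<and>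
     i ` pts X \<inter> j ` pts Y = {} \<and> i ` pts X \<union> j ` pts Y = pts Z"

text \<open>The square with \<open>p : P \<rightarrow> X\<close>, \<open>q : P \<rightarrow> Y\<close>, \<open>f : X \<rightarrow> Z\<close>, \<open>g : Y \<rightarrow> Z\<close> is a pullback.\<close>

definition gpullback ::
  "'g monoid \<Rightarrow> 'g gset \<Rightarrow> 'g gset \<Rightarrow> 'g gset \<Rightarrow> 'g gset
   \<Rightarrow> (nat \<Rightarrow> nat) \<Rightarrow> (nat \<Rightarrow> nat) \<Rightarrow> (nat \<Rightarrow> nat) \<Rightarrow> (nat \<Rightarrow> nat) \<Rightarrow> bool" where
  "gpullback G X Y Z P f g p q \<longleftrightarrow>
     gmap G X Z f \<and> gmap G Y Z g \<and> gmap G P X p \<and> gmap G P Y q \<and>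
     bij_betw (\<lambda>w. (p w, q w)) (pts P) {(x, y) \<in> pts X \<times> pts Y. f x = g y}"

text \<open>Exponential diagrams: given \<open>p : A \<rightarrow> X\<close> and \<open>f : X \<rightarrow> Y\<close>, the map \<open>q : B \<rightarrow> Y\<close> is (isomorphic
  to) the dependent product of \<open>p\<close> along \<open>f\<close>, whose fibre over \<open>y\<close> is the set of sections of \<open>p\<close>
  over the fibre of \<open>f\<close> at \<open>y\<close>; \<open>E\<close> is the pullback of \<open>f\<close> and \<open>q\<close>, \<open>c : E \<rightarrow> B\<close> is its projection,
  and \<open>e : E \<rightarrow> A\<close> is the evaluation of sections.\<close>

definition gexponential ::
  "'g monoid \<Rightarrow> 'g gset \<Rightarrow> 'g gset \<Rightarrow> 'g gset \<Rightarrow> 'g gset \<Rightarrow> 'g gset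
   \<Rightarrow> (nat \<Rightarrow> nat) \<Rightarrow> (nat \<Rightarrow> nat) \<Rightarrow> (nat \<Rightarrow> nat) \<Rightarrow> (nat \<Rightarrow> nat) \<Rightarrow> (nat \<Rightarrow> nat) \<Rightarrow> bool" where
  "gexponential G A X Y E B p f e c q \<longleftrightarrow>
     gmap G A X p \<and> gmap G E A e \<and> gpullback G X B Y E f q (compose (pts E) p e) c \<and>
     (\<forall>y\<in>pts Y.
        bij_betw
          (\<lambda>b. \<lambda>x\<in>{x \<in> pts X. f x = y}. e (THE w. w \<in> pts E \<and> p (e w) = x \<and> c w = b))
          {b \<in> pts B. q b = y}
          {s \<in> {x \<in> pts X. f x = y} \<rightarrow>\<^sub>E pts A. \<forall>x\<in>pts X. f x = y \<longrightarrow> p (s x) = x})"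


section \<open>Mackey functors and Tambara functors\<close>

text \<open>For \<open>f : X \<rightarrow> Y\<close>, \<open>rst X Y f\<close> goes from level \<open>Y\<close> to level \<open>X\<close>, while \<open>trf X Y f\<close> (and the norm
  \<open>nrm X Y f\<close> below) go from level \<open>X\<close> to level \<open>Y\<close>. Only the additive groups of the \<open>A X\<close> are used
  in a Mackey functor. Values outside of the carriers are irrelevant throughout.\<close>

locale mackey_functor =
  fixes G :: "'g monoid"
    and A :: "'g gset \<Rightarrow> ('u, 'x) ring_scheme"
    and rst :: "'g gset \<Rightarrow> 'g gset \<Rightarrow> (nat \<Rightarrow> nat) \<Rightarrow> 'u \<Rightarrow> 'u"
    and trf :: "'g gset \<Rightarrow> 'g gset \<Rightarrow> (nat \<Rightarrow> nat) \<Rightarrow> 'u \<Rightarrow> 'u"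
  assumes level_group: "fin_gset G X \<Longrightarrow> abelian_group (A X)"
    and rst_hom: "gmap G X Y f \<Longrightarrow> rst X Y f \<in> hom (add_monoid (A Y)) (add_monoid (A X))"
    and trf_hom: "gmap G X Y f \<Longrightarrow> trf X Y f \<in> hom (add_monoid (A X)) (add_monoid (A Y))"
    and rst_id: "fin_gset G X \<Longrightarrow> a \<in> carrier (A X) \<Longrightarrow> rst X X (\<lambda>x\<in>pts X. x) a = a"
    and trf_id: "fin_gset G X \<Longrightarrow> a \<in> carrier (A X) \<Longrightarrow> trf X X (\<lambda>x\<in>pts X. x) a = a"
    and rst_comp: "gmap G X Y f \<Longrightarrow> gmap G Y Z g \<Longrightarrow> a \<in> carrier (A Z) \<Longrightarrow>
        rst X Z (compose (pts X) g f) a = rst X Y f (rst Y Z g a)"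
    and trf_comp: "gmap G X Y f \<Longrightarrow> gmap G Y Z g \<Longrightarrow> a \<in> carrier (A X) \<Longrightarrow>
        trf X Z (compose (pts X) g f) a = trf Y Z g (trf X Y f a)"
    and additive: "gcoproduct G X Y Z i j \<Longrightarrow>
        bij_betw (\<lambda>a. (rst X Z i a, rst Y Z j a)) (carrier (A Z)) (carrier (A X) \<times> carrier (A Y))"
    and rst_trf: "gpullback G X Y Z P f g p q \<Longrightarrow> a \<in> carrier (A X) \<Longrightarrow>
        rst Y Z g (trf X Z f a) = trf P Y q (rst P X p a)"

record ('g, 'u) tamb =
  lev :: "'g gset \<Rightarrow> 'u ring"
  rst :: "'g gset \<Rightarrow> 'g gset \<Rightarrow> (nat \<Rightarrow> nat) \<Rightarrow> 'u \<Rightarrow> 'u"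
  trf :: "'g gset \<Rightarrow> 'g gset \<Rightarrow> (nat \<Rightarrow> nat) \<Rightarrow> 'u \<Rightarrow> 'u"
  nrm :: "'g gset \<Rightarrow> 'g gset \<Rightarrow> (nat \<Rightarrow> nat) \<Rightarrow> 'u \<Rightarrow> 'u"

text \<open>Additivity and base change force the transfer (respectively the norm) along a fold map to be the addition
  (respectively the multiplication) of the level rings.\<close>

locale tambara = mackey_functor G "lev R" "rst R" "trf R"
  for G :: "'g monoid" and R :: "('g, 'u) tamb" +
  assumes level_cring: "fin_gset G X \<Longrightarrow> cring (lev R X)"
    and rst_ring_hom: "gmap G X Y f \<Longrightarrow> rst R X Y f \<in> ring_hom (lev R Y) (lev R X)"
    and nrm_hom: "gmap G X Y f \<Longrightarrow> nrm R X Y f \<in> hom (lev R X) (lev R Y)"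
    and nrm_one: "gmap G X Y f \<Longrightarrow> nrm R X Y f \<one>\<^bsub>lev R X\<^esub> = \<one>\<^bsub>lev R Y\<^esub>"
    and nrm_id: "fin_gset G X \<Longrightarrow> a \<in> carrier (lev R X) \<Longrightarrow> nrm R X X (\<lambda>x\<in>pts X. x) a = a"
    and nrm_comp: "gmap G X Y f \<Longrightarrow> gmap G Y Z g \<Longrightarrow> a \<in> carrier (lev R X) \<Longrightarrow>
        nrm R X Z (compose (pts X) g f) a = nrm R Y Z g (nrm R X Y f a)"
    and rst_nrm: "gpullback G X Y Z P f g p q \<Longrightarrow> a \<in> carrier (lev R X) \<Longrightarrow>
        rst R Y Z g (nrm R X Z f a) = nrm R P Y q (rst R P X p a)"
    and nrm_trf: "gexponential G A X Y E B p f e c q \<Longrightarrow> a \<in> carrier (lev R A) \<Longrightarrow>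
        nrm R X Y f (trf R A X p a) = trf R B Y q (nrm R E B c (rst R E A e a))"

definition tambara_hom ::
  "'g monoid \<Rightarrow> ('g, 'u) tamb \<Rightarrow> ('g, 'u) tamb \<Rightarrow> ('g gset \<Rightarrow> 'u \<Rightarrow> 'u) \<Rightarrow> bool" where
  "tambara_hom G R S \<phi> \<longleftrightarrow>
     tambara G R \<and> tambara G S \<and>
     (\<forall>X. fin_gset G X \<longrightarrow> \<phi> X \<in> ring_hom (lev R X) (lev S X)) \<and>
     (\<forall>X Y f. gmap G X Y f \<longrightarrow>
        (\<forall>a\<in>carrier (lev R Y). \<phi> X (rst R X Y f a) = rst S X Y f (\<phi> Y a)) \<and>
        (\<forall>a\<in>carrier (lev R X). \<phi> Y (trf R X Y f a) = trf S X Y f (\<phi> X a)) \<and>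
        (\<forall>a\<in>carrier (lev R X). \<phi> Y (nrm R X Y f a) = nrm S X Y f (\<phi> X a)))"

text \<open>Equality of levelwise maps on the levels of their source.\<close>

definition agree ::
  "'g monoid \<Rightarrow> ('g gset \<Rightarrow> ('u, 'x) ring_scheme)
   \<Rightarrow> ('g gset \<Rightarrow> 'u \<Rightarrow> 'v) \<Rightarrow> ('g gset \<Rightarrow> 'u \<Rightarrow> 'v) \<Rightarrow> bool" where
  "agree G A h k \<longleftrightarrow> (\<forall>X. fin_gset G X \<longrightarrow> (\<forall>a\<in>carrier (A X). h X a = k X a))"


section \<open>Tambara ideals and the Nakaoka spectrum\<close>

text \<open>A Tambara ideal is a family of ideals on transitive \<open>G\<close>-sets (the orbits \<open>G/H\<close>); restriction,
  transfer and norm along isomorphisms of orbits give the conjugations. The last clause extends the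
  family to all finite \<open>G\<close>-sets by the product over orbits. A family is the empty set outside of
  finite \<open>G\<close>-sets, so that \<open>\<le>\<close> and \<open>=\<close> are inclusion and equality of ideals.\<close>

definition tambara_ideal ::
  "'g monoid \<Rightarrow> ('g, 'u) tamb \<Rightarrow> ('g gset \<Rightarrow> 'u set) \<Rightarrow> bool" where
  "tambara_ideal G R I \<longleftrightarrow>
     (\<forall>X. trans_gset G X \<longrightarrow> ideal (I X) (lev R X)) \<and>
     (\<forall>X Y f. trans_gset G X \<longrightarrow> trans_gset G Y \<longrightarrow> gmap G X Y f \<longrightarrow>
        rst R X Y f ` I Y \<subseteq> I X \<and> trf R X Y f ` I X \<subseteq> I Y \<and> nrm R X Y f ` I X \<subseteq> I Y) \<and>
     (\<forall>X. I X = (if fin_gset G X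
        then {a \<in> carrier (lev R X). \<forall>Q i. trans_gset G Q \<longrightarrow> gmap G Q X i \<longrightarrow> rst R Q X i a \<in> I Q}
        else {}))"

definition unit_tideal :: "'g monoid \<Rightarrow> ('g, 'u) tamb \<Rightarrow> 'g gset \<Rightarrow> 'u set" where
  "unit_tideal G R X = (if fin_gset G X then carrier (lev R X) else {})"

definition tideal_gen ::
  "'g monoid \<Rightarrow> ('g, 'u) tamb \<Rightarrow> ('g gset \<Rightarrow> 'u set) \<Rightarrow> 'g gset \<Rightarrow> 'u set" where
  "tideal_gen G R A X = \<Inter>{I X | I. tambara_ideal G R I \<and> A \<le> I}"

definition tideal_prod ::
  "'g monoid \<Rightarrow> ('g, 'u) tamb \<Rightarrow> ('g gset \<Rightarrow> 'u set) \<Rightarrow> ('g gset \<Rightarrow> 'u set) \<Rightarrow> 'g gset \<Rightarrow> 'u set"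
where
  "tideal_prod G R I J =
     tideal_gen G R (\<lambda>X. if trans_gset G X then ideal_prod (lev R X) (I X) (J X) else {})"

definition tambara_prime ::
  "'g monoid \<Rightarrow> ('g, 'u) tamb \<Rightarrow> ('g gset \<Rightarrow> 'u set) \<Rightarrow> bool" where
  "tambara_prime G R P \<longleftrightarrow>
     tambara_ideal G R P \<and> P \<noteq> unit_tideal G R \<and>
     (\<forall>I J. tambara_ideal G R I \<longrightarrow> tambara_ideal G R J \<longrightarrow>
        tideal_prod G R I J \<le> P \<longrightarrow> I \<le> P \<or> J \<le> P)"

definition Spec :: "'g monoid \<Rightarrow> ('g, 'u) tamb \<Rightarrow> ('g gset \<Rightarrow> 'u set) set" where
  "Spec G R = {P. tambara_prime G R P}"

definition vanishing ::
  "'g monoid \<Rightarrow> ('g, 'u) tamb \<Rightarrow> ('g gset \<Rightarrow> 'u set) \<Rightarrow> ('g gset \<Rightarrow> 'u set) set" where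
  "vanishing G R I = {P \<in> Spec G R. I \<le> P}"

definition nakaoka_spec :: "'g monoid \<Rightarrow> ('g, 'u) tamb \<Rightarrow> ('g gset \<Rightarrow> 'u set) topology" where
  "nakaoka_spec G R =
     topology (\<lambda>U. \<exists>I. tambara_ideal G R I \<and> U = Spec G R - vanishing G R I)"

definition spec_map ::
  "'g monoid \<Rightarrow> ('g, 'u) tamb \<Rightarrow> ('g gset \<Rightarrow> 'u \<Rightarrow> 'u) \<Rightarrow> ('g gset \<Rightarrow> 'u set) \<Rightarrow> 'g gset \<Rightarrow> 'u set"
where
  "spec_map G R \<phi> P X = (if fin_gset G X then {a \<in> carrier (lev R X). \<phi> X a \<in> P X} else {})"


section \<open>Modules over a Tambara functor and the relative box product\<close>

text \<open>The ring multiplication and unit of the record type \<open>module\<close> carry no meaning.\<close>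

record ('g, 'u) gmodule =
  mlev :: "'g gset \<Rightarrow> ('u, 'u) module"
  mrst :: "'g gset \<Rightarrow> 'g gset \<Rightarrow> (nat \<Rightarrow> nat) \<Rightarrow> 'u \<Rightarrow> 'u"
  mtrf :: "'g gset \<Rightarrow> 'g gset \<Rightarrow> (nat \<Rightarrow> nat) \<Rightarrow> 'u \<Rightarrow> 'u"

locale tambara_module = tambara G R + M: mackey_functor G "mlev M" "mrst M" "mtrf M"
  for G :: "'g monoid" and R :: "('g, 'u) tamb" and M :: "('g, 'u) gmodule" +
  assumes level_module: "fin_gset G X \<Longrightarrow> Module.module (lev R X) (mlev M X)"
    and mrst_smult: "gmap G X Y f \<Longrightarrow> r \<in> carrier (lev R Y) \<Longrightarrow> m \<in> carrier (mlev M Y) \<Longrightarrow>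
        mrst M X Y f (r \<odot>\<^bsub>mlev M Y\<^esub> m) = rst R X Y f r \<odot>\<^bsub>mlev M X\<^esub> mrst M X Y f m"
    and frobenius_left: "gmap G X Y f \<Longrightarrow> r \<in> carrier (lev R Y) \<Longrightarrow> m \<in> carrier (mlev M X) \<Longrightarrow>
        mtrf M X Y f (rst R X Y f r \<odot>\<^bsub>mlev M X\<^esub> m) = r \<odot>\<^bsub>mlev M Y\<^esub> mtrf M X Y f m"
    and frobenius_right: "gmap G X Y f \<Longrightarrow> r \<in> carrier (lev R X) \<Longrightarrow> m \<in> carrier (mlev M Y) \<Longrightarrow>
        mtrf M X Y f (r \<odot>\<^bsub>mlev M X\<^esub> mrst M X Y f m) = trf R X Y f r \<odot>\<^bsub>mlev M Y\<^esub> m"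

definition gmodule_hom ::
  "'g monoid \<Rightarrow> ('g, 'u) tamb \<Rightarrow> ('g, 'u) gmodule \<Rightarrow> ('g, 'u) gmodule
   \<Rightarrow> ('g gset \<Rightarrow> 'u \<Rightarrow> 'u) \<Rightarrow> bool" where
  "gmodule_hom G R M N h \<longleftrightarrow>
     tambara_module G R M \<and> tambara_module G R N \<and>
     (\<forall>X. fin_gset G X \<longrightarrow>
        h X \<in> hom (add_monoid (mlev M X)) (add_monoid (mlev N X)) \<and>
        (\<forall>r\<in>carrier (lev R X). \<forall>m\<in>carrier (mlev M X).
           h X (r \<odot>\<^bsub>mlev M X\<^esub> m) = r \<odot>\<^bsub>mlev N X\<^esub> h X m)) \<and>
     (\<forall>X Y f. gmap G X Y f \<longrightarrow>
        (\<forall>m\<in>carrier (mlev M Y). h X (mrst M X Y f m) = mrst N X Y f (h Y m)) \<and>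
        (\<forall>m\<in>carrier (mlev M X). h Y (mtrf M X Y f m) = mtrf N X Y f (h X m)))"

definition gmodule_exact ::
  "'g monoid \<Rightarrow> ('g, 'u) tamb \<Rightarrow> ('g, 'u) gmodule \<Rightarrow> ('g, 'u) gmodule \<Rightarrow> ('g, 'u) gmodule
   \<Rightarrow> ('g gset \<Rightarrow> 'u \<Rightarrow> 'u) \<Rightarrow> ('g gset \<Rightarrow> 'u \<Rightarrow> 'u) \<Rightarrow> bool" where
  "gmodule_exact G R L M N h k \<longleftrightarrow>
     gmodule_hom G R L M h \<and> gmodule_hom G R M N k \<and>
     (\<forall>X. fin_gset G X \<longrightarrow>
        h X ` carrier (mlev L X) = {m \<in> carrier (mlev M X). k X m = \<zero>\<^bsub>mlev N X\<^esub>})"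

text \<open>\<open>R\<close>-bilinear Dress pairings; the three clauses for \<open>f : X \<rightarrow> Y\<close> are compatibility with
  restrictions and the two Frobenius relations.\<close>

definition dress_pairing ::
  "'g monoid \<Rightarrow> ('g, 'u) tamb \<Rightarrow> ('g, 'u) gmodule \<Rightarrow> ('g, 'u) gmodule \<Rightarrow> ('g, 'u) gmodule
   \<Rightarrow> ('g gset \<Rightarrow> 'u \<Rightarrow> 'u \<Rightarrow> 'u) \<Rightarrow> bool" where
  "dress_pairing G R M N Q \<beta> \<longleftrightarrow>
     tambara_module G R M \<and> tambara_module G R N \<and> tambara_module G R Q \<and>
     (\<forall>X. fin_gset G X \<longrightarrow>
        (\<forall>m\<in>carrier (mlev M X).
           \<beta> X m \<in> hom (add_monoid (mlev N X)) (add_monoid (mlev Q X))) \<and>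
        (\<forall>n\<in>carrier (mlev N X).
           (\<lambda>m. \<beta> X m n) \<in> hom (add_monoid (mlev M X)) (add_monoid (mlev Q X))) \<and>
        (\<forall>r\<in>carrier (lev R X). \<forall>m\<in>carrier (mlev M X). \<forall>n\<in>carrier (mlev N X).
           \<beta> X (r \<odot>\<^bsub>mlev M X\<^esub> m) n = r \<odot>\<^bsub>mlev Q X\<^esub> \<beta> X m n \<and>
           \<beta> X m (r \<odot>\<^bsub>mlev N X\<^esub> n) = r \<odot>\<^bsub>mlev Q X\<^esub> \<beta> X m n)) \<and>
     (\<forall>X Y f. gmap G X Y f \<longrightarrow>
        (\<forall>m\<in>carrier (mlev M Y). \<forall>n\<in>carrier (mlev N Y).
           mrst Q X Y f (\<beta> Y m n) = \<beta> X (mrst M X Y f m) (mrst N X Y f n)) \<and>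
        (\<forall>m\<in>carrier (mlev M X). \<forall>n\<in>carrier (mlev N Y).
           mtrf Q X Y f (\<beta> X m (mrst N X Y f n)) = \<beta> Y (mtrf M X Y f m) n) \<and>
        (\<forall>m\<in>carrier (mlev M Y). \<forall>n\<in>carrier (mlev N X).
           mtrf Q X Y f (\<beta> X (mrst M X Y f m) n) = \<beta> Y m (mtrf N X Y f n)))"

text \<open>\<open>P\<close> with \<open>\<beta>\<close> is the relative box product of \<open>M\<close> and \<open>N\<close> over \<open>R\<close>, i.e. the target of the
  universal \<open>R\<close>-bilinear Dress pairing. Here and in the universal properties below, the type \<open>'u\<close> plays
  the role of a universe: test objects have levels contained in \<open>'u\<close>. If \<open>'u\<close> is infinite, box
  products, free algebras and coequalizers of objects with levels in \<open>'u\<close> can be realised in \<open>'u\<close>, so that the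
  universal properties determine the usual objects.\<close>

definition is_box_product ::
  "'g monoid \<Rightarrow> ('g, 'u) tamb \<Rightarrow> ('g, 'u) gmodule \<Rightarrow> ('g, 'u) gmodule \<Rightarrow> ('g, 'u) gmodule
   \<Rightarrow> ('g gset \<Rightarrow> 'u \<Rightarrow> 'u \<Rightarrow> 'u) \<Rightarrow> bool" where
  "is_box_product G R M N P \<beta> \<longleftrightarrow>
     dress_pairing G R M N P \<beta> \<and>
     (\<forall>Q \<gamma>. dress_pairing G R M N Q \<gamma> \<longrightarrow>
        (let factors = (\<lambda>h. gmodule_hom G R P Q h \<and>
               (\<forall>X. fin_gset G X \<longrightarrow>
                  (\<forall>m\<in>carrier (mlev M X). \<forall>n\<in>carrier (mlev N X). h X (\<beta> X m n) = \<gamma> X m n)))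
         in (\<exists>h. factors h) \<and>
            (\<forall>h h'. factors h \<longrightarrow> factors h' \<longrightarrow> agree G (mlev P) h h')))"

definition alg_module ::
  "('g, 'u) tamb \<Rightarrow> ('g gset \<Rightarrow> 'u \<Rightarrow> 'u) \<Rightarrow> ('g, 'u) gmodule" where
  "alg_module S \<phi> =
     \<lparr>mlev = (\<lambda>X. ring.extend (lev S X) (module.fields (\<lambda>r s. \<phi> X r \<otimes>\<^bsub>lev S X\<^esub> s))),
      mrst = rst S, mtrf = trf S\<rparr>"


section \<open>Etale maps\<close>

definition algebra_hom ::
  "'g monoid \<Rightarrow> ('g, 'u) tamb \<Rightarrow> ('g, 'u) tamb \<Rightarrow> ('g gset \<Rightarrow> 'u \<Rightarrow> 'u)
   \<Rightarrow> ('g, 'u) tamb \<Rightarrow> ('g gset \<Rightarrow> 'u \<Rightarrow> 'u) \<Rightarrow> ('g gset \<Rightarrow> 'u \<Rightarrow> 'u) \<Rightarrow> bool" where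
  "algebra_hom G R A \<alpha> B \<beta> k \<longleftrightarrow>
     tambara_hom G R A \<alpha> \<and> tambara_hom G R B \<beta> \<and> tambara_hom G A B k \<and>
     agree G (lev R) (\<lambda>X a. k X (\<alpha> X a)) \<beta>"

definition elements_at ::
  "('g, 'u) tamb \<Rightarrow> 'g gset list \<Rightarrow> 'u list \<Rightarrow> bool" where
  "elements_at F Xs xs \<longleftrightarrow> list_all2 (\<lambda>X x. x \<in> carrier (lev F X)) Xs xs"

text \<open>\<open>F\<close>, with structure map \<open>\<eta>\<close>, is the free \<open>R\<close>-algebra on generators \<open>xs\<close>, the \<open>i\<close>-th of which
  lives at the level of the transitive \<open>G\<close>-set \<open>Xs ! i\<close>.\<close>

definition is_free_algebra ::
  "'g monoid \<Rightarrow> ('g, 'u) tamb \<Rightarrow> 'g gset list \<Rightarrow> ('g, 'u) tamb \<Rightarrow> ('g gset \<Rightarrow> 'u \<Rightarrow> 'u)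
   \<Rightarrow> 'u list \<Rightarrow> bool" where
  "is_free_algebra G R Xs F \<eta> xs \<longleftrightarrow>
     (\<forall>X\<in>set Xs. trans_gset G X) \<and> tambara_hom G R F \<eta> \<and> elements_at F Xs xs \<and>
     (\<forall>T \<theta> ts. tambara_hom G R T \<theta> \<longrightarrow> elements_at T Xs ts \<longrightarrow>
        (let extends = (\<lambda>k. algebra_hom G R F \<eta> T \<theta> k \<and> (\<forall>i<length Xs. k (Xs ! i) (xs ! i) = ts ! i))
         in (\<exists>k. extends k) \<and>
            (\<forall>k k'. extends k \<longrightarrow> extends k' \<longrightarrow> agree G (lev F) k k')))"

definition is_algebra_coequalizer ::
  "'g monoid \<Rightarrow> ('g, 'u) tamb \<Rightarrow> ('g, 'u) tamb \<Rightarrow> ('g gset \<Rightarrow> 'u \<Rightarrow> 'u)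
   \<Rightarrow> ('g, 'u) tamb \<Rightarrow> ('g gset \<Rightarrow> 'u \<Rightarrow> 'u) \<Rightarrow> ('g gset \<Rightarrow> 'u \<Rightarrow> 'u) \<Rightarrow> ('g gset \<Rightarrow> 'u \<Rightarrow> 'u)
   \<Rightarrow> ('g, 'u) tamb \<Rightarrow> ('g gset \<Rightarrow> 'u \<Rightarrow> 'u) \<Rightarrow> ('g gset \<Rightarrow> 'u \<Rightarrow> 'u) \<Rightarrow> bool" where
  "is_algebra_coequalizer G R A \<alpha> B \<beta> u v S \<phi> c \<longleftrightarrow>
     algebra_hom G R A \<alpha> B \<beta> u \<and> algebra_hom G R A \<alpha> B \<beta> v \<and> algebra_hom G R B \<beta> S \<phi> c \<and>
     agree G (lev A) (\<lambda>X a. c X (u X a)) (\<lambda>X a. c X (v X a)) \<and>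
     (\<forall>T \<theta> d. algebra_hom G R B \<beta> T \<theta> d \<longrightarrow>
        agree G (lev A) (\<lambda>X a. d X (u X a)) (\<lambda>X a. d X (v X a)) \<longrightarrow>
        (let factors = (\<lambda>k. algebra_hom G R S \<phi> T \<theta> k \<and> agree G (lev B) (\<lambda>X b. k X (c X b)) d)
         in (\<exists>k. factors k) \<and>
            (\<forall>k k'. factors k \<longrightarrow> factors k' \<longrightarrow> agree G (lev S) k k')))"

definition finitely_presented ::
  "'g monoid \<Rightarrow> ('g, 'u) tamb \<Rightarrow> ('g, 'u) tamb \<Rightarrow> ('g gset \<Rightarrow> 'u \<Rightarrow> 'u) \<Rightarrow> bool" where
  "finitely_presented G R S \<phi> \<longleftrightarrow>
     (\<exists>Xs A \<alpha> xs Ys B \<beta> ys u v c.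
        is_free_algebra G R Xs A \<alpha> xs \<and> is_free_algebra G R Ys B \<beta> ys \<and>
        is_algebra_coequalizer G R A \<alpha> B \<beta> u v S \<phi> c)"

text \<open>The map of box products induced by \<open>f : M \<rightarrow> N\<close> in the second variable, for box products
  \<open>(P, \<beta>)\<close> of \<open>L\<close> with \<open>M\<close> and \<open>(Q, \<gamma>)\<close> of \<open>L\<close> with \<open>N\<close>.\<close>

definition induced_box_map ::
  "'g monoid \<Rightarrow> ('g, 'u) tamb \<Rightarrow> ('g, 'u) gmodule \<Rightarrow> ('g, 'u) gmodule \<Rightarrow> ('g gset \<Rightarrow> 'u \<Rightarrow> 'u)
   \<Rightarrow> ('g, 'u) gmodule \<Rightarrow> ('g gset \<Rightarrow> 'u \<Rightarrow> 'u \<Rightarrow> 'u)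
   \<Rightarrow> ('g, 'u) gmodule \<Rightarrow> ('g gset \<Rightarrow> 'u \<Rightarrow> 'u \<Rightarrow> 'u) \<Rightarrow> ('g gset \<Rightarrow> 'u \<Rightarrow> 'u) \<Rightarrow> bool" where
  "induced_box_map G R L M f P \<beta> Q \<gamma> h \<longleftrightarrow>
     gmodule_hom G R P Q h \<and>
     (\<forall>X. fin_gset G X \<longrightarrow>
        (\<forall>l\<in>carrier (mlev L X). \<forall>m\<in>carrier (mlev M X). h X (\<beta> X l m) = \<gamma> X l (f X m)))"

text \<open>Box products and induced maps are unique up to unique isomorphism, so the choice
  of \<open>P\<^sub>1\<close>, \<open>P\<^sub>2\<close>, \<open>P\<^sub>3\<close> does not matter.\<close>

definition flat_algebra ::
  "'g monoid \<Rightarrow> ('g, 'u) tamb \<Rightarrow> ('g, 'u) tamb \<Rightarrow> ('g gset \<Rightarrow> 'u \<Rightarrow> 'u) \<Rightarrow> bool" where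
  "flat_algebra G R S \<phi> \<longleftrightarrow>
     tambara_hom G R S \<phi> \<and>
     (\<forall>M\<^sub>1 M\<^sub>2 M\<^sub>3 f\<^sub>1 f\<^sub>2. gmodule_exact G R M\<^sub>1 M\<^sub>2 M\<^sub>3 f\<^sub>1 f\<^sub>2 \<longrightarrow>
        (\<exists>P\<^sub>1 \<beta>\<^sub>1 P\<^sub>2 \<beta>\<^sub>2 P\<^sub>3 \<beta>\<^sub>3 h\<^sub>1 h\<^sub>2.
           is_box_product G R (alg_module S \<phi>) M\<^sub>1 P\<^sub>1 \<beta>\<^sub>1 \<and>
           is_box_product G R (alg_module S \<phi>) M\<^sub>2 P\<^sub>2 \<beta>\<^sub>2 \<and>
           is_box_product G R (alg_module S \<phi>) M\<^sub>3 P\<^sub>3 \<beta>\<^sub>3 \<and>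
           induced_box_map G R (alg_module S \<phi>) M\<^sub>1 f\<^sub>1 P\<^sub>1 \<beta>\<^sub>1 P\<^sub>2 \<beta>\<^sub>2 h\<^sub>1 \<and>
           induced_box_map G R (alg_module S \<phi>) M\<^sub>2 f\<^sub>2 P\<^sub>2 \<beta>\<^sub>2 P\<^sub>3 \<beta>\<^sub>3 h\<^sub>2 \<and>
           gmodule_exact G R P\<^sub>1 P\<^sub>2 P\<^sub>3 h\<^sub>1 h\<^sub>2))"

text \<open>\<open>T\<close> is the relative box product of \<open>S\<close> with itself over \<open>R\<close> as a Tambara functor: \<open>i\<^sub>1\<close> and \<open>i\<^sub>2\<close>
  send \<open>s\<close> to the classes of \<open>s \<otimes> 1\<close> and \<open>1 \<otimes> s\<close>. The norms of \<open>T\<close> are determined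
  by those of \<open>S\<close>, because \<open>i\<^sub>1\<close> and \<open>i\<^sub>2\<close> are maps of Tambara functors.\<close>

definition is_self_box ::
  "'g monoid \<Rightarrow> ('g, 'u) tamb \<Rightarrow> ('g, 'u) tamb \<Rightarrow> ('g gset \<Rightarrow> 'u \<Rightarrow> 'u)
   \<Rightarrow> ('g, 'u) tamb \<Rightarrow> ('g gset \<Rightarrow> 'u \<Rightarrow> 'u) \<Rightarrow> ('g gset \<Rightarrow> 'u \<Rightarrow> 'u) \<Rightarrow> bool" where
  "is_self_box G R S \<phi> T i\<^sub>1 i\<^sub>2 \<longleftrightarrow>
     tambara_hom G R S \<phi> \<and> tambara_hom G S T i\<^sub>1 \<and> tambara_hom G S T i\<^sub>2 \<and>
     agree G (lev R) (\<lambda>X a. i\<^sub>1 X (\<phi> X a)) (\<lambda>X a. i\<^sub>2 X (\<phi> X a)) \<and>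
     is_box_product G R (alg_module S \<phi>) (alg_module S \<phi>) (alg_module T (\<lambda>X a. i\<^sub>1 X (\<phi> X a)))
       (\<lambda>X s t. i\<^sub>1 X s \<otimes>\<^bsub>lev T X\<^esub> i\<^sub>2 X t)"

definition multiplication_map ::
  "'g monoid \<Rightarrow> ('g, 'u) tamb \<Rightarrow> ('g, 'u) tamb \<Rightarrow> ('g gset \<Rightarrow> 'u \<Rightarrow> 'u) \<Rightarrow> ('g gset \<Rightarrow> 'u \<Rightarrow> 'u)
   \<Rightarrow> ('g gset \<Rightarrow> 'u \<Rightarrow> 'u) \<Rightarrow> bool" where
  "multiplication_map G S T i\<^sub>1 i\<^sub>2 \<mu> \<longleftrightarrow>
     tambara_hom G T S \<mu> \<and>
     (\<forall>X. fin_gset G X \<longrightarrow> (\<forall>s\<in>carrier (lev S X). \<forall>t\<in>carrier (lev S X).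
        \<mu> X (i\<^sub>1 X s \<otimes>\<^bsub>lev T X\<^esub> i\<^sub>2 X t) = s \<otimes>\<^bsub>lev S X\<^esub> t))"

definition tambara_kernel ::
  "'g monoid \<Rightarrow> ('g, 'u) tamb \<Rightarrow> ('g, 'u) tamb \<Rightarrow> ('g gset \<Rightarrow> 'u \<Rightarrow> 'u) \<Rightarrow> 'g gset \<Rightarrow> 'u set" where
  "tambara_kernel G T S \<mu> X =
     (if fin_gset G X then {a \<in> carrier (lev T X). \<mu> X a = \<zero>\<^bsub>lev S X\<^esub>} else {})"

text \<open>The ideal \<open>I\<^sup>>\<^sup>1\<close>.\<close>

definition norm_power ::
  "'g monoid \<Rightarrow> ('g, 'u) tamb \<Rightarrow> ('g gset \<Rightarrow> 'u set) \<Rightarrow> 'g gset \<Rightarrow> 'u set" where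
  "norm_power G T I =
     tideal_gen G T (\<lambda>Y. {nrm T X Y h a | X h a.
        gmap G X Y h \<and> (\<forall>y\<in>pts Y. 2 \<le> card {x \<in> pts X. h x = y}) \<and> a \<in> I X})"

text \<open>The quotient \<open>I / I\<^sup>>\<^sup>1\<close> at level \<open>X\<close>, as a set of cosets; its zero is the coset \<open>I\<^sup>>\<^sup>1 X\<close>.\<close>

definition kaehler ::
  "'g monoid \<Rightarrow> ('g, 'u) tamb \<Rightarrow> ('g gset \<Rightarrow> 'u set) \<Rightarrow> 'g gset \<Rightarrow> 'u set set" where
  "kaehler G T I X = (\<lambda>a. a_r_coset (lev T X) (norm_power G T I X) a) ` I X"

definition kaehler_vanishes ::
  "'g monoid \<Rightarrow> ('g, 'u) tamb \<Rightarrow> ('g, 'u) tamb \<Rightarrow> ('g gset \<Rightarrow> 'u \<Rightarrow> 'u) \<Rightarrow> bool" where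
  "kaehler_vanishes G R S \<phi> \<longleftrightarrow>
     (\<exists>T i\<^sub>1 i\<^sub>2 \<mu>.
        is_self_box G R S \<phi> T i\<^sub>1 i\<^sub>2 \<and> multiplication_map G S T i\<^sub>1 i\<^sub>2 \<mu> \<and>
        (let I = tambara_kernel G T S \<mu>
         in \<forall>X. fin_gset G X \<longrightarrow> kaehler G T I X = {norm_power G T I X}))"

definition etale ::
  "'g monoid \<Rightarrow> ('g, 'u) tamb \<Rightarrow> ('g, 'u) tamb \<Rightarrow> ('g gset \<Rightarrow> 'u \<Rightarrow> 'u) \<Rightarrow> bool" where
  "etale G R S \<phi> \<longleftrightarrow>
     tambara_hom G R S \<phi> \<and> finitely_presented G R S \<phi> \<and> flat_algebra G R S \<phi> \<and>
     kaehler_vanishes G R S \<phi>"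

definition dedekind_group :: "'g monoid \<Rightarrow> bool" where
  "dedekind_group G \<longleftrightarrow> group G \<and> (\<forall>H. subgroup H G \<longrightarrow> H \<lhd> G)"


section \<open>The Nakaoka spectrum is a topological space\<close>

lemma unit_tideal_ideal:
  assumes "tambara G R" shows "tambara_ideal G R (unit_tideal G R)"
proof -
  interpret tambara G R by fact
  have 1: "ideal (carrier (lev R X)) (lev R X)" if "fin_gset G X" for X
    using level_cring[OF that] by (simp add: cring.axioms(1) ring.oneideal)
  have 2: "rst R X Y f a \<in> carrier (lev R X)"
    if "gmap G X Y f" "a \<in> carrier (lev R Y)" for X Y f a
    using ring_hom_closed[OF rst_ring_hom[OF that(1)] that(2)] .
  have 3: "nrm R X Y f a \<in> carrier (lev R Y)" "trf R X Y f a \<in> carrier (lev R Y)"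
    if "gmap G X Y f" "a \<in> carrier (lev R X)" for X Y f a
    using hom_in_carrier[OF nrm_hom[OF that(1)] that(2)] hom_in_carrier[OF trf_hom[OF that(1)]] that(2)
    by simp_all
  have u: "unit_tideal G R X = carrier (lev R X)" if "trans_gset G X" for X
    using that by (simp add: unit_tideal_def trans_gset_def)
  show ?thesis
    unfolding tambara_ideal_def
  proof (intro conjI allI impI)
    fix X assume "trans_gset G X"
    then show "ideal (unit_tideal G R X) (lev R X)" using 1 u by (simp add: trans_gset_def)
  next
    fix X Y f assume h: "trans_gset G X" "trans_gset G Y" "gmap G X Y f"
    show "rst R X Y f ` unit_tideal G R Y \<subseteq> unit_tideal G R X"
      unfolding u[OF h(1)] u[OF h(2)] using 2[OF h(3)] by blast
    show "trf R X Y f ` unit_tideal G R X \<subseteq> unit_tideal G R Y"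
      unfolding u[OF h(1)] u[OF h(2)] using 3(2)[OF h(3)] by blast
    show "nrm R X Y f ` unit_tideal G R X \<subseteq> unit_tideal G R Y"
      unfolding u[OF h(1)] u[OF h(2)] using 3(1)[OF h(3)] by blast
  next
    fix X
    have "rst R Q X i a \<in> unit_tideal G R Q"
      if "trans_gset G Q" "gmap G Q X i" "a \<in> carrier (lev R X)" for Q i a
      unfolding u[OF that(1)] using 2[OF that(2,3)] .
    then show "unit_tideal G R X = (if fin_gset G X
        then {a \<in> carrier (lev R X).
          \<forall>Q i. trans_gset G Q \<longrightarrow> gmap G Q X i \<longrightarrow> rst R Q X i a \<in> unit_tideal G R Q}
        else {})"
      unfolding unit_tideal_def[of G R X] by (cases "fin_gset G X") (simp_all, blast)
  qed
qed

lemmas tambara_ideal_level = tambara_ideal_def[THEN iffD1, THEN conjunct1, rule_format]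

lemmas tambara_ideal_eq =
  tambara_ideal_def[THEN iffD1, THEN conjunct2, THEN conjunct2, THEN spec]

lemmas tambara_ideal_closed =
  tambara_ideal_def[THEN iffD1, THEN conjunct2, THEN conjunct1, rule_format]

lemma tambara_ideal_Inter:
  assumes "tambara G R" "\<I> \<noteq> {}" "\<And>I. I \<in> \<I> \<Longrightarrow> tambara_ideal G R I"
  shows "tambara_ideal G R (\<lambda>X. \<Inter>I\<in>\<I>. I X)"
proof -
  interpret tambara G R by fact
  have 1: "ideal (\<Inter>I\<in>\<I>. I X) (lev R X)" if "trans_gset G X" for X
  proof -
    have "ring (lev R X)" using that level_cring by (simp add: trans_gset_def cring.axioms(1))
    from ring.i_Intersect[OF this, of "(\<lambda>I. I X) ` \<I>"] show ?thesis
      using assms(2) tambara_ideal_level[OF assms(3) that] by auto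
  qed
  have 2: "rst R X Y f ` (\<Inter>I\<in>\<I>. I Y) \<subseteq> (\<Inter>I\<in>\<I>. I X) \<and>
      trf R X Y f ` (\<Inter>I\<in>\<I>. I X) \<subseteq> (\<Inter>I\<in>\<I>. I Y) \<and> nrm R X Y f ` (\<Inter>I\<in>\<I>. I X) \<subseteq> (\<Inter>I\<in>\<I>. I Y)"
    if h: "trans_gset G X" "trans_gset G Y" "gmap G X Y f" for X Y f
  proof -
    have "rst R X Y f ` I Y \<subseteq> I X \<and> trf R X Y f ` I X \<subseteq> I Y \<and> nrm R X Y f ` I X \<subseteq> I Y"
      if "I \<in> \<I>" for I
      using tambara_ideal_closed[OF assms(3)[OF that] h] .
    then have "\<forall>I\<in>\<I>. (\<forall>a\<in>I Y. rst R X Y f a \<in> I X) \<and>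
        (\<forall>a\<in>I X. trf R X Y f a \<in> I Y) \<and> (\<forall>a\<in>I X. nrm R X Y f a \<in> I Y)"
      by (simp add: image_subset_iff)
    then show ?thesis by (simp add: image_subset_iff)
  qed
  have 3: "(\<Inter>I\<in>\<I>. I X) = (if fin_gset G X
        then {a \<in> carrier (lev R X).
          \<forall>Q i. trans_gset G Q \<longrightarrow> gmap G Q X i \<longrightarrow> rst R Q X i a \<in> (\<Inter>I\<in>\<I>. I Q)}
        else {})" (is "_ = ?r") for X
  proof -
    have eq: "I X = (if fin_gset G X
        then {a \<in> carrier (lev R X). \<forall>Q i. trans_gset G Q \<longrightarrow> gmap G Q X i \<longrightarrow> rst R Q X i a \<in> I Q}
        else {})" if "I \<in> \<I>" for I
      using assms(3)[OF that] by (rule tambara_ideal_eq)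
    obtain I\<^sub>0 where "I\<^sub>0 \<in> \<I>" using assms(2) by blast
    have mem: "a \<in> I X \<longleftrightarrow> fin_gset G X \<and> a \<in> carrier (lev R X) \<and>
        (\<forall>Q i. trans_gset G Q \<longrightarrow> gmap G Q X i \<longrightarrow> rst R Q X i a \<in> I Q)" if "I \<in> \<I>" for I a
      by (subst eq[OF that]) simp
    show ?thesis
    proof (rule Set.set_eqI)
      fix a
      have "a \<in> (\<Inter>I\<in>\<I>. I X) \<longleftrightarrow> (\<forall>I\<in>\<I>. fin_gset G X \<and> a \<in> carrier (lev R X) \<and>
          (\<forall>Q i. trans_gset G Q \<longrightarrow> gmap G Q X i \<longrightarrow> rst R Q X i a \<in> I Q))"
        unfolding INT_iff using mem by (rule ball_cong[OF refl])
      also have "\<dots> \<longleftrightarrow> fin_gset G X \<and> a \<in> carrier (lev R X) \<and>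
          (\<forall>Q i. trans_gset G Q \<longrightarrow> gmap G Q X i \<longrightarrow> (\<forall>I\<in>\<I>. rst R Q X i a \<in> I Q))"
        using \<open>I\<^sub>0 \<in> \<I>\<close> by blast
      also have "\<dots> \<longleftrightarrow> a \<in> ?r" by simp
      finally show "a \<in> (\<Inter>I\<in>\<I>. I X) \<longleftrightarrow> a \<in> ?r" .
    qed
  qed
  show ?thesis
    unfolding tambara_ideal_def
    by (rule conjI, intro allI impI, rule 1, assumption, rule conjI, intro allI impI, rule 2,
        assumption+, rule allI, rule 3)
qed

lemma tambara_ideal_le_unit:
  assumes "tambara_ideal G R I" shows "I \<le> unit_tideal G R"
proof (intro le_funI)
  fix X
  have "I X = (if fin_gset G X
        then {a \<in> carrier (lev R X). \<forall>Q i. trans_gset G Q \<longrightarrow> gmap G Q X i \<longrightarrow> rst R Q X i a \<in> I Q}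
        else {})"
    using assms by (rule tambara_ideal_eq)
  then show "I X \<le> unit_tideal G R X"
    by (cases "fin_gset G X") (simp_all add: unit_tideal_def subset_iff)
qed

lemma tideal_gen_ideal:
  assumes "tambara G R" "A \<le> unit_tideal G R"
  shows "tambara_ideal G R (tideal_gen G R A)"
proof -
  have eq: "tideal_gen G R A = (\<lambda>X. \<Inter>I\<in>{I. tambara_ideal G R I \<and> A \<le> I}. I X)"
    unfolding tideal_gen_def by (rule ext) blast
  have "unit_tideal G R \<in> {I. tambara_ideal G R I \<and> A \<le> I}"
    using unit_tideal_ideal[OF assms(1)] assms(2) by (intro CollectI conjI)
  then have "tambara_ideal G R (\<lambda>X. \<Inter>I\<in>{I. tambara_ideal G R I \<and> A \<le> I}. I X)"
    by (intro tambara_ideal_Inter[OF assms(1)]) (blast, erule CollectE, erule conjunct1)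
  then show ?thesis by (simp only: eq)
qed

lemma tideal_gen_superset: "A \<le> tideal_gen G R A"
  by (auto simp: tideal_gen_def le_fun_def)

lemma tideal_gen_least: "tambara_ideal G R I \<Longrightarrow> A \<le> I \<Longrightarrow> tideal_gen G R A \<le> I"
  by (auto simp: tideal_gen_def le_fun_def)

lemma level_prod_le:
  assumes "tambara G R" "tambara_ideal G R I" "tambara_ideal G R J"
  shows "(\<lambda>X. if trans_gset G X then ideal_prod (lev R X) (I X) (J X) else {}) \<le> I"
    and "(\<lambda>X. if trans_gset G X then ideal_prod (lev R X) (I X) (J X) else {}) \<le> J"
proof -
  interpret tambara G R by fact
  have "ideal_prod (lev R X) (I X) (J X) \<subseteq> I X \<inter> J X" if "trans_gset G X" for X
  proof -
    have "ring (lev R X)" using that level_cring by (simp add: trans_gset_def cring.axioms(1))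
    then show ?thesis
      using ring.ideal_prod_inter tambara_ideal_level[OF assms(2) that]
        tambara_ideal_level[OF assms(3) that] by blast
  qed
  then show "(\<lambda>X. if trans_gset G X then ideal_prod (lev R X) (I X) (J X) else {}) \<le> I"
    "(\<lambda>X. if trans_gset G X then ideal_prod (lev R X) (I X) (J X) else {}) \<le> J"
    by (auto simp: le_fun_def)
qed

lemma istopology_nakaoka:
  assumes "tambara G R"
  shows "istopology (\<lambda>U. \<exists>I. tambara_ideal G R I \<and> U = Spec G R - vanishing G R I)"
    (is "istopology ?O")
  unfolding istopology_def
proof (intro conjI allI impI)
  fix U V assume "?O U" "?O V"
  then obtain I J where I: "tambara_ideal G R I" "U = Spec G R - vanishing G R I"
    and J: "tambara_ideal G R J" "V = Spec G R - vanishing G R J" by auto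
  let ?K = "tideal_prod G R I J"
  note le = level_prod_le[OF assms I(1) J(1)]
  have K: "tambara_ideal G R ?K" "?K \<le> I" "?K \<le> J"
    unfolding tideal_prod_def
    by (rule tideal_gen_ideal[OF assms order_trans[OF le(1) tambara_ideal_le_unit[OF I(1)]]],
        rule tideal_gen_least[OF I(1) le(1)], rule tideal_gen_least[OF J(1) le(2)])
  have "I \<le> P \<or> J \<le> P \<longleftrightarrow> ?K \<le> P" if "P \<in> Spec G R" for P
  proof -
    have "?K \<le> P \<Longrightarrow> I \<le> P \<or> J \<le> P"
      using that I(1) J(1) unfolding Spec_def tambara_prime_def by blast
    then show ?thesis using order_trans[OF K(2), of P] order_trans[OF K(3), of P] by argo
  qed
  then have "U \<inter> V = Spec G R - vanishing G R ?K"
    unfolding I(2) J(2) vanishing_def by blast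
  then show "?O (U \<inter> V)" using K(1) by blast
next
  fix \<U> assume "\<forall>U\<in>\<U>. ?O U"
  then obtain f where f: "\<And>U. U \<in> \<U> \<Longrightarrow> tambara_ideal G R (f U)"
    "\<And>U. U \<in> \<U> \<Longrightarrow> U = Spec G R - vanishing G R (f U)" by metis
  let ?A = "\<lambda>X. \<Union>U\<in>\<U>. f U X"
  have "?A \<le> unit_tideal G R"
    using tambara_ideal_le_unit[OF f(1)] by (force simp: le_fun_def)
  note K = tideal_gen_ideal[OF assms this]
  have "tideal_gen G R ?A \<le> P \<longleftrightarrow> (\<forall>U\<in>\<U>. f U \<le> P)" if "P \<in> Spec G R" for P
  proof -
    have "tideal_gen G R ?A \<le> P \<longleftrightarrow> ?A \<le> P"
      using that order_trans[OF tideal_gen_superset[of ?A G R], of P] tideal_gen_least[of G R P ?A]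
      unfolding Spec_def tambara_prime_def by blast
    also have "\<dots> \<longleftrightarrow> (\<forall>U\<in>\<U>. f U \<le> P)" by (auto simp: le_fun_def)
    finally show ?thesis .
  qed
  then have "Spec G R - vanishing G R (tideal_gen G R ?A)
      = (\<Union>U\<in>\<U>. Spec G R - vanishing G R (f U))"
    unfolding vanishing_def by auto
  also have "\<dots> = (\<Union>U\<in>\<U>. U)" by (rule SUP_cong[OF refl]) (rule f(2)[symmetric])
  also have "\<dots> = \<Union>\<U>" by simp
  finally have "\<Union>\<U> = Spec G R - vanishing G R (tideal_gen G R ?A)" by (rule sym)
  then show "?O (\<Union>\<U>)" using K by blast
qed

lemma openin_nakaoka_spec:
  assumes "tambara G R"
  shows "openin (nakaoka_spec G R) U \<longleftrightarrow>
    (\<exists>I. tambara_ideal G R I \<and> U = Spec G R - vanishing G R I)"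
  unfolding nakaoka_spec_def topology_inverse'[OF istopology_nakaoka[OF assms]] ..

end

theory Submission
  imports Defs "HOL-Analysis.Finite_Cartesian_Product" "HOL-Algebra.RingHom"
begin

text \<open>Let \<open>R\<close> be the ghost Tambara functor with values in \<open>\<bbbF>\<^sub>2\<close>: an element of \<open>R(X)\<close> is a \<open>G\<close>-invariant function on the
  pairs \<open>(H, x)\<close> with \<open>H\<close> a subgroup of \<open>G\<close> and \<open>x\<close> an \<open>H\<close>-fixed point of \<open>X\<close>. Restricting to
  \<open>H = 1\<close> gives a map from \<open>R\<close> to the fixed point functor \<open>S\<close> of \<open>\<bbbF>\<^sub>2\<close>. The kernel is generated by an
  idempotent at the level of a point, so base change to \<open>S\<close> is multiplication by the complementary idempotent,
  the box square of \<open>S\<close> is \<open>S\<close> itself, and the map is etale. Every nonzero element of \<open>S\<close> has a norm of a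
  restriction equal to 1. Hence the spectrum of \<open>S\<close> is a point, and it maps to a closed point of the spectrum of \<open>R\<close>,
  the kernel. The zero ideal of \<open>R\<close> is prime as well, since the norm from \<open>G/H\<close> to a point moves the value at the pair
  \<open>(H, H)\<close> to the pair of \<open>G\<close> and the point. For nontrivial \<open>G\<close> it is strictly contained in the kernel, so that
  the image is not stable under generization and not open.\<close>

text \<open>For commutative rings, passing to the quotient by an idempotent gives a clopen immersion
  of spectra. Here the norms break this. Extension by zero from \<open>H = 1\<close> to all
  subgroups commutes with restrictions and transfers, but a norm at \<open>(H, y)\<close> reads
  values at stabilizers inside \<open>H\<close>, and these may be trivial. So the idempotent splits
  \<open>R\<close> as a Green functor, which is all that flatness and the box square see, but not as
  a Tambara functor. The same mixing makes the zero ideal prime although the levels of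
  \<open>R\<close> have zero divisors.

  The field with two elements is chosen since its elements satisfy x^n = x and 1 is its only nonzero
  element: a factor per orbit may be replaced by a factor per point, and a product of nonzero values
  is 1 outright.

  For trivial \<open>G\<close>, Tambara functors are commutative rings, whose etale maps are open;
  hence \<open>G\<close> is assumed nontrivial.

  The universal properties test against objects over a fixed type \<open>'u\<close> that is only
  known to be infinite. Hence functors are built on a convenient type, shown to be levelwise
  countable, and carried over to \<open>'u\<close>.\<close>

lemma odd_card_sym_diff:
  assumes "finite A" "finite B"
  shows "odd (card ((A - B) \<union> (B - A))) \<longleftrightarrow> odd (card A) \<noteq> odd (card B)"
proof -
  have "card ((A - B) \<union> (B - A)) = card (A - B) + card (B - A)"
    using assms by (intro card_Un_disjoint) auto
  moreover have "card A = card (A - B) + card (A \<inter> B)" "card B = card (B - A) + card (A \<inter> B)"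
    using assms by (subst card_Un_disjoint[symmetric]; auto intro: arg_cong[where f = card])+
  ultimately show ?thesis by presburger
qed

section \<open>Finite G-sets\<close>

locale finite_group = group G for G :: "'a monoid" (structure) +
  assumes finite_carrier: "finite (carrier G)"
begin

text \<open>\<open>group_action\<close> asks for a homomorphism into the group of bijections. The
  unit and multiplication laws suffice, because the action of \<open>inv g\<close> inverts that of
  \<open>g\<close>.\<close>

lemma fin_gset_intro:
  assumes "finite (pts X)" "act X \<in> extensional (carrier G)"
    and "\<And>g. g \<in> carrier G \<Longrightarrow> act X g \<in> pts X \<rightarrow>\<^sub>E pts X"
    and one: "\<And>x. x \<in> pts X \<Longrightarrow> act X \<one> x = x"
    and mult: "\<And>g h x. g \<in> carrier G \<Longrightarrow> h \<in> carrier G \<Longrightarrow> x \<in> pts X \<Longrightarrow>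
      act X (g \<otimes> h) x = act X g (act X h x)"
  shows "fin_gset G X"
proof -
  have B: "act X g \<in> Bij (pts X)" if "g \<in> carrier G" for g
  proof -
    have "bij_betw (act X g) (pts X) (pts X)"
      by (rule bij_betw_byWitness[where f' = "act X (inv g)"])
        (use that assms(3)[of g] assms(3)[of "inv g"] mult[of g "inv g"] mult[of "inv g" g] one in auto)
    then show ?thesis using assms(3)[OF that] by (simp add: Bij_def PiE_iff)
  qed
  have "act X \<in> hom G (BijGroup (pts X))"
  proof (rule homI)
    fix g h assume gh: "g \<in> carrier G" "h \<in> carrier G"
    have "act X (g \<otimes> h) = compose (pts X) (act X g) (act X h)"
      by (rule extensionalityI[of _ "pts X"])
        (use assms(3)[OF m_closed[OF gh]] mult[OF gh] in \<open>auto simp: compose_def PiE_iff\<close>)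
    then show "act X (g \<otimes> h) = act X g \<otimes>\<^bsub>BijGroup (pts X)\<^esub> act X h"
      using B gh by (simp add: BijGroup_def)
  qed (use B in \<open>simp add: BijGroup_def\<close>)
  then have "group_action G (pts X) (act X)"
    unfolding group_action_def group_hom_def group_hom_axioms_def
    using group_BijGroup group_axioms by blast
  then show ?thesis using assms by (simp add: fin_gset_def)
qed

lemma gset_finite: "fin_gset G X \<Longrightarrow> finite (pts X)"
  by (simp add: fin_gset_def)

lemma gset_act_closed: "fin_gset G X \<Longrightarrow> g \<in> carrier G \<Longrightarrow> x \<in> pts X \<Longrightarrow> act X g x \<in> pts X"
  using group_action.element_image by (fastforce simp: fin_gset_def)

lemma gset_act_one: "fin_gset G X \<Longrightarrow> x \<in> pts X \<Longrightarrow> act X \<one> x = x"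
  using group_action.id_eq_one[of G "pts X" "act X"] by (metis fin_gset_def restrict_apply')

lemma gset_act_mult: "fin_gset G X \<Longrightarrow> g \<in> carrier G \<Longrightarrow> h \<in> carrier G \<Longrightarrow> x \<in> pts X \<Longrightarrow>
    act X (g \<otimes> h) x = act X g (act X h x)"
  using group_action.composition_rule by (fastforce simp: fin_gset_def)

lemma gset_act_ext: "fin_gset G X \<Longrightarrow> g \<in> carrier G \<Longrightarrow> act X g \<in> extensional (pts X)"
  using group_action.bij_prop0[of G "pts X" "act X" g] by (simp add: fin_gset_def Bij_def)

lemma gset_act_inv:
  assumes "fin_gset G X" "g \<in> carrier G" "x \<in> pts X"
  shows "act X (inv g) (act X g x) = x" "act X g (act X (inv g) x) = x"
  using assms gset_act_mult[of X "inv g" g x] gset_act_mult[of X g "inv g" x]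
  by (simp_all add: gset_act_one)

lemma gset_act_inj:
  assumes "fin_gset G X" "g \<in> carrier G" "x \<in> pts X" "y \<in> pts X" "act X g x = act X g y"
  shows "x = y"
  by (metis assms gset_act_inv(1))

lemma gmap_src: "gmap G X Y f \<Longrightarrow> fin_gset G X"
  and gmap_tgt: "gmap G X Y f \<Longrightarrow> fin_gset G Y"
  and gmap_closed: "gmap G X Y f \<Longrightarrow> x \<in> pts X \<Longrightarrow> f x \<in> pts Y"
  and gmap_act: "gmap G X Y f \<Longrightarrow> g \<in> carrier G \<Longrightarrow> x \<in> pts X \<Longrightarrow> f (act X g x) = act Y g (f x)"
  by (auto simp: gmap_def PiE_iff)

section \<open>The point and transitive G-sets\<close>

definition pt :: "'a gset" where
  "pt = \<lparr>pts = {0}, act = (\<lambda>g\<in>carrier G. \<lambda>x\<in>{0}. 0)\<rparr>"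

definition to_pt :: "'a gset \<Rightarrow> nat \<Rightarrow> nat" where
  "to_pt X = (\<lambda>x\<in>pts X. 0)"

lemma pts_pt [simp]: "pts pt = {0}"
  by (simp add: pt_def)

lemma act_pt [simp]: "g \<in> carrier G \<Longrightarrow> act pt g 0 = 0"
  by (simp add: pt_def)

lemma fin_pt [simp]: "fin_gset G pt"
  by (rule fin_gset_intro) (auto simp: pt_def)

lemma trans_pt [simp]: "trans_gset G pt"
  using fin_pt one_closed
  by (auto simp: trans_gset_def fin_gset_def transitive_action_def transitive_action_axioms_def)

lemma gmap_to_pt: "fin_gset G X \<Longrightarrow> gmap G X pt (to_pt X)"
  by (auto simp: gmap_def to_pt_def gset_act_closed)

lemma trans_fin: "trans_gset G X \<Longrightarrow> fin_gset G X"
  by (simp add: trans_gset_def)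

lemma trans_ne: "trans_gset G X \<Longrightarrow> pts X \<noteq> {}"
  by (simp add: trans_gset_def)

lemma trans_act: "trans_gset G X \<Longrightarrow> x \<in> pts X \<Longrightarrow> y \<in> pts X \<Longrightarrow> \<exists>g\<in>carrier G. act X g x = y"
  by (metis trans_gset_def transitive_action.unique_orbit)

text \<open>The image is nonempty and closed under a transitive action. Surjectivity is what later
  makes norms of zero vanish, since an empty fibre would contribute an empty product.\<close>

lemma gmap_trans_surj:
  assumes "gmap G X Y f" "trans_gset G X" "trans_gset G Y" "y \<in> pts Y"
  shows "\<exists>x\<in>pts X. f x = y"
proof -
  obtain x where x: "x \<in> pts X" using trans_ne assms by blast
  obtain g where "g \<in> carrier G" "act Y g (f x) = y"
    using trans_act[OF assms(3) gmap_closed[OF assms(1) x] assms(4)] by blast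
  then show ?thesis using gmap_act[OF assms(1) _ x] gset_act_closed[OF gmap_src[OF assms(1)] _ x] by metis
qed

section \<open>Stabilizers inside a subgroup, conjugation, and orbits\<close>

definition stab :: "'a gset \<Rightarrow> 'a set \<Rightarrow> nat \<Rightarrow> 'a set" where
  "stab X H x = {h \<in> H. act X h x = x}"

definition conj_by :: "'a \<Rightarrow> 'a set \<Rightarrow> 'a set" where
  "conj_by g H = (\<lambda>h. g \<otimes> h \<otimes> inv g) ` H"

lemma stab_subgroup:
  assumes "subgroup H G" "fin_gset G X" "x \<in> pts X"
  shows "subgroup (stab X H x) G"
proof -
  interpret subgroup H G by fact
  show ?thesis
  proof
    show "stab X H x \<subseteq> carrier G" by (auto simp: stab_def)
    show "\<one> \<in> stab X H x" using assms by (simp add: stab_def gset_act_one)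
  next
    fix g h assume "g \<in> stab X H x" "h \<in> stab X H x"
    then show "g \<otimes> h \<in> stab X H x" using assms by (simp add: stab_def gset_act_mult)
  next
    fix g assume "g \<in> stab X H x"
    then show "inv g \<in> stab X H x" using assms gset_act_inv(1)[of X g x] by (simp add: stab_def)
  qed
qed

lemma act_conj:
  assumes "fin_gset G X" "g \<in> carrier G" "h \<in> carrier G" "x \<in> pts X"
  shows "act X (g \<otimes> h \<otimes> inv g) (act X g x) = act X g (act X h x)"
  using assms by (simp add: gset_act_mult gset_act_closed gset_act_inv)

lemma stab_conj:
  assumes "fin_gset G X" "g \<in> carrier G" "H \<subseteq> carrier G" "x \<in> pts X"
  shows "stab X (conj_by g H) (act X g x) = conj_by g (stab X H x)"
proof -
  have "act X (g \<otimes> h \<otimes> inv g) (act X g x) = act X g x \<longleftrightarrow> act X h x = x" if "h \<in> H" for h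
    using act_conj[OF assms(1,2) _ assms(4)] gset_act_inj[OF assms(1,2)] gset_act_closed assms that
    by (metis subsetD)
  then show ?thesis unfolding stab_def conj_by_def by auto
qed

lemma conj_by_inv: "g \<in> carrier G \<Longrightarrow> H \<subseteq> carrier G \<Longrightarrow> conj_by (inv g) (conj_by g H) = H"
  by (simp add: conj_by_def image_image m_assoc subset_iff inv_solve_left' cong: image_cong)
    (simp add: m_assoc[symmetric])

text \<open>Moving along an \<open>H\<close>-orbit conjugates the stabilizers of its points but
  leaves \<open>H\<close> itself in place; this is the second half of that remark,
  \<open>stab_conj\<close> being the first.\<close>

lemma conj_by_self:
  assumes "subgroup H G" "h \<in> H" shows "conj_by h H = H"
proof -
  interpret subgroup H G by fact
  show ?thesis
  proof
    show "conj_by h H \<subseteq> H" using assms by (auto simp: conj_by_def)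
    show "H \<subseteq> conj_by h H"
    proof
      fix k assume "k \<in> H"
      then have "k = h \<otimes> (inv h \<otimes> k \<otimes> h) \<otimes> inv h" "inv h \<otimes> k \<otimes> h \<in> H"
        using assms by (simp_all add: m_assoc inv_solve_left' ) (simp add: m_assoc[symmetric])
      then show "k \<in> conj_by h H" unfolding conj_by_def by blast
    qed
  qed
qed

lemma conj_by_subgroup:
  assumes "subgroup H G" "g \<in> carrier G" shows "subgroup (conj_by g H) G"
proof -
  interpret subgroup H G by fact
  have e: "(g \<otimes> h \<otimes> inv g) \<otimes> (g \<otimes> k \<otimes> inv g) = g \<otimes> (h \<otimes> k) \<otimes> inv g"
    if "h \<in> carrier G" "k \<in> carrier G" for h k
    using that assms(2) by (simp add: m_assoc inv_solve_left')
  show ?thesis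
  proof (rule subgroupI)
    show "conj_by g H \<subseteq> carrier G" using assms by (auto simp: conj_by_def)
    show "conj_by g H \<noteq> {}" using subgroup.one_closed[OF assms(1)] by (metis conj_by_def empty_iff image_is_empty)
  next
    fix a assume "a \<in> conj_by g H"
    then obtain h where "h \<in> H" "a = g \<otimes> h \<otimes> inv g" by (auto simp: conj_by_def)
    then have "inv a = g \<otimes> inv h \<otimes> inv g" "inv h \<in> H"
      using assms by (simp_all add: inv_mult_group m_assoc)
    then show "inv a \<in> conj_by g H" by (auto simp: conj_by_def)
  next
    fix a b assume "a \<in> conj_by g H" "b \<in> conj_by g H"
    then obtain h k where "h \<in> H" "a = g \<otimes> h \<otimes> inv g" "k \<in> H" "b = g \<otimes> k \<otimes> inv g"
      by (auto simp: conj_by_def)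
    then show "a \<otimes> b \<in> conj_by g H" using e by (auto simp: conj_by_def)
  qed
qed

text \<open>Here \<open>Q\<close> is the orbit \<open>G/H\<close>, with its cosets coded by natural numbers.\<close>

lemma orbit_through:
  assumes H: "subgroup H G" and X: "fin_gset G X" and x: "x \<in> pts X" "\<And>h. h \<in> H \<Longrightarrow> act X h x = x"
  obtains Q i q where "trans_gset G Q" "gmap G Q X i" "q \<in> pts Q" "i q = x" "stab Q (carrier G) q = H"
proof -
  have oneG: "\<one> \<in> carrier G" by simp
  interpret subgroup H G by fact
  define E where "E = (\<lambda>g. g <# H) ` carrier G"
  define c where "c = to_nat_on E"
  define d where "d = the_inv_into E c"
  have fE: "finite E" unfolding E_def using finite_carrier by simp
  have inj: "inj_on c E" unfolding c_def using fE by (intro inj_on_to_nat_on countable_finite)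
  have dc: "d (c A) = A" if "A \<in> E" for A unfolding d_def using the_inv_into_f_f[OF inj that] .
  define Q where "Q = \<lparr>pts = c ` E, act = (\<lambda>g\<in>carrier G. \<lambda>n\<in>c ` E. c (g <# d n))\<rparr>"
  have actQ: "act Q g (c (k <# H)) = c ((g \<otimes> k) <# H)" if "g \<in> carrier G" "k \<in> carrier G" for g k
    using that by (simp add: Q_def E_def dc[unfolded E_def] lcos_m_assoc[OF subset])
  have ptsQ: "\<exists>k\<in>carrier G. n = c (k <# H)" if "n \<in> pts Q" for n
    using that by (auto simp: Q_def E_def)
  have inQ: "c (k <# H) \<in> pts Q" if "k \<in> carrier G" for k
    using that by (auto simp: Q_def E_def)
  have finQ: "fin_gset G Q"
  proof (rule fin_gset_intro)
    show "finite (pts Q)" using fE by (simp add: Q_def)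
    show "act Q \<in> extensional (carrier G)" by (simp add: Q_def)
    show "act Q g \<in> pts Q \<rightarrow>\<^sub>E pts Q" if "g \<in> carrier G" for g
    proof
      show "act Q g n \<in> pts Q" if "n \<in> pts Q" for n
        using ptsQ[OF that] inQ actQ \<open>g \<in> carrier G\<close> by auto
      show "act Q g n = undefined" if "n \<notin> pts Q" for n
        using that \<open>g \<in> carrier G\<close> by (simp add: Q_def)
    qed
    show "act Q \<one> n = n" if "n \<in> pts Q" for n using ptsQ[OF that] actQ by auto
    show "act Q (g \<otimes> h) n = act Q g (act Q h n)"
      if "g \<in> carrier G" "h \<in> carrier G" "n \<in> pts Q" for g h n
      using ptsQ[OF that(3)] actQ that by (auto simp: m_assoc)
  qed
  have tr: "\<exists>g\<in>carrier G. act Q g m = n" if mn: "m \<in> pts Q" "n \<in> pts Q" for m n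
  proof -
    obtain k l where k: "k \<in> carrier G" "m = c (k <# H)" and l: "l \<in> carrier G" "n = c (l <# H)"
      using ptsQ mn by blast
    have "act Q (l \<otimes> inv k) m = n" using actQ k l by (simp add: m_assoc)
    then show ?thesis using k l by blast
  qed
  have transQ: "trans_gset G Q"
    using finQ tr inQ[OF oneG]
    by (auto simp: trans_gset_def fin_gset_def transitive_action_def transitive_action_axioms_def)
  have coset_eq: "inv k \<otimes> l \<in> H" if "k \<in> carrier G" "l \<in> carrier G" "c (k <# H) = c (l <# H)" for k l
  proof -
    have "k <# H = l <# H" using inj_onD[OF inj that(3)] that by (auto simp: E_def)
    moreover have "l \<in> l <# H" using that(2) oneG subgroup.one_closed[OF H] by (force simp: l_coset_def)
    ultimately obtain h where "h \<in> H" "l = k \<otimes> h" by (auto simp: l_coset_def)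
    then show ?thesis using that by (simp add: m_assoc[symmetric])
  qed
  \<comment> \<open>The map sends the coset of \<open>k\<close> to \<open>k x\<close>, evaluated at
    a chosen representative. The choice does not matter, because two representatives differ by an
    element of \<open>H\<close>, which fixes \<open>x\<close>.\<close>
  define i where "i = (\<lambda>n\<in>pts Q. act X (SOME k. k \<in> carrier G \<and> c (k <# H) = n) x)"
  have i: "i (c (k <# H)) = act X k x" if k: "k \<in> carrier G" for k
  proof -
    define l where "l = (SOME l. l \<in> carrier G \<and> c (l <# H) = c (k <# H))"
    have "l \<in> carrier G \<and> c (l <# H) = c (k <# H)"
      unfolding l_def by (rule someI[of _ k]) (use k in simp)
    then have l: "l \<in> carrier G" "inv l \<otimes> k \<in> H" using coset_eq k by blast+
    have "act X k x = act X (l \<otimes> (inv l \<otimes> k)) x" using k l by (simp add: m_assoc[symmetric])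
    also have "\<dots> = act X l x" using k l x X by (subst gset_act_mult) auto
    finally show ?thesis using inQ[OF k] by (simp add: i_def l_def)
  qed
  have "gmap G Q X i"
    unfolding gmap_def
  proof (intro conjI ballI)
    show "i \<in> pts Q \<rightarrow>\<^sub>E pts X"
    proof
      show "i n \<in> pts X" if "n \<in> pts Q" for n
        using ptsQ[OF that] i gset_act_closed[OF X _ x(1)] by auto
    qed (simp add: i_def)
    show "i (act Q g n) = act X g (i n)" if "g \<in> carrier G" "n \<in> pts Q" for g n
      using ptsQ[OF that(2)] that actQ i x X by (auto simp: gset_act_mult)
  qed (fact finQ X)+
  moreover have "i (c H) = x"
    using i[OF oneG] gset_act_one[OF X x(1)] by (simp add: lcos_mult_one[OF subset])
  moreover have "stab Q (carrier G) (c H) = H"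
  proof
    show "stab Q (carrier G) (c H) \<subseteq> H"
    proof
      fix g assume "g \<in> stab Q (carrier G) (c H)"
      then have "g \<in> carrier G" "c (\<one> <# H) = c (g <# H)"
        using actQ[of g \<one>] by (auto simp: stab_def lcos_mult_one[OF subset])
      then show "g \<in> H" using coset_eq[of \<one> g] by simp
    qed
    show "H \<subseteq> stab Q (carrier G) (c H)"
    proof
      fix h assume h: "h \<in> H"
      then have "h <# H = H" using coset_join3 H by auto
      then show "h \<in> stab Q (carrier G) (c H)"
        using actQ[of h \<one>] h by (simp add: stab_def lcos_mult_one[OF subset])
    qed
  qed
  moreover have "c H \<in> pts Q" using inQ[OF oneG] by (simp add: lcos_mult_one[OF subset])
  ultimately show ?thesis using that transQ by blast
qed

end

section \<open>Ghost Tambara functors with values in the field with two elements\<close>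

text \<open>An element of the level \<open>X\<close> is a \<open>G\<close>-invariant function to \<open>\<bbbF>\<^sub>2\<close> on the pairs of a subgroup \<open>H\<close> in a family and
  an \<open>H\<close>-fixed point of \<open>X\<close>, represented by its support. For an element \<open>a\<close> that comes from a finite
  \<open>G\<close>-set over \<open>X\<close>, it records the parities of the \<open>H\<close>-fixed points in the fibres. The norm at \<open>(H, y)\<close>
  is a product over the \<open>H\<close>-orbits of the fibre; since the values lie in \<open>\<bbbF>\<^sub>2\<close>,
  it can be taken over all points of the fibre.\<close>

locale subgroup_family = finite_group +
  fixes F :: "'a set set"
  assumes family_subgroup: "H \<in> F \<Longrightarrow> subgroup H G"
    and family_conj: "H \<in> F \<Longrightarrow> g \<in> carrier G \<Longrightarrow> conj_by g H \<in> F"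
    and family_sub: "H \<in> F \<Longrightarrow> subgroup K G \<Longrightarrow> K \<subseteq> H \<Longrightarrow> K \<in> F"
begin

text \<open>A pair \<open>(H, x)\<close> is the same as a map of G-sets from \<open>G/H\<close> to
  \<open>X\<close>, with \<open>x\<close> the image of the coset \<open>H\<close>; conjugating the
  pair changes the base point of the orbit.\<close>

definition fixed_pairs :: "'a gset \<Rightarrow> ('a set \<times> nat) set" where
  "fixed_pairs X = {(H, x). H \<in> F \<and> x \<in> pts X \<and> (\<forall>h\<in>H. act X h x = x)}"

definition invariant_sets :: "'a gset \<Rightarrow> ('a set \<times> nat) set set" where
  "invariant_sets X = {a. a \<subseteq> fixed_pairs X \<and>
     (\<forall>g\<in>carrier G. \<forall>H x. (H, x) \<in> a \<longrightarrow> (conj_by g H, act X g x) \<in> a)}"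

text \<open>These are the formulas for marks. An \<open>H\<close>-fixed point of a set over
  \<open>X\<close>, pushed forward to \<open>Y\<close>, lies over an \<open>H\<close>-fixed point of
  \<open>X\<close>, whence the count over fixed points in the transfer. An \<open>H\<close>-fixed
  section over a fibre assigns to \<open>x\<close> a point fixed by the stabilizer of
  \<open>x\<close> in \<open>H\<close>, whence \<open>stab X H x\<close> in the norm. An empty fibre
  gives transfer 0 and norm 1.\<close>

definition ghost :: "('a, ('a set \<times> nat) set) tamb" where
  "ghost = \<lparr>
     lev = (\<lambda>X. \<lparr>carrier = invariant_sets X, mult = (\<inter>), one = fixed_pairs X, zero = {},
       add = (\<lambda>a b. (a - b) \<union> (b - a))\<rparr>),
     rst = (\<lambda>X Y f b. {(H, x) \<in> fixed_pairs X. (H, f x) \<in> b}),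
     trf = (\<lambda>X Y f a. {(H, y) \<in> fixed_pairs Y. odd (card {x \<in> pts X. f x = y \<and> (H, x) \<in> a})}),
     nrm = (\<lambda>X Y f a. {(H, y) \<in> fixed_pairs Y. \<forall>x\<in>pts X. f x = y \<longrightarrow> (stab X H x, x) \<in> a})\<rparr>"

abbreviation "grst \<equiv> rst ghost"
abbreviation "gtrf \<equiv> trf ghost"
abbreviation "gnrm \<equiv> nrm ghost"

lemma ghost_lev [simp]: "carrier (lev ghost X) = invariant_sets X" "mult (lev ghost X) = (\<inter>)"
    "one (lev ghost X) = fixed_pairs X" "zero (lev ghost X) = {}"
    "add (lev ghost X) = (\<lambda>a b. (a - b) \<union> (b - a))"
  by (simp_all add: ghost_def)

lemma mem_rst: "(H, x) \<in> grst X Y f b \<longleftrightarrow> (H, x) \<in> fixed_pairs X \<and> (H, f x) \<in> b"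
  and mem_trf: "(H, y) \<in> gtrf X Y f a \<longleftrightarrow>
    (H, y) \<in> fixed_pairs Y \<and> odd (card {x \<in> pts X. f x = y \<and> (H, x) \<in> a})"
  and mem_nrm: "(H, y) \<in> gnrm X Y f a \<longleftrightarrow>
    (H, y) \<in> fixed_pairs Y \<and> (\<forall>x\<in>pts X. f x = y \<longrightarrow> (stab X H x, x) \<in> a)"
  by (simp_all add: ghost_def)

lemma pairs_D:
  assumes "(H, x) \<in> fixed_pairs X"
  shows "H \<in> F" "x \<in> pts X" "h \<in> H \<Longrightarrow> act X h x = x" "H \<subseteq> carrier G"
  using assms family_subgroup subgroup.subset by (auto simp: fixed_pairs_def)

lemma pairs_gmap:
  assumes "gmap G X Y f" "(H, x) \<in> fixed_pairs X" shows "(H, f x) \<in> fixed_pairs Y"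
  using gmap_closed[OF assms(1)] gmap_act[OF assms(1), symmetric] pairs_D[OF assms(2)]
  by (auto simp: fixed_pairs_def subset_iff)

lemma pairs_act:
  assumes "fin_gset G X" "g \<in> carrier G" "(H, x) \<in> fixed_pairs X"
  shows "(conj_by g H, act X g x) \<in> fixed_pairs X"
proof -
  note D = pairs_D[OF assms(3)]
  have "act X k (act X g x) = act X g x" if "k \<in> conj_by g H" for k
    using that act_conj[OF assms(1,2)] D by (auto simp: conj_by_def subset_iff)
  then show ?thesis using assms D by (simp add: fixed_pairs_def family_conj gset_act_closed)
qed

text \<open>This is where closure of the family under subgroups enters: the stabilizers at which a
  norm evaluates its argument belong to the family again.\<close>

lemma pairs_stab:
  assumes "fin_gset G X" "H \<in> F" "x \<in> pts X"
  shows "(stab X H x, x) \<in> fixed_pairs X"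
  using assms family_sub[OF assms(2) stab_subgroup[OF family_subgroup[OF assms(2)] assms(1,3)]]
  by (auto simp: fixed_pairs_def stab_def)

lemma stab_fibre:
  assumes "gmap G X Y f" "(H, f x) \<in> fixed_pairs Y" "x \<in> pts X"
    and "h \<in> H"
  shows "act X h x \<in> pts X" "f (act X h x) = f x"
  using assms pairs_D[OF assms(2)] gmap_act[OF assms(1)] gset_act_closed[OF gmap_src[OF assms(1)]]
  by auto

lemma inv_D:
  assumes "a \<in> invariant_sets X"
  shows "(H, x) \<in> a \<Longrightarrow> (H, x) \<in> fixed_pairs X"
    and "g \<in> carrier G \<Longrightarrow> (H, x) \<in> a \<Longrightarrow> (conj_by g H, act X g x) \<in> a"
  using assms by (auto simp: invariant_sets_def)

lemma inv_iff:
  assumes "fin_gset G X" "a \<in> invariant_sets X" "g \<in> carrier G" "H \<subseteq> carrier G" "x \<in> pts X"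
  shows "(conj_by g H, act X g x) \<in> a \<longleftrightarrow> (H, x) \<in> a"
  using inv_D(2)[OF assms(2,3)] inv_D(2)[OF assms(2), of "inv g" "conj_by g H" "act X g x"] assms
  by (auto simp: conj_by_inv gset_act_inv)

lemma inv_I:
  assumes "\<And>H x. (H, x) \<in> a \<Longrightarrow> (H, x) \<in> fixed_pairs X"
    and "\<And>g H x. g \<in> carrier G \<Longrightarrow> (H, x) \<in> a \<Longrightarrow> (conj_by g H, act X g x) \<in> a"
  shows "a \<in> invariant_sets X"
  using assms by (auto simp: invariant_sets_def)

lemma inv_one: "fin_gset G X \<Longrightarrow> fixed_pairs X \<in> invariant_sets X"
  by (rule inv_I) (auto intro: pairs_act)

lemma inv_zero: "{} \<in> invariant_sets X"
  by (rule inv_I) auto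

lemma inv_inter: "a \<in> invariant_sets X \<Longrightarrow> b \<in> invariant_sets X \<Longrightarrow> a \<inter> b \<in> invariant_sets X"
  by (auto simp: invariant_sets_def)

lemma inv_sym_diff:
  assumes X: "fin_gset G X" and "a \<in> invariant_sets X" "b \<in> invariant_sets X"
  shows "(a - b) \<union> (b - a) \<in> invariant_sets X"
proof (rule inv_I)
  fix g H x assume "g \<in> carrier G" "(H, x) \<in> (a - b) \<union> (b - a)"
  moreover from this have "(H, x) \<in> fixed_pairs X" using inv_D(1) assms by blast
  note pairs_D[OF this]
  ultimately show "(conj_by g H, act X g x) \<in> (a - b) \<union> (b - a)"
    using inv_iff[OF X] assms by blast
qed (use assms inv_D(1) in blast)

lemma inv_rst:
  assumes "gmap G X Y f" "b \<in> invariant_sets Y"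
  shows "grst X Y f b \<in> invariant_sets X"
proof (rule inv_I)
  fix g H x assume "g \<in> carrier G" "(H, x) \<in> grst X Y f b"
  then show "(conj_by g H, act X g x) \<in> grst X Y f b"
    using pairs_act[OF gmap_src[OF assms(1)]] inv_D(2)[OF assms(2)] gmap_act[OF assms(1)] pairs_D
    by (auto simp: mem_rst)
qed (simp add: mem_rst)

lemma inv_trf:
  assumes f: "gmap G X Y f" and a: "a \<in> invariant_sets X"
  shows "gtrf X Y f a \<in> invariant_sets Y"
proof (rule inv_I)
  note X = gmap_src[OF f] and Y = gmap_tgt[OF f]
  fix g H y assume g: "g \<in> carrier G" and y: "(H, y) \<in> gtrf X Y f a"
  then have y': "(H, y) \<in> fixed_pairs Y" by (simp add: mem_trf)
  note D = pairs_D[OF y']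
  have "bij_betw (act X g) {x \<in> pts X. f x = y \<and> (H, x) \<in> a}
      {x \<in> pts X. f x = act Y g y \<and> (conj_by g H, x) \<in> a}"
    by (rule bij_betw_byWitness[where f' = "act X (inv g)"])
      (use g D X Y gmap_act[OF f] inv_D(2)[OF a, of g] inv_D(2)[OF a, of "inv g" "conj_by g H"]
        in \<open>auto simp: gset_act_inv gset_act_closed conj_by_inv\<close>)
  from bij_betw_same_card[OF this] y pairs_act[OF Y g y']
  show "(conj_by g H, act Y g y) \<in> gtrf X Y f a" by (simp add: mem_trf)
qed (simp add: mem_trf)

lemma inv_nrm:
  assumes f: "gmap G X Y f" and a: "a \<in> invariant_sets X"
  shows "gnrm X Y f a \<in> invariant_sets Y"
proof (rule inv_I)
  note X = gmap_src[OF f] and Y = gmap_tgt[OF f]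
  fix g H y assume g: "g \<in> carrier G" and y: "(H, y) \<in> gnrm X Y f a"
  then have y': "(H, y) \<in> fixed_pairs Y" by (simp add: mem_nrm)
  note D = pairs_D[OF y']
  have "(stab X (conj_by g H) x, x) \<in> a" if x: "x \<in> pts X" "f x = act Y g y" for x
  proof -
    define z where "z = act X (inv g) x"
    have z: "z \<in> pts X" "f z = y" "x = act X g z"
      using x g D X Y gmap_act[OF f] by (simp_all add: z_def gset_act_closed gset_act_inv)
    then have "(stab X H z, z) \<in> a" using y by (simp add: mem_nrm)
    then show ?thesis using inv_D(2)[OF a g] stab_conj[OF X g D(4) z(1)] z(3) by simp
  qed
  then show "(conj_by g H, act Y g y) \<in> gnrm X Y f a" using pairs_act[OF Y g y'] by (simp add: mem_nrm)
qed (simp add: mem_nrm)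

section \<open>Ring levels, identities and composites\<close>

lemma ghost_cring:
  assumes X: "fin_gset G X" shows "cring (lev ghost X)"
proof (rule cringI)
  show "abelian_group (lev ghost X)"
  proof (rule abelian_groupI)
    fix a assume "a \<in> carrier (lev ghost X)"
    \<comment> \<open>Characteristic two: every element is its own negative.\<close>
    then show "\<exists>b\<in>carrier (lev ghost X). b \<oplus>\<^bsub>lev ghost X\<^esub> a = \<zero>\<^bsub>lev ghost X\<^esub>" by auto
  qed (use inv_sym_diff[OF X] inv_zero in auto)
  show "comm_monoid (lev ghost X)"
    by (rule comm_monoidI) (use inv_inter inv_one[OF X] in \<open>auto simp: invariant_sets_def\<close>)
qed auto

lemma rst_id_ghost: "a \<in> invariant_sets X \<Longrightarrow> grst X X (\<lambda>x\<in>pts X. x) a = a"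
  using inv_D(1) pairs_D(2) by (auto simp: mem_rst) (metis restrict_apply')+

lemma trf_id_ghost:
  assumes "a \<in> invariant_sets X" shows "gtrf X X (\<lambda>x\<in>pts X. x) a = a"
proof -
  have "odd (card {x \<in> pts X. restrict (\<lambda>x. x) (pts X) x = y \<and> (H, x) \<in> a}) \<longleftrightarrow> (H, y) \<in> a"
    if "(H, y) \<in> fixed_pairs X" for H y
  proof -
    have "{x \<in> pts X. restrict (\<lambda>x. x) (pts X) x = y \<and> (H, x) \<in> a} = (if (H, y) \<in> a then {y} else {})"
      using pairs_D(2)[OF that] by auto
    then show ?thesis by simp
  qed
  then show ?thesis using inv_D(1)[OF assms] by (auto simp: mem_trf)
qed

lemma nrm_id_ghost:
  assumes "a \<in> invariant_sets X" shows "gnrm X X (\<lambda>x\<in>pts X. x) a = a"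
proof -
  have "stab X H y = H" if "(H, y) \<in> fixed_pairs X" for H y
    using pairs_D(3)[OF that] by (auto simp: stab_def)
  moreover have "y \<in> pts X" if "(H, y) \<in> fixed_pairs X" for H y using pairs_D(2)[OF that] .
  ultimately show ?thesis using inv_D(1)[OF assms] by (fastforce simp: mem_nrm)
qed

lemma rst_comp_ghost:
  assumes "gmap G X Y f"
  shows "grst X Z (compose (pts X) g f) a = grst X Y f (grst Y Z g a)"
  using pairs_gmap[OF assms] pairs_D(2) by (auto simp: mem_rst compose_def)

lemma trf_comp_ghost:
  assumes f: "gmap G X Y f" and g: "gmap G Y Z g" and a: "a \<in> invariant_sets X"
  shows "gtrf X Z (compose (pts X) g f) a = gtrf Y Z g (gtrf X Y f a)"
proof -
  have "odd (card {x \<in> pts X. compose (pts X) g f x = z \<and> (H, x) \<in> a}) \<longleftrightarrow>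
    odd (card {y \<in> pts Y. g y = z \<and> (H, y) \<in> gtrf X Y f a})" if "(H, z) \<in> fixed_pairs Z" for H z
  proof -
    let ?n = "\<lambda>y. {x \<in> pts X. f x = y \<and> (H, x) \<in> a}"
    let ?Y = "{y \<in> pts Y. g y = z}"
    have fin: "finite ?Y" "finite (pts X)" using gset_finite f gmap_src gmap_tgt by auto
    have "{x \<in> pts X. compose (pts X) g f x = z \<and> (H, x) \<in> a} = (\<Union>y\<in>?Y. ?n y)"
      using gmap_closed[OF f] by (auto simp: compose_def)
    then have "card {x \<in> pts X. compose (pts X) g f x = z \<and> (H, x) \<in> a} = (\<Sum>y\<in>?Y. card (?n y))"
      using fin by (simp only:) (rule card_UN_disjoint, auto)
    \<comment> \<open>A sum is odd exactly if it has an odd number of odd terms, and the points with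
      an odd term make up the inner transfer.\<close>
    then have "odd (card {x \<in> pts X. compose (pts X) g f x = z \<and> (H, x) \<in> a}) \<longleftrightarrow>
        odd (card {y \<in> ?Y. odd (card (?n y))})"
      using fin by (simp add: even_sum_iff)
    moreover have "{y \<in> ?Y. odd (card (?n y))} = {y \<in> pts Y. g y = z \<and> (H, y) \<in> gtrf X Y f a}"
    proof -
      have "(H, y) \<in> fixed_pairs Y" if "odd (card (?n y))" for y
      proof -
        have "?n y \<noteq> {}" using that by force
        then show ?thesis using inv_D(1)[OF a] pairs_gmap[OF f] by blast
      qed
      then show ?thesis by (auto simp: mem_trf)
    qed
    ultimately show ?thesis by simp
  qed
  then show ?thesis by (auto simp: mem_trf)
qed

text \<open>An element of \<open>H\<close> that fixes \<open>x\<close> also fixes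
  \<open>f x\<close>, so the stabilizer of \<open>x\<close> in the stabilizer of \<open>f x\<close>
  is the stabilizer of \<open>x\<close> in \<open>H\<close>. With products over all points instead
  of orbit representatives, no representatives have to be matched along the composite.\<close>

lemma nrm_comp_ghost:
  assumes f: "gmap G X Y f" and g: "gmap G Y Z g"
  shows "gnrm X Z (compose (pts X) g f) a = gnrm Y Z g (gnrm X Y f a)"
proof -
  have st: "stab X (stab Y H (f x)) x = stab X H x" if "x \<in> pts X" "H \<subseteq> carrier G" for x H
    using gmap_act[OF f _ that(1)] that by (force simp: stab_def)
  have "(\<forall>x\<in>pts X. compose (pts X) g f x = z \<longrightarrow> (stab X H x, x) \<in> a) \<longleftrightarrow>
      (\<forall>y\<in>pts Y. g y = z \<longrightarrow> (stab Y H y, y) \<in> gnrm X Y f a)" (is "?l \<longleftrightarrow> ?r")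
    if z: "(H, z) \<in> fixed_pairs Z" for H z
  proof
    assume l: ?l
    show ?r
    proof (intro ballI impI)
      fix y assume y: "y \<in> pts Y" "g y = z"
      have "(stab X (stab Y H y) x, x) \<in> a" if "x \<in> pts X" "f x = y" for x
        using l st[OF that(1) pairs_D(4)[OF z]] that y by (simp add: compose_def)
      then show "(stab Y H y, y) \<in> gnrm X Y f a"
        using pairs_stab[OF gmap_tgt[OF f] pairs_D(1)[OF z] y(1)] by (simp add: mem_nrm)
    qed
  next
    assume r: ?r
    show ?l
    proof (intro ballI impI)
      fix x assume x: "x \<in> pts X" "compose (pts X) g f x = z"
      then have "(stab Y H (f x), f x) \<in> gnrm X Y f a"
        using r gmap_closed[OF f x(1)] by (simp add: compose_def)
      then have "(stab X (stab Y H (f x)) x, x) \<in> a" using x(1) by (simp add: mem_nrm)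
      then show "(stab X H x, x) \<in> a" using st[OF x(1) pairs_D(4)[OF z]] by simp
    qed
  qed
  then show ?thesis by (auto simp: mem_nrm)
qed

section \<open>Homomorphism properties and base change\<close>

lemma trf_hom_ghost:
  assumes f: "gmap G X Y f"
  shows "gtrf X Y f \<in> hom (add_monoid (lev ghost X)) (add_monoid (lev ghost Y))"
proof (rule homI)
  fix a b assume "a \<in> carrier (add_monoid (lev ghost X))" "b \<in> carrier (add_monoid (lev ghost X))"
  have eq: "{x \<in> pts X. f x = y \<and> (H, x) \<in> (a - b) \<union> (b - a)} =
      ({x \<in> pts X. f x = y \<and> (H, x) \<in> a} - {x \<in> pts X. f x = y \<and> (H, x) \<in> b}) \<union>
      ({x \<in> pts X. f x = y \<and> (H, x) \<in> b} - {x \<in> pts X. f x = y \<and> (H, x) \<in> a})" for H y by auto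
  have "odd (card {x \<in> pts X. f x = y \<and> (H, x) \<in> (a - b) \<union> (b - a)}) \<longleftrightarrow>
      odd (card {x \<in> pts X. f x = y \<and> (H, x) \<in> a}) \<noteq> odd (card {x \<in> pts X. f x = y \<and> (H, x) \<in> b})"
    for H y
    unfolding eq using gset_finite[OF gmap_src[OF f]] by (intro odd_card_sym_diff) auto
  then show "gtrf X Y f (a \<otimes>\<^bsub>add_monoid (lev ghost X)\<^esub> b) =
      gtrf X Y f a \<otimes>\<^bsub>add_monoid (lev ghost Y)\<^esub> gtrf X Y f b"
    unfolding monoid.simps ghost_lev by (intro Set.set_eqI) (auto simp: mem_trf simp del: Un_iff Diff_iff)
qed (use inv_trf[OF f] in simp)

lemma rst_ring_hom_ghost:
  assumes f: "gmap G X Y f"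
  shows "grst X Y f \<in> ring_hom (lev ghost Y) (lev ghost X)"
  by (rule ring_hom_memI) (use inv_rst[OF f] pairs_gmap[OF f] in \<open>auto simp: mem_rst\<close>)

lemma nrm_hom_ghost:
  assumes f: "gmap G X Y f"
  shows "gnrm X Y f \<in> hom (lev ghost X) (lev ghost Y)"
  by (rule homI) (use inv_nrm[OF f] in \<open>auto simp: mem_nrm\<close>)

lemma nrm_one_ghost:
  assumes f: "gmap G X Y f"
  shows "gnrm X Y f (fixed_pairs X) = fixed_pairs Y"
  using pairs_stab[OF gmap_src[OF f]] pairs_D(1) by (auto simp: mem_nrm)

text \<open>A point of a pullback is determined by its two projections. Since \<open>H\<close> fixes
  the second one, an element of \<open>H\<close> fixes the point as soon as it fixes the
  first.\<close>

lemma pullback_stab: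
  assumes P: "gpullback G X Y Z P f g p q" and w: "w \<in> pts P" and H: "(H, q w) \<in> fixed_pairs Y"
  shows "stab P H w = stab X H (p w)"
proof -
  have p: "gmap G P X p" and q: "gmap G P Y q"
    and bij: "bij_betw (\<lambda>w. (p w, q w)) (pts P) {(x, y) \<in> pts X \<times> pts Y. f x = g y}"
    using P by (auto simp: gpullback_def)
  note D = pairs_D[OF H]
  have "act P h w = w \<longleftrightarrow> act X h (p w) = p w" if h: "h \<in> H" for h
  proof
    have hG: "h \<in> carrier G" using D h by blast
    have hw: "act P h w \<in> pts P" using gset_act_closed[OF gmap_src[OF p] hG w] .
    assume "act X h (p w) = p w"
    then have "(p (act P h w), q (act P h w)) = (p w, q w)"
      using gmap_act[OF p hG w] gmap_act[OF q hG w] D(3)[OF h] by simp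
    then show "act P h w = w" using bij hw w by (auto simp: bij_betw_def dest: inj_onD)
  qed (metis D(4) gmap_act[OF p _ w] h subsetD)
  then show ?thesis by (auto simp: stab_def)
qed

text \<open>The projection \<open>p\<close> identifies the fibre of \<open>q\<close> over
  \<open>y\<close> with the fibre of \<open>f\<close> over \<open>g y\<close>. By
  \<open>pullback_stab\<close> it also preserves and reflects being fixed by \<open>H\<close>, so
  both transfers count the same points.\<close>

lemma rst_trf_ghost:
  assumes P: "gpullback G X Y Z P f g p q" and a: "a \<in> invariant_sets X"
  shows "grst Y Z g (gtrf X Z f a) = gtrf P Y q (grst P X p a)"
proof -
  have f: "gmap G X Z f" and g: "gmap G Y Z g" and p: "gmap G P X p" and q: "gmap G P Y q"
    and bij: "bij_betw (\<lambda>w. (p w, q w)) (pts P) {(x, y) \<in> pts X \<times> pts Y. f x = g y}"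
    using P by (auto simp: gpullback_def)
  have pq: "p w \<in> pts X" "f (p w) = g (q w)" if "w \<in> pts P" for w
    using bij_betwE[OF bij, rule_format, OF that] by simp_all
  have "card {x \<in> pts X. f x = g y \<and> (H, x) \<in> a} = card {w \<in> pts P. q w = y \<and> (H, w) \<in> grst P X p a}"
    if H: "(H, y) \<in> fixed_pairs Y" for H y
  proof -
    note D = pairs_D[OF H]
    have mem: "(H, w) \<in> grst P X p a \<longleftrightarrow> (H, p w) \<in> a" if "w \<in> pts P" "q w = y" for w
    proof -
      have "(H, w) \<in> fixed_pairs P" if "(H, p w) \<in> a"
      proof -
        have "stab X H (p w) = H" using pairs_D(3)[OF inv_D(1)[OF a that]] by (auto simp: stab_def)
        then have "stab P H w = H" using pullback_stab[OF P \<open>w \<in> pts P\<close>] H \<open>q w = y\<close> by simp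
        then show ?thesis using pairs_stab[OF gmap_src[OF p] D(1) \<open>w \<in> pts P\<close>] by simp
      qed
      then show ?thesis by (auto simp: mem_rst)
    qed
    have inj: "inj_on p {w \<in> pts P. q w = y \<and> (H, w) \<in> grst P X p a}"
      using bij by (auto simp: bij_betw_def inj_on_def)
    have img: "p ` {w \<in> pts P. q w = y \<and> (H, w) \<in> grst P X p a} = {x \<in> pts X. f x = g y \<and> (H, x) \<in> a}"
    proof (intro equalityI subsetI)
      fix x assume x: "x \<in> {x \<in> pts X. f x = g y \<and> (H, x) \<in> a}"
      then have "(x, y) \<in> (\<lambda>w. (p w, q w)) ` pts P"
        using bij D(2) by (simp add: bij_betw_def)
      then obtain w where w: "w \<in> pts P" "x = p w" "q w = y" by blast
      then show "x \<in> p ` {w \<in> pts P. q w = y \<and> (H, w) \<in> grst P X p a}"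
        using x mem[OF w(1,3)] by blast
    next
      fix x assume "x \<in> p ` {w \<in> pts P. q w = y \<and> (H, w) \<in> grst P X p a}"
      then obtain w where w: "w \<in> pts P" "x = p w" "q w = y" "(H, w) \<in> grst P X p a" by blast
      then show "x \<in> {x \<in> pts X. f x = g y \<and> (H, x) \<in> a}"
        using mem[OF w(1,3)] pq[OF w(1)] by blast
    qed
    show ?thesis unfolding img[symmetric] by (rule card_image[OF inj])
  qed
  then show ?thesis using pairs_gmap[OF g] by (auto simp: mem_rst mem_trf)
qed

lemma rst_nrm_ghost:
  assumes P: "gpullback G X Y Z P f g p q"
  shows "grst Y Z g (gnrm X Z f a) = gnrm P Y q (grst P X p a)"
proof -
  have f: "gmap G X Z f" and g: "gmap G Y Z g" and p: "gmap G P X p" and q: "gmap G P Y q"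
    and bij: "bij_betw (\<lambda>w. (p w, q w)) (pts P) {(x, y) \<in> pts X \<times> pts Y. f x = g y}"
    using P by (auto simp: gpullback_def)
  have pq: "p w \<in> pts X" "f (p w) = g (q w)" if "w \<in> pts P" for w
    using bij_betwE[OF bij, rule_format, OF that] by simp_all
  have "(\<forall>x\<in>pts X. f x = g y \<longrightarrow> (stab X H x, x) \<in> a) \<longleftrightarrow>
     (\<forall>w\<in>pts P. q w = y \<longrightarrow> (stab P H w, w) \<in> grst P X p a)" (is "?l \<longleftrightarrow> ?r")
    if H: "(H, y) \<in> fixed_pairs Y" for H y
  proof -
    note D = pairs_D[OF H]
    have mem: "(stab P H w, w) \<in> grst P X p a \<longleftrightarrow> (stab X H (p w), p w) \<in> a"
      if "w \<in> pts P" "q w = y" for w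
      using pairs_stab[OF gmap_src[OF p] D(1) that(1)] pullback_stab[OF P that(1)] H that(2)
      by (auto simp: mem_rst)
    show ?thesis
    proof
      assume l: ?l
      show ?r
      proof (intro ballI impI)
        fix w assume w: "w \<in> pts P" "q w = y"
        then show "(stab P H w, w) \<in> grst P X p a" using mem[OF w] pq[OF w(1)] l by blast
      qed
    next
      assume r: ?r
      show ?l
      proof (intro ballI impI)
        fix x assume x: "x \<in> pts X" "f x = g y"
        then have "(x, y) \<in> (\<lambda>w. (p w, q w)) ` pts P" using bij D(2) by (simp add: bij_betw_def)
        then obtain w where w: "w \<in> pts P" "x = p w" "q w = y" by blast
        then show "(stab X H x, x) \<in> a" using mem[OF w(1,3)] r by blast
      qed
    qed
  qed
  then show ?thesis using pairs_gmap[OF g] by (auto simp: mem_rst mem_nrm)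
qed

text \<open>Injective equivariant maps reflect fixed points, so the fixed pairs of \<open>Z\<close>
  are the disjoint union of those of \<open>X\<close> and of \<open>Y\<close>. The inverse takes the
  union of the two images.\<close>

lemma additive_ghost:
  assumes "gcoproduct G X Y Z i j"
  shows "bij_betw (\<lambda>a. (grst X Z i a, grst Y Z j a)) (invariant_sets Z)
    (invariant_sets X \<times> invariant_sets Y)"
proof -
  have i: "gmap G X Z i" and j: "gmap G Y Z j" and inj: "inj_on i (pts X)" "inj_on j (pts Y)"
    and disj: "i ` pts X \<inter> j ` pts Y = {}" and un: "i ` pts X \<union> j ` pts Y = pts Z"
    using assms by (auto simp: gcoproduct_def)
  note X = gmap_src[OF i] and Y = gmap_src[OF j] and Z = gmap_tgt[OF i]
  define glue :: "('a set \<times> nat) set \<times> ('a set \<times> nat) set \<Rightarrow> ('a set \<times> nat) set"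
    where "glue = (\<lambda>(a, b). (\<lambda>(H, x). (H, i x)) ` a \<union> (\<lambda>(H, y). (H, j y)) ` b)"
  have mem_glue: "(H, z) \<in> glue (a, b) \<longleftrightarrow> (\<exists>x. z = i x \<and> (H, x) \<in> a) \<or> (\<exists>y. z = j y \<and> (H, y) \<in> b)"
    for H z a b by (force simp: glue_def)
  have fixi: "(H, x) \<in> fixed_pairs X" if "(H, i x) \<in> fixed_pairs Z" "x \<in> pts X" for H x
    using stab_fibre[OF i that] pairs_D[OF that(1)] that inj(1) gmap_act[OF i _ that(2)]
    unfolding fixed_pairs_def by (auto simp: inj_on_def subset_iff)
  have fixj: "(H, x) \<in> fixed_pairs Y" if "(H, j x) \<in> fixed_pairs Z" "x \<in> pts Y" for H x
    using stab_fibre[OF j that] pairs_D[OF that(1)] that inj(2) gmap_act[OF j _ that(2)]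
    unfolding fixed_pairs_def by (auto simp: inj_on_def subset_iff)
  show ?thesis
  proof (rule bij_betw_byWitness[where f' = glue])
    show "\<forall>a\<in>invariant_sets Z. glue (grst X Z i a, grst Y Z j a) = a"
    proof
      fix a assume a: "a \<in> invariant_sets Z"
      have "(H, z) \<in> glue (grst X Z i a, grst Y Z j a)" if "(H, z) \<in> a" for H z
      proof -
        note z = inv_D(1)[OF a that]
        consider x where "x \<in> pts X" "z = i x" | y where "y \<in> pts Y" "z = j y"
          using pairs_D(2)[OF z] un by blast
        then show ?thesis
          by cases (use z that fixi fixj in \<open>auto simp: mem_glue mem_rst\<close>)
      qed
      then show "glue (grst X Z i a, grst Y Z j a) = a" by (auto simp: mem_glue mem_rst)
    qed
    show "\<forall>c\<in>invariant_sets X \<times> invariant_sets Y. (grst X Z i (glue c), grst Y Z j (glue c)) = c"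
    proof clarify
      fix a b assume a: "a \<in> invariant_sets X" and b: "b \<in> invariant_sets Y"
      have neq: "i x \<noteq> j y" if "x \<in> pts X" "y \<in> pts Y" for x y using disj that by blast
      have "(H, i x) \<in> glue (a, b) \<longleftrightarrow> (H, x) \<in> a" if "x \<in> pts X" for H x
        unfolding mem_glue using that neq inj_onD[OF inj(1)] pairs_D(2)[OF inv_D(1)[OF a]]
          pairs_D(2)[OF inv_D(1)[OF b]] by blast
      then have "(H, x) \<in> grst X Z i (glue (a, b)) \<longleftrightarrow> (H, x) \<in> a" for H x
        using inv_D(1)[OF a, of H x] pairs_D(2)[of H x X] unfolding mem_rst by blast
      moreover have "(H, j y) \<in> glue (a, b) \<longleftrightarrow> (H, y) \<in> b" if "y \<in> pts Y" for H y
        unfolding mem_glue using that neq[symmetric] inj_onD[OF inj(2)] pairs_D(2)[OF inv_D(1)[OF a]]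
          pairs_D(2)[OF inv_D(1)[OF b]] by blast
      then have "(H, y) \<in> grst Y Z j (glue (a, b)) \<longleftrightarrow> (H, y) \<in> b" for H y
        using inv_D(1)[OF b, of H y] pairs_D(2)[of H y Y] unfolding mem_rst by blast
      ultimately show "grst X Z i (glue (a, b)) = a \<and> grst Y Z j (glue (a, b)) = b" by auto
    qed
    show "glue ` (invariant_sets X \<times> invariant_sets Y) \<subseteq> invariant_sets Z"
    proof clarify
      fix a b assume a: "a \<in> invariant_sets X" and b: "b \<in> invariant_sets Y"
      show "glue (a, b) \<in> invariant_sets Z"
      proof (rule inv_I)
        show "(H, z) \<in> fixed_pairs Z" if "(H, z) \<in> glue (a, b)" for H z
          using that pairs_gmap[OF i inv_D(1)[OF a]] pairs_gmap[OF j inv_D(1)[OF b]]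
          by (auto simp: mem_glue)
        show "(conj_by g H, act Z g z) \<in> glue (a, b)" if "g \<in> carrier G" "(H, z) \<in> glue (a, b)" for g H z
        proof -
          from that(2) consider x where "(H, x) \<in> a" "z = i x" | y where "(H, y) \<in> b" "z = j y"
            by (auto simp: mem_glue)
          then show ?thesis
          proof cases
            case 1
            have "act Z g z = i (act X g x)"
              using gmap_act[OF i that(1) pairs_D(2)[OF inv_D(1)[OF a 1(1)]]] 1(2) by simp
            then show ?thesis unfolding mem_glue using inv_D(2)[OF a that(1) 1(1)] by blast
          next
            case 2
            have "act Z g z = j (act Y g y)"
              using gmap_act[OF j that(1) pairs_D(2)[OF inv_D(1)[OF b 2(1)]]] 2(2) by simp
            then show ?thesis unfolding mem_glue using inv_D(2)[OF b that(1) 2(1)] by blast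
          qed
        qed
      qed
    qed
  qed (use inv_rst[OF i] inv_rst[OF j] in auto)
qed

lemma mackey_ghost: "mackey_functor G (lev ghost) grst gtrf"
proof (rule mackey_functor.intro)
  show "grst X Y f \<in> hom (add_monoid (lev ghost Y)) (add_monoid (lev ghost X))" if "gmap G X Y f" for X Y f
    using rst_ring_hom_ghost[OF that] by (auto simp: ring_hom_def hom_def)
  show "abelian_group (lev ghost X)" if "fin_gset G X" for X
    using ghost_cring[OF that] cring.axioms(1) ring.is_abelian_group by blast
qed (use trf_hom_ghost rst_id_ghost trf_id_ghost rst_comp_ghost trf_comp_ghost additive_ghost
    rst_trf_ghost in \<open>simp_all\<close>)

text \<open>At \<open>(H, y)\<close> the restricted factor is constant on the fibre: either all of
  its points survive or none. The relation supplies the assumption \<open>frobenius\<close> of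
  \<open>idempotent_quotient\<close>, where it turns the quotient into a module.\<close>

lemma frobenius_ghost:
  assumes f: "gmap G X Y f" and a: "a \<in> invariant_sets X"
  shows "gtrf X Y f (grst X Y f b \<inter> a) = b \<inter> gtrf X Y f a"
proof -
  have "{x \<in> pts X. f x = y \<and> (H, x) \<in> grst X Y f b \<inter> a} =
    (if (H, y) \<in> b then {x \<in> pts X. f x = y \<and> (H, x) \<in> a} else {})" for H y
    using inv_D(1)[OF a] by (auto simp: mem_rst)
  then show ?thesis by (auto simp: mem_trf split: if_splits)
qed

end

section \<open>The distributive law for norms of transfers\<close>

context subgroup_family
begin

text \<open>Equivariant sections over an \<open>H\<close>-set are determined by their values on orbit representatives.\<close>

lemma odd_card_equivariant_sections:
  assumes p: "gmap G A X p" and a: "a \<in> invariant_sets A" and H: "H \<in> F"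
    and V: "V \<subseteq> pts X" "\<And>h x. h \<in> H \<Longrightarrow> x \<in> V \<Longrightarrow> act X h x \<in> V"
  shows "odd (card {s \<in> V \<rightarrow>\<^sub>E pts A. (\<forall>x\<in>V. p (s x) = x \<and> (stab X H x, s x) \<in> a) \<and>
      (\<forall>h\<in>H. \<forall>x\<in>V. s (act X h x) = act A h (s x))})
    \<longleftrightarrow> (\<forall>x\<in>V. (stab X H x, x) \<in> gtrf A X p a)"
proof -
  note A = gmap_src[OF p] and X = gmap_tgt[OF p] and sub = family_subgroup[OF H]
  interpret H: subgroup H G by (fact sub)
  have HG: "h \<in> carrier G" if "h \<in> H" for h using that by simp
  have VX: "x \<in> pts X" if "x \<in> V" for x using that V by blast
  \<comment> \<open>As points are natural numbers, the least element of an \<open>H\<close>-orbit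
    serves as its canonical representative.\<close>
  define r where "r x = Min ((\<lambda>h. act X h x) ` H)" for x
  have finH: "finite H" using H.subset finite_carrier finite_subset by blast
  have r_ex: "\<exists>k\<in>H. act X k (r x) = x" "r x \<in> V" if x: "x \<in> V" for x
  proof -
    have "H \<noteq> {}" using H.one_closed by (metis empty_iff)
    then have "r x \<in> (\<lambda>h. act X h x) ` H" unfolding r_def using finH by (intro Min_in) auto
    then obtain h where h: "h \<in> H" "r x = act X h x" by blast
    then show "r x \<in> V" using V x by simp
    have "act X (inv h) (r x) = x" using h x VX gset_act_inv(1)[OF X] by simp
    then show "\<exists>k\<in>H. act X k (r x) = x" using h by blast
  qed
  have r_act: "r (act X k x) = r x" if "x \<in> V" "k \<in> H" for x k
  proof -
    have "(\<lambda>h. act X h (act X k x)) ` H = (\<lambda>h. act X h x) ` H"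
    proof (intro equalityI subsetI)
      fix y assume "y \<in> (\<lambda>h. act X h (act X k x)) ` H"
      then obtain h where h: "h \<in> H" "y = act X h (act X k x)" by blast
      then have "y = act X (h \<otimes> k) x" using gset_act_mult[OF X HG HG VX] that by simp
      then show "y \<in> (\<lambda>h. act X h x) ` H" using h that by auto
    next
      fix y assume "y \<in> (\<lambda>h. act X h x) ` H"
      then obtain h where h: "h \<in> H" "y = act X h x" by blast
      then have "y = act X (h \<otimes> inv k) (act X k x)"
        using that VX gset_act_mult[OF X, of "h \<otimes> inv k" k x] by (simp add: m_assoc)
      then show "y \<in> (\<lambda>h. act X h (act X k x)) ` H" using h that by auto
    qed
    then show ?thesis by (simp add: r_def)
  qed
  define T where "T = {x \<in> V. r x = x}"
  have rT: "r x \<in> T" if x: "x \<in> V" for x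
  proof -
    obtain k where "k \<in> H" "act X k (r x) = x" using r_ex[OF x] by blast
    then show ?thesis using r_act[OF r_ex(2)[OF x], of k] r_ex(2)[OF x] by (simp add: T_def)
  qed
  have finT: "finite T" by (rule finite_subset[OF _ gset_finite[OF X]]) (use VX in \<open>auto simp: T_def\<close>)
  define N where "N x = {z \<in> pts A. p z = x \<and> (stab X H x, z) \<in> a}" for x
  define Sec where "Sec = {s \<in> V \<rightarrow>\<^sub>E pts A. (\<forall>x\<in>V. p (s x) = x \<and> (stab X H x, s x) \<in> a) \<and>
      (\<forall>h\<in>H. \<forall>x\<in>V. s (act X h x) = act A h (s x))}"
  have "bij_betw (\<lambda>s. restrict s T) Sec (PiE T N)"
  proof (rule bij_betw_imageI)
    show "inj_on (\<lambda>s. restrict s T) Sec"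
    proof (rule inj_onI)
      fix s s' assume s: "s \<in> Sec" and s': "s' \<in> Sec" and eq: "restrict s T = restrict s' T"
      show "s = s'"
      proof (rule extensionalityI[of _ V])
        show "s \<in> extensional V" "s' \<in> extensional V" using s s' by (auto simp: Sec_def PiE_iff)
        fix x assume x: "x \<in> V"
        obtain k where k: "k \<in> H" "act X k (r x) = x" using r_ex[OF x] by blast
        have "s (r x) = s' (r x)" using fun_cong[OF eq, of "r x"] rT[OF x] by simp
        moreover have "s x = act A k (s (r x))" "s' x = act A k (s' (r x))"
          using s s' k r_ex(2)[OF x] unfolding Sec_def by fastforce+
        ultimately show "s x = s' x" by simp
      qed
    qed
    show "(\<lambda>s. restrict s T) ` Sec = PiE T N"
    proof (intro equalityI subsetI)
      fix t assume "t \<in> (\<lambda>s. restrict s T) ` Sec"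
      then show "t \<in> PiE T N" by (auto simp: Sec_def T_def N_def PiE_iff)
    next
      fix t assume t: "t \<in> PiE T N"
      have tN: "t (r x) \<in> pts A" "p (t (r x)) = r x" "(stab X H (r x), t (r x)) \<in> a" if "x \<in> V" for x
        using t rT[OF that] unfolding N_def by (auto dest: PiE_mem)
      define k where "k x = (SOME k. k \<in> H \<and> act X k (r x) = x)" for x
      have k: "k x \<in> H" "act X (k x) (r x) = x" if "x \<in> V" for x
        using someI_ex[of "\<lambda>k. k \<in> H \<and> act X k (r x) = x"] r_ex(1)[OF that] unfolding k_def by blast+
      define s where "s = (\<lambda>x\<in>V. act A (k x) (t (r x)))"
      \<comment> \<open>The extension of \<open>t\<close> along an orbit does not depend on the
        group element used: two choices differ by an element stabilizing \<open>r x\<close>, and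
        this fixes \<open>t (r x)\<close> because \<open>t (r x)\<close> forms a fixed pair with
        that stabilizer.\<close>
      have s_eq: "s x = act A h (t (r x))" if x: "x \<in> V" and h: "h \<in> H" "act X h (r x) = x" for x h
      proof -
        note rx = VX[OF r_ex(2)[OF x]]
        have "act X (inv h \<otimes> k x) (r x) = r x"
          using k[OF x] h HG rx gset_act_mult[OF X] gset_act_inv(1)[OF X, of h "r x"] by simp
        then have "inv h \<otimes> k x \<in> stab X H (r x)" using k[OF x] h by (simp add: stab_def)
        then have "act A (inv h \<otimes> k x) (t (r x)) = t (r x)"
          using pairs_D(3)[OF inv_D(1)[OF a tN(3)[OF x]]] by blast
        then have "act A h (t (r x)) = act A (h \<otimes> (inv h \<otimes> k x)) (t (r x))"
          using h k[OF x] tN[OF x] by (subst gset_act_mult[OF A]) auto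
        also have "\<dots> = s x" using h k[OF x] x by (simp add: m_assoc[symmetric] s_def)
        finally show ?thesis by (rule sym)
      qed
      have "s \<in> Sec"
        unfolding Sec_def
      proof (intro CollectI conjI ballI)
        show "s \<in> V \<rightarrow>\<^sub>E pts A"
          using k tN gset_act_closed[OF A] by (auto simp: s_def)
      next
        fix x assume x: "x \<in> V"
        show "p (s x) = x" using gmap_act[OF p HG[OF k(1)] tN(1)] k tN x by (simp add: s_def)
        have "(conj_by (k x) (stab X H (r x)), act A (k x) (t (r x))) \<in> a"
          by (rule inv_D(2)[OF a HG[OF k(1)] tN(3)]) (fact x)+
        moreover have "conj_by (k x) (stab X H (r x)) = stab X H x"
          using stab_conj[OF X HG[OF k(1)[OF x]] H.subset VX[OF r_ex(2)[OF x]]]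
            conj_by_self[OF sub k(1)[OF x]] k(2)[OF x] by simp
        ultimately show "(stab X H x, s x) \<in> a" using x by (simp add: s_def)
      next
        fix h x assume h: "h \<in> H" and x: "x \<in> V"
        have "act X (h \<otimes> k x) (r (act X h x)) = act X h x"
          using k[OF x] h x VX[OF r_ex(2)[OF x]] gset_act_mult[OF X] by (simp add: r_act)
        then have "s (act X h x) = act A (h \<otimes> k x) (t (r (act X h x)))"
          using s_eq V(2)[OF h x] h k[OF x] by simp
        also have "\<dots> = act A h (s x)"
          using x h k[OF x] tN[OF x] by (simp add: r_act s_def gset_act_mult[OF A])
        finally show "s (act X h x) = act A h (s x)" .
      qed
      moreover have "restrict s T = t"
      proof (rule extensionalityI[of _ T])
        show "t \<in> extensional T" using t by (simp add: PiE_iff)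
        fix x assume "x \<in> T"
        then have "x \<in> V" "r x = x" by (auto simp: T_def)
        then show "restrict s T x = t x"
          using s_eq[of x \<one>] tN[of x] gset_act_one[OF X VX] gset_act_one[OF A] \<open>x \<in> T\<close> by simp
      qed simp
      ultimately show "t \<in> (\<lambda>s. restrict s T) ` Sec" by blast
    qed
  qed
  \<comment> \<open>The number of sections is a product with one factor per orbit. Modulo 2 it is
    nonzero exactly if every factor is odd, and the factor at a representative is the count in the
    transfer.\<close>
  then have "card Sec = (\<Prod>x\<in>T. card (N x))" using bij_betw_same_card card_PiE[OF finT] by metis
  then have "odd (card Sec) \<longleftrightarrow> (\<forall>x\<in>T. odd (card (N x)))" using finT by (simp add: even_prod_iff)
  also have "\<dots> \<longleftrightarrow> (\<forall>x\<in>T. (stab X H x, x) \<in> gtrf A X p a)"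
    using pairs_stab[OF X H VX] by (auto simp: mem_trf N_def T_def)
  \<comment> \<open>The condition passes from representatives to all of \<open>V\<close>, because
    the transfer of an invariant set is invariant.\<close>
  also have "\<dots> \<longleftrightarrow> (\<forall>x\<in>V. (stab X H x, x) \<in> gtrf A X p a)"
  proof -
    have "(stab X H x, x) \<in> gtrf A X p a" if x: "x \<in> V" and *: "(stab X H (r x), r x) \<in> gtrf A X p a" for x
    proof -
      obtain k where k: "k \<in> H" "act X k (r x) = x" using r_ex[OF x] by blast
      have "conj_by k (stab X H (r x)) = stab X H x"
        using stab_conj[OF X HG[OF k(1)] H.subset VX[OF r_ex(2)[OF x]]] conj_by_self[OF sub k(1)] k(2)
        by simp
      then show ?thesis using inv_D(2)[OF inv_trf[OF p a] HG[OF k(1)] *] k(2) by simp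
    qed
    then show ?thesis using rT unfolding T_def by blast
  qed
  finally show ?thesis unfolding Sec_def .
qed

text \<open>At \<open>(H, y)\<close> the right side counts, modulo 2, the \<open>H\<close>-fixed
  points \<open>b\<close> over \<open>y\<close> that lie in the norm. Such a \<open>b\<close> is an
  \<open>H\<close>-equivariant section of \<open>p\<close> over the fibre of \<open>y\<close> with
  values in \<open>a\<close>, so \<open>odd_card_equivariant_sections\<close> evaluates the
  count.\<close>

lemma nrm_trf_ghost:
  assumes ex: "gexponential G A X Y E B p f e c q" and a: "a \<in> invariant_sets A"
  shows "gnrm X Y f (gtrf A X p a) = gtrf B Y q (gnrm E B c (grst E A e a))"
proof -
  have p: "gmap G A X p" and e: "gmap G E A e"
    and pb: "gpullback G X B Y E f q (compose (pts E) p e) c"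
    using ex by (simp_all add: gexponential_def)
  then have f: "gmap G X Y f" and q: "gmap G B Y q" and c: "gmap G E B c"
    and bij: "bij_betw (\<lambda>w. (compose (pts E) p e w, c w)) (pts E) {(x, b) \<in> pts X \<times> pts B. f x = q b}"
    by (simp_all add: gpullback_def)
  note A = gmap_src[OF p] and B = gmap_src[OF q] and E = gmap_src[OF e] and X = gmap_src[OF f]
  have "(\<forall>x\<in>pts X. f x = y \<longrightarrow> (stab X H x, x) \<in> gtrf A X p a) \<longleftrightarrow>
      odd (card {b \<in> pts B. q b = y \<and> (H, b) \<in> gnrm E B c (grst E A e a)})"
    if Hy: "(H, y) \<in> fixed_pairs Y" for H y
  proof -
    note D = pairs_D[OF Hy]
    have HG: "h \<in> carrier G" if "h \<in> H" for h using that D by blast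
    define V where "V = {x \<in> pts X. f x = y}"
    have VX: "x \<in> pts X" "f x = y" if "x \<in> V" for x using that by (auto simp: V_def)
    have actV: "act X h x \<in> V" if "h \<in> H" "x \<in> V" for h x
      using that D gmap_act[OF f HG] gset_act_closed[OF X HG] by (auto simp: V_def)
    \<comment> \<open>\<open>w x b\<close> is the point of the pullback \<open>E\<close> lying over
      \<open>x\<close> and \<open>b\<close>, so that \<open>s b\<close> below is the section coded
      by \<open>b\<close>.\<close>
    define w where "w x b = (THE w. w \<in> pts E \<and> p (e w) = x \<and> c w = b)" for x b
    define s where "s b = (\<lambda>x\<in>V. e (w x b))" for b
    have sbij: "bij_betw s {b \<in> pts B. q b = y} {s \<in> V \<rightarrow>\<^sub>E pts A. \<forall>x\<in>pts X. f x = y \<longrightarrow> p (s x) = x}"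
    proof -
      have "y \<in> pts Y" by fact
      then show ?thesis using ex unfolding gexponential_def s_def w_def V_def by blast
    qed
    have w_eq: "w (p (e u)) (c u) = u" if "u \<in> pts E" for u
      unfolding w_def
    proof (rule the_equality)
      fix v assume "v \<in> pts E \<and> p (e v) = p (e u) \<and> c v = c u"
      then show "v = u" using that bij by (auto simp: bij_betw_def inj_on_def compose_def)
    qed (use that in simp)
    have w_ex: "\<exists>u\<in>pts E. p (e u) = x \<and> c u = b \<and> w x b = u" if "x \<in> V" "b \<in> pts B" "q b = y" for x b
    proof -
      have "(x, b) \<in> (\<lambda>w. (compose (pts E) p e w, c w)) ` pts E"
        using bij that VX[OF that(1)] by (simp add: bij_betw_def)
      then obtain u where "u \<in> pts E" "p (e u) = x" "c u = b" by (auto simp: compose_def)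
      then show ?thesis using w_eq by blast
    qed
    have s_u: "s (c u) (p (e u)) = e u" if "u \<in> pts E" "p (e u) \<in> V" for u
      using that w_eq by (simp add: s_def)
    have s_act: "s (act B h b) (act X h x) = act A h (s b x)"
      if h: "h \<in> H" and x: "x \<in> V" and b: "b \<in> pts B" "q b = y" for h x b
    proof -
      obtain u where u: "u \<in> pts E" "p (e u) = x" "c u = b" using w_ex[OF x b] by blast
      have hu: "act E h u \<in> pts E" "c (act E h u) = act B h b" "e (act E h u) = act A h (e u)"
        "p (e (act E h u)) = act X h x"
        using u HG[OF h] gset_act_closed[OF E] gmap_act[OF c] gmap_act[OF e] gmap_act[OF p]
          gmap_closed[OF e] by auto
      show ?thesis using s_u[OF u(1)] s_u[OF hu(1)] u hu x actV[OF h x] by simp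
    qed
    \<comment> \<open>By \<open>s_act\<close>, acting on \<open>b\<close> corresponds to conjugating
      the section. Since \<open>s\<close> is injective on the fibre over \<open>y\<close>, being
      fixed means being equivariant.\<close>
    have fix_iff: "(\<forall>h\<in>H. act B h b = b) \<longleftrightarrow> (\<forall>h\<in>H. \<forall>x\<in>V. s b (act X h x) = act A h (s b x))"
      if b: "b \<in> pts B" "q b = y" for b
    proof
      assume "\<forall>h\<in>H. act B h b = b"
      then show "\<forall>h\<in>H. \<forall>x\<in>V. s b (act X h x) = act A h (s b x)" using s_act b by metis
    next
      assume eqv: "\<forall>h\<in>H. \<forall>x\<in>V. s b (act X h x) = act A h (s b x)"
      show "\<forall>h\<in>H. act B h b = b"
      proof
        fix h assume h: "h \<in> H"
        have hb: "act B h b \<in> pts B" "q (act B h b) = y"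
          using b h HG D gset_act_closed[OF B] gmap_act[OF q] by auto
        have "s (act B h b) = s b"
        proof (rule extensionalityI[of _ V])
          fix x assume x: "x \<in> V"
          define z where "z = act X (inv h) x"
          have "inv h \<in> H" using h D(1) family_subgroup subgroup.m_inv_closed by metis
          then have z: "z \<in> V" "act X h z = x"
            using actV x VX(1)[OF x] gset_act_inv(2)[OF X HG[OF h]] by (auto simp: z_def)
          then show "s (act B h b) x = s b x" using s_act[OF h z(1) b] eqv h by metis
        qed (simp_all add: s_def)
        then show "act B h b = b" using sbij hb b by (auto simp: bij_betw_def dest: inj_onD)
      qed
    qed
    \<comment> \<open>Points of \<open>E\<close> over \<open>b\<close> correspond to points
      \<open>x\<close> of \<open>V\<close>, and \<open>e\<close> takes there the value
      \<open>s b x\<close>. So the product defining the norm at \<open>b\<close> runs over the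
      values of the section.\<close>
    have nrm_iff: "(H, b) \<in> gnrm E B c (grst E A e a) \<longleftrightarrow>
        (\<forall>h\<in>H. act B h b = b) \<and> (\<forall>x\<in>V. (stab X H x, s b x) \<in> a)" if b: "b \<in> pts B" "q b = y" for b
    proof (cases "\<forall>h\<in>H. act B h b = b")
      case True
      then have Hb: "(H, b) \<in> fixed_pairs B" using b D by (simp add: fixed_pairs_def)
      have mem: "(stab E H u, u) \<in> grst E A e a \<longleftrightarrow> (stab X H (p (e u)), e u) \<in> a"
        if u: "u \<in> pts E" "c u = b" for u
        using pairs_stab[OF E D(1) u(1)] pullback_stab[OF pb u(1)] Hb u
        by (simp add: mem_rst compose_def)
      have uV: "p (e u) \<in> V" if u: "u \<in> pts E" "c u = b" for u
        using bij_betwE[OF bij, rule_format, OF u(1)] u b by (simp add: V_def compose_def)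
      have "(\<forall>u\<in>pts E. c u = b \<longrightarrow> (stab E H u, u) \<in> grst E A e a) \<longleftrightarrow>
          (\<forall>x\<in>V. (stab X H x, s b x) \<in> a)" (is "?l \<longleftrightarrow> ?r")
      proof
        assume l: ?l
        show ?r
        proof
          fix x assume x: "x \<in> V"
          obtain u where u: "u \<in> pts E" "p (e u) = x" "c u = b" using w_ex[OF x b] by blast
          then show "(stab X H x, s b x) \<in> a" using l mem[OF u(1,3)] s_u[OF u(1)] x by simp
        qed
      next
        assume r: ?r
        show ?l
        proof (intro ballI impI)
          fix u assume u: "u \<in> pts E" "c u = b"
          show "(stab E H u, u) \<in> grst E A e a"
            using mem[OF u] r uV[OF u] s_u[OF u(1) uV[OF u]] u by force
        qed
      qed
      then show ?thesis using True Hb by (simp add: mem_nrm)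
    next
      case False
      then show ?thesis using pairs_D(3)[of H b B] by (auto simp: mem_nrm)
    qed
    define Sec where "Sec = {s \<in> V \<rightarrow>\<^sub>E pts A. (\<forall>x\<in>V. p (s x) = x \<and> (stab X H x, s x) \<in> a) \<and>
      (\<forall>h\<in>H. \<forall>x\<in>V. s (act X h x) = act A h (s x))}"
    define B' where "B' = {b \<in> pts B. q b = y \<and> (H, b) \<in> gnrm E B c (grst E A e a)}"
    have "bij_betw s B' Sec"
    proof (rule bij_betw_imageI)
      show "inj_on s B'" using sbij unfolding B'_def bij_betw_def by (auto intro: inj_on_subset)
      have "b \<in> B' \<longleftrightarrow> s b \<in> Sec" if b: "b \<in> pts B" "q b = y" for b
      proof -
        have "s b \<in> V \<rightarrow>\<^sub>E pts A" "\<forall>x\<in>V. p (s b x) = x" using bij_betwE[OF sbij] b by (auto simp: V_def)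
        then show ?thesis using b nrm_iff[OF b] fix_iff[OF b] by (auto simp: B'_def Sec_def)
      qed
      moreover have "\<exists>b\<in>pts B. q b = y \<and> t = s b" if "t \<in> Sec" for t
      proof -
        have "t \<in> s ` {b \<in> pts B. q b = y}"
          using sbij that by (simp add: bij_betw_def Sec_def V_def)
        then show ?thesis by blast
      qed
      ultimately show "s ` B' = Sec" by (auto simp: B'_def) blast
    qed
    then have "card B' = card Sec" by (rule bij_betw_same_card)
    then show ?thesis
      using odd_card_equivariant_sections[OF p a D(1), of V] actV
      by (auto simp: V_def B'_def Sec_def)
  qed
  then show ?thesis by (auto simp: mem_nrm mem_trf)
qed

lemma tambara_ghost: "tambara G ghost"
proof (rule tambara.intro[OF mackey_ghost tambara_axioms.intro])
  show "cring (lev ghost X)" if "fin_gset G X" for X using ghost_cring[OF that] .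
qed (use rst_ring_hom_ghost nrm_hom_ghost nrm_one_ghost nrm_id_ghost nrm_comp_ghost rst_nrm_ghost
    nrm_trf_ghost in \<open>simp_all\<close>)

end

section \<open>Maps of Tambara functors and joint embeddings\<close>

text \<open>Unlike \<open>tambara_hom\<close>, this allows different types of elements and
  presupposes nothing about source and target, so it can be used to prove that the source is a
  Tambara functor. Preservation of zero is therefore a clause of its own.\<close>

definition levelwise_hom ::
  "'g monoid \<Rightarrow> ('g, 'u) tamb \<Rightarrow> ('g, 'v) tamb \<Rightarrow> ('g gset \<Rightarrow> 'u \<Rightarrow> 'v) \<Rightarrow> bool" where
  "levelwise_hom G R S h \<longleftrightarrow>
     (\<forall>X. fin_gset G X \<longrightarrow> h X \<in> ring_hom (lev R X) (lev S X) \<and> h X \<zero>\<^bsub>lev R X\<^esub> = \<zero>\<^bsub>lev S X\<^esub>) \<and>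
     (\<forall>X Y f. gmap G X Y f \<longrightarrow>
        (\<forall>a\<in>carrier (lev R Y). h X (rst R X Y f a) = rst S X Y f (h Y a)) \<and>
        (\<forall>a\<in>carrier (lev R X). h Y (trf R X Y f a) = trf S X Y f (h X a)) \<and>
        (\<forall>a\<in>carrier (lev R X). h Y (nrm R X Y f a) = nrm S X Y f (h X a)))"

lemma levelwise_homD:
  assumes "levelwise_hom G R S h"
  shows "fin_gset G X \<Longrightarrow> a \<in> carrier (lev R X) \<Longrightarrow> h X a \<in> carrier (lev S X)"
    and "fin_gset G X \<Longrightarrow> h X \<zero>\<^bsub>lev R X\<^esub> = \<zero>\<^bsub>lev S X\<^esub>"
    and "fin_gset G X \<Longrightarrow> h X \<one>\<^bsub>lev R X\<^esub> = \<one>\<^bsub>lev S X\<^esub>"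
    and "fin_gset G X \<Longrightarrow> a \<in> carrier (lev R X) \<Longrightarrow> b \<in> carrier (lev R X) \<Longrightarrow>
      h X (a \<oplus>\<^bsub>lev R X\<^esub> b) = h X a \<oplus>\<^bsub>lev S X\<^esub> h X b"
    and "fin_gset G X \<Longrightarrow> a \<in> carrier (lev R X) \<Longrightarrow> b \<in> carrier (lev R X) \<Longrightarrow>
      h X (a \<otimes>\<^bsub>lev R X\<^esub> b) = h X a \<otimes>\<^bsub>lev S X\<^esub> h X b"
    and "gmap G X Y f \<Longrightarrow> a \<in> carrier (lev R Y) \<Longrightarrow> h X (rst R X Y f a) = rst S X Y f (h Y a)"
    and "gmap G X Y f \<Longrightarrow> a \<in> carrier (lev R X) \<Longrightarrow> h Y (trf R X Y f a) = trf S X Y f (h X a)"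
    and "gmap G X Y f \<Longrightarrow> a \<in> carrier (lev R X) \<Longrightarrow> h Y (nrm R X Y f a) = nrm S X Y f (h X a)"
  using assms by (auto simp: levelwise_hom_def ring_hom_def)

lemma levelwise_homI:
  assumes "\<And>X a. fin_gset G X \<Longrightarrow> a \<in> carrier (lev R X) \<Longrightarrow> h X a \<in> carrier (lev S X)"
    and "\<And>X. fin_gset G X \<Longrightarrow> h X \<zero>\<^bsub>lev R X\<^esub> = \<zero>\<^bsub>lev S X\<^esub>"
    and "\<And>X. fin_gset G X \<Longrightarrow> h X \<one>\<^bsub>lev R X\<^esub> = \<one>\<^bsub>lev S X\<^esub>"
    and "\<And>X a b. fin_gset G X \<Longrightarrow> a \<in> carrier (lev R X) \<Longrightarrow> b \<in> carrier (lev R X) \<Longrightarrow>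
      h X (a \<oplus>\<^bsub>lev R X\<^esub> b) = h X a \<oplus>\<^bsub>lev S X\<^esub> h X b"
    and "\<And>X a b. fin_gset G X \<Longrightarrow> a \<in> carrier (lev R X) \<Longrightarrow> b \<in> carrier (lev R X) \<Longrightarrow>
      h X (a \<otimes>\<^bsub>lev R X\<^esub> b) = h X a \<otimes>\<^bsub>lev S X\<^esub> h X b"
    and "\<And>X Y f a. gmap G X Y f \<Longrightarrow> a \<in> carrier (lev R Y) \<Longrightarrow> h X (rst R X Y f a) = rst S X Y f (h Y a)"
    and "\<And>X Y f a. gmap G X Y f \<Longrightarrow> a \<in> carrier (lev R X) \<Longrightarrow> h Y (trf R X Y f a) = trf S X Y f (h X a)"
    and "\<And>X Y f a. gmap G X Y f \<Longrightarrow> a \<in> carrier (lev R X) \<Longrightarrow> h Y (nrm R X Y f a) = nrm S X Y f (h X a)"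
  shows "levelwise_hom G R S h"
  unfolding levelwise_hom_def using assms by (auto intro!: ring_hom_memI)

lemma levelwise_hom_comp:
  assumes "levelwise_hom G R S h" "levelwise_hom G S T k"
  shows "levelwise_hom G R T (\<lambda>X a. k X (h X a))"
  by (rule levelwise_homI)
    (simp_all add: levelwise_homD[OF assms(1)] levelwise_homD[OF assms(2)] gmap_def)

lemma levelwise_hom_id: "levelwise_hom G R R (\<lambda>X a. a)"
  by (rule levelwise_homI) auto

lemma (in tambara)
  shows fin_src: "gmap G X Y f \<Longrightarrow> fin_gset G X" and fin_tgt: "gmap G X Y f \<Longrightarrow> fin_gset G Y"
  by (auto simp: gmap_def)

lemma (in tambara)
  shows rst_closed: "gmap G X Y f \<Longrightarrow> a \<in> carrier (lev R Y) \<Longrightarrow> rst R X Y f a \<in> carrier (lev R X)"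
    and trf_closed: "gmap G X Y f \<Longrightarrow> a \<in> carrier (lev R X) \<Longrightarrow> trf R X Y f a \<in> carrier (lev R Y)"
    and nrm_closed: "gmap G X Y f \<Longrightarrow> a \<in> carrier (lev R X) \<Longrightarrow> nrm R X Y f a \<in> carrier (lev R Y)"
  using ring_hom_closed[OF rst_ring_hom] hom_in_carrier[OF trf_hom] hom_in_carrier[OF nrm_hom] by auto

lemma (in tambara)
  shows rst_one: "gmap G X Y f \<Longrightarrow> rst R X Y f \<one>\<^bsub>lev R Y\<^esub> = \<one>\<^bsub>lev R X\<^esub>"
    and rst_zero: "gmap G X Y f \<Longrightarrow> rst R X Y f \<zero>\<^bsub>lev R Y\<^esub> = \<zero>\<^bsub>lev R X\<^esub>"
    and rst_mult: "gmap G X Y f \<Longrightarrow> a \<in> carrier (lev R Y) \<Longrightarrow> b \<in> carrier (lev R Y) \<Longrightarrow>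
      rst R X Y f (a \<otimes>\<^bsub>lev R Y\<^esub> b) = rst R X Y f a \<otimes>\<^bsub>lev R X\<^esub> rst R X Y f b"
    and rst_add: "gmap G X Y f \<Longrightarrow> a \<in> carrier (lev R Y) \<Longrightarrow> b \<in> carrier (lev R Y) \<Longrightarrow>
      rst R X Y f (a \<oplus>\<^bsub>lev R Y\<^esub> b) = rst R X Y f a \<oplus>\<^bsub>lev R X\<^esub> rst R X Y f b"
    and trf_add: "gmap G X Y f \<Longrightarrow> a \<in> carrier (lev R X) \<Longrightarrow> b \<in> carrier (lev R X) \<Longrightarrow>
      trf R X Y f (a \<oplus>\<^bsub>lev R X\<^esub> b) = trf R X Y f a \<oplus>\<^bsub>lev R Y\<^esub> trf R X Y f b"
    and nrm_mult: "gmap G X Y f \<Longrightarrow> a \<in> carrier (lev R X) \<Longrightarrow> b \<in> carrier (lev R X) \<Longrightarrow>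
      nrm R X Y f (a \<otimes>\<^bsub>lev R X\<^esub> b) = nrm R X Y f a \<otimes>\<^bsub>lev R Y\<^esub> nrm R X Y f b"
  using ring_hom_one[OF rst_ring_hom] ring_hom_zero[OF rst_ring_hom] ring_hom_mult[OF rst_ring_hom]
    ring_hom_add[OF rst_ring_hom] hom_mult[OF trf_hom] hom_mult[OF nrm_hom]
    level_cring[THEN cring.axioms(1)] fin_src fin_tgt
  by auto

lemma tambara_hom_iff:
  "tambara_hom G R S \<phi> \<longleftrightarrow> tambara G R \<and> tambara G S \<and> levelwise_hom G R S \<phi>"
proof -
  have "\<phi> X \<zero>\<^bsub>lev R X\<^esub> = \<zero>\<^bsub>lev S X\<^esub>"
    if "tambara G R" "tambara G S" "\<phi> X \<in> ring_hom (lev R X) (lev S X)" "fin_gset G X" for X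
    using ring_hom_zero[OF that(3)] tambara.level_cring[OF that(1,4)] tambara.level_cring[OF that(2,4)]
    by (simp add: cring.axioms(1))
  then show ?thesis unfolding tambara_hom_def levelwise_hom_def by blast
qed

lemma gexponentialD:
  assumes "gexponential G A X Y E B p f e c q"
  shows "gmap G A X p" "gmap G E A e" "gmap G X Y f" "gmap G E B c" "gmap G B Y q"
  using assms by (simp_all add: gexponential_def gpullback_def)

lemma gpullbackD:
  assumes "gpullback G X Y Z P f g p q"
  shows "gmap G X Z f" "gmap G Y Z g" "gmap G P X p" "gmap G P Y q"
  using assms by (simp_all add: gpullback_def)

lemma gcoproductD:
  assumes "gcoproduct G X Y Z i j"
  shows "gmap G X Z i" "gmap G Y Z j"
  using assms by (simp_all add: gcoproduct_def)

lemma gmap_compI: "gmap G X Y f \<Longrightarrow> gmap G Y Z g \<Longrightarrow> fin_gset G X \<Longrightarrow> gmap G X Z (compose (pts X) g f)"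
  by (auto simp: gmap_def compose_def PiE_iff fin_gset_def dest: group_action.element_image)

text \<open>All axioms but additivity are equations, which can be tested after a jointly injective family of
  maps; additivity becomes the existence of glued elements.\<close>

locale joint_embedding =
  fixes G :: "'g monoid" and S :: "('g, 'w) tamb" and I :: "'i set"
    and T :: "'i \<Rightarrow> ('g, 'v) tamb" and \<pi> :: "'i \<Rightarrow> 'g gset \<Rightarrow> 'w \<Rightarrow> 'v"
  assumes T: "i \<in> I \<Longrightarrow> tambara G (T i)"
    and \<pi>: "i \<in> I \<Longrightarrow> levelwise_hom G S (T i) (\<pi> i)"
    and inj: "fin_gset G X \<Longrightarrow> a \<in> carrier (lev S X) \<Longrightarrow> b \<in> carrier (lev S X) \<Longrightarrow>
      (\<And>i. i \<in> I \<Longrightarrow> \<pi> i X a = \<pi> i X b) \<Longrightarrow> a = b"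
    and zero: "fin_gset G X \<Longrightarrow> \<zero>\<^bsub>lev S X\<^esub> \<in> carrier (lev S X)"
    and one: "fin_gset G X \<Longrightarrow> \<one>\<^bsub>lev S X\<^esub> \<in> carrier (lev S X)"
    and add: "fin_gset G X \<Longrightarrow> a \<in> carrier (lev S X) \<Longrightarrow> b \<in> carrier (lev S X) \<Longrightarrow>
      a \<oplus>\<^bsub>lev S X\<^esub> b \<in> carrier (lev S X)"
    and mult: "fin_gset G X \<Longrightarrow> a \<in> carrier (lev S X) \<Longrightarrow> b \<in> carrier (lev S X) \<Longrightarrow>
      a \<otimes>\<^bsub>lev S X\<^esub> b \<in> carrier (lev S X)"
    and neg: "fin_gset G X \<Longrightarrow> a \<in> carrier (lev S X) \<Longrightarrow>
      \<exists>b\<in>carrier (lev S X). b \<oplus>\<^bsub>lev S X\<^esub> a = \<zero>\<^bsub>lev S X\<^esub>"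
    and rst: "gmap G X Y f \<Longrightarrow> a \<in> carrier (lev S Y) \<Longrightarrow> rst S X Y f a \<in> carrier (lev S X)"
    and trf: "gmap G X Y f \<Longrightarrow> a \<in> carrier (lev S X) \<Longrightarrow> trf S X Y f a \<in> carrier (lev S Y)"
    and nrm: "gmap G X Y f \<Longrightarrow> a \<in> carrier (lev S X) \<Longrightarrow> nrm S X Y f a \<in> carrier (lev S Y)"
    and glue: "gcoproduct G X Y Z i\<^sub>1 i\<^sub>2 \<Longrightarrow> a \<in> carrier (lev S X) \<Longrightarrow> b \<in> carrier (lev S Y) \<Longrightarrow>
      \<exists>c\<in>carrier (lev S Z). rst S X Z i\<^sub>1 c = a \<and> rst S Y Z i\<^sub>2 c = b"
begin

lemma fin: "gmap G X Y f \<Longrightarrow> fin_gset G X" "gmap G X Y f \<Longrightarrow> fin_gset G Y"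
  by (auto simp: gmap_def)

lemmas \<pi>D = levelwise_homD[OF \<pi>]

lemma cring_level:
  assumes X: "fin_gset G X" shows "cring (lev S X)"
proof -
  have ci: "cring (lev (T i) X)" if "i \<in> I" for i using tambara.level_cring[OF T[OF that] X] .
  note cl = zero[OF X] one[OF X] add[OF X] mult[OF X]
  have r_one: "x \<otimes>\<^bsub>lev (T i) X\<^esub> \<one>\<^bsub>lev (T i) X\<^esub> = x" if "i \<in> I" "x \<in> carrier (lev (T i) X)" for i x
    using cring.cring_simprules(6,12,14)[OF ci[OF that(1)]] that(2) by metis
  note simps = \<pi>D(1-5)[OF _ X] cring.cring_simprules(1,2,5-8,10-14,16,23-)[OF ci] cl r_one
  show ?thesis
  proof (rule cringI)
    show "abelian_group (lev S X)"
      by (rule abelian_groupI; (rule neg[OF X])?; (rule inj[OF X])?; simp add: simps)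
    show "comm_monoid (lev S X)"
      by (rule comm_monoidI; (rule inj[OF X])?; simp add: simps)
  qed (rule inj[OF X]; simp add: simps)
qed

lemma tambara: "tambara G S"
proof (rule tambara.intro[OF mackey_functor.intro tambara_axioms.intro])
  show "abelian_group (lev S X)" "cring (lev S X)" if "fin_gset G X" for X
    using cring_level[OF that] by (simp_all add: cring.axioms(1) ring.is_abelian_group)
  fix X Y Z f g
  assume f: "gmap G X Y f"
  note X = fin(1)[OF f] and Y = fin(2)[OF f]
  note cl = add[OF X] add[OF Y] mult[OF X] mult[OF Y] rst[OF f] trf[OF f] nrm[OF f] one[OF X] one[OF Y]
  have rst_add: "rst S X Y f (a \<oplus>\<^bsub>lev S Y\<^esub> b) = rst S X Y f a \<oplus>\<^bsub>lev S X\<^esub> rst S X Y f b"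
    if "a \<in> carrier (lev S Y)" "b \<in> carrier (lev S Y)" for a b
    by (rule inj[OF X]) (use that cl f X Y in \<open>simp_all add: \<pi>D tambara.rst_add[OF T]\<close>)
  have rst_mult: "rst S X Y f (a \<otimes>\<^bsub>lev S Y\<^esub> b) = rst S X Y f a \<otimes>\<^bsub>lev S X\<^esub> rst S X Y f b"
    if "a \<in> carrier (lev S Y)" "b \<in> carrier (lev S Y)" for a b
    by (rule inj[OF X]) (use that cl f X Y in \<open>simp_all add: \<pi>D tambara.rst_mult[OF T]\<close>)
  have rst_one: "rst S X Y f \<one>\<^bsub>lev S Y\<^esub> = \<one>\<^bsub>lev S X\<^esub>"
    by (rule inj[OF X]) (use cl f X Y in \<open>simp_all add: \<pi>D tambara.rst_one[OF T]\<close>)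
  have trf_add: "trf S X Y f (a \<oplus>\<^bsub>lev S X\<^esub> b) = trf S X Y f a \<oplus>\<^bsub>lev S Y\<^esub> trf S X Y f b"
    if "a \<in> carrier (lev S X)" "b \<in> carrier (lev S X)" for a b
    by (rule inj[OF Y]) (use that cl f X Y in \<open>simp_all add: \<pi>D tambara.trf_add[OF T]\<close>)
  have nrm_mult: "nrm S X Y f (a \<otimes>\<^bsub>lev S X\<^esub> b) = nrm S X Y f a \<otimes>\<^bsub>lev S Y\<^esub> nrm S X Y f b"
    if "a \<in> carrier (lev S X)" "b \<in> carrier (lev S X)" for a b
    by (rule inj[OF Y]) (use that cl f X Y in \<open>simp_all add: \<pi>D tambara.nrm_mult[OF T]\<close>)
  show "rst S X Y f \<in> hom (add_monoid (lev S Y)) (add_monoid (lev S X))"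
    by (rule homI) (use cl rst_add in simp_all)
  show "trf S X Y f \<in> hom (add_monoid (lev S X)) (add_monoid (lev S Y))"
    by (rule homI) (use cl trf_add in simp_all)
  show "rst S X Y f \<in> ring_hom (lev S Y) (lev S X)"
    by (rule ring_hom_memI) (use cl rst_add rst_mult rst_one in simp_all)
  show "nrm S X Y f \<in> hom (lev S X) (lev S Y)"
    by (rule homI) (use cl nrm_mult in simp_all)
  show "nrm S X Y f \<one>\<^bsub>lev S X\<^esub> = \<one>\<^bsub>lev S Y\<^esub>"
    by (rule inj[OF Y]) (use cl f X Y in \<open>simp_all add: \<pi>D tambara.nrm_one[OF T]\<close>)
  fix Z g assume g: "gmap G Y Z g"
  note gf = gmap_compI[OF f g X] and Z = fin(2)[OF g]
  show "rst S X Z (compose (pts X) g f) a = rst S X Y f (rst S Y Z g a)" if "a \<in> carrier (lev S Z)" for a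
    by (rule inj[OF X])
      (use that rst[OF f] rst[OF g] rst[OF gf] f g gf Z in \<open>simp_all add: \<pi>D mackey_functor.rst_comp[OF tambara.axioms(1)[OF T]]\<close>)
  show "trf S X Z (compose (pts X) g f) a = trf S Y Z g (trf S X Y f a)" if "a \<in> carrier (lev S X)" for a
    by (rule inj[OF Z])
      (use that trf[OF f] trf[OF g] trf[OF gf] f g gf X in \<open>simp_all add: \<pi>D mackey_functor.trf_comp[OF tambara.axioms(1)[OF T]]\<close>)
  show "nrm S X Z (compose (pts X) g f) a = nrm S Y Z g (nrm S X Y f a)" if "a \<in> carrier (lev S X)" for a
    by (rule inj[OF Z])
      (use that nrm[OF f] nrm[OF g] nrm[OF gf] f g gf X in \<open>simp_all add: \<pi>D tambara.nrm_comp[OF T]\<close>)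
next
  fix X a assume X: "fin_gset G X" and a: "a \<in> carrier (lev S X)"
  then have id: "gmap G X X (\<lambda>x\<in>pts X. x)"
    by (auto simp: gmap_def fin_gset_def dest: group_action.element_image)
  show "rst S X X (\<lambda>x\<in>pts X. x) a = a"
    by (rule inj[OF X]) (use a X id rst in \<open>simp_all add: \<pi>D mackey_functor.rst_id[OF tambara.axioms(1)[OF T]]\<close>)
  show "trf S X X (\<lambda>x\<in>pts X. x) a = a"
    by (rule inj[OF X]) (use a X id trf in \<open>simp_all add: \<pi>D mackey_functor.trf_id[OF tambara.axioms(1)[OF T]]\<close>)
  show "nrm S X X (\<lambda>x\<in>pts X. x) a = a"
    by (rule inj[OF X]) (use a X id nrm in \<open>simp_all add: \<pi>D tambara.nrm_id[OF T]\<close>)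
next
  fix X Y Z P f g p q a assume P: "gpullback G X Y Z P f g p q" and a: "a \<in> carrier (lev S X)"
  note D = gpullbackD[OF P]
  show "rst S Y Z g (trf S X Z f a) = trf S P Y q (rst S P X p a)"
    by (rule inj[OF fin(1)[OF D(2)]])
      (use a D rst trf fin in \<open>simp_all add: \<pi>D mackey_functor.rst_trf[OF tambara.axioms(1)[OF T] P]\<close>)
  show "rst S Y Z g (nrm S X Z f a) = nrm S P Y q (rst S P X p a)"
    by (rule inj[OF fin(1)[OF D(2)]])
      (use a D rst nrm fin in \<open>simp_all add: \<pi>D tambara.rst_nrm[OF T P]\<close>)
next
  fix A X Y E B p f e c q a
  assume E: "gexponential G A X Y E B p f e c q" and a: "a \<in> carrier (lev S A)"
  note D = gexponentialD[OF E]
  show "nrm S X Y f (trf S A X p a) = trf S B Y q (nrm S E B c (rst S E A e a))"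
    by (rule inj[OF fin(2)[OF D(3)]])
      (use a D rst trf nrm fin in \<open>simp_all add: \<pi>D tambara.nrm_trf[OF T E]\<close>)
next
  fix X Y Z i j assume C: "gcoproduct G X Y Z i j"
  note D = gcoproductD[OF C]
  \<comment> \<open>Injectivity is tested on the components, which are additive; surjectivity is the
    assumption \<open>glue\<close>.\<close>
  show "bij_betw (\<lambda>a. (rst S X Z i a, rst S Y Z j a)) (carrier (lev S Z))
      (carrier (lev S X) \<times> carrier (lev S Y))"
  proof (rule bij_betw_imageI)
    show "inj_on (\<lambda>a. (rst S X Z i a, rst S Y Z j a)) (carrier (lev S Z))"
    proof (rule inj_onI)
      fix a b assume ab: "a \<in> carrier (lev S Z)" "b \<in> carrier (lev S Z)"
        and eq: "(rst S X Z i a, rst S Y Z j a) = (rst S X Z i b, rst S Y Z j b)"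
      show "a = b"
      proof (rule inj[OF fin(2)[OF D(1)] ab])
        fix k assume k: "k \<in> I"
        have "bij_betw (\<lambda>a. (rst (T k) X Z i a, rst (T k) Y Z j a)) (carrier (lev (T k) Z))
            (carrier (lev (T k) X) \<times> carrier (lev (T k) Y))"
          using mackey_functor.additive[OF tambara.axioms(1)[OF T[OF k]] C] .
        moreover have "rst (T k) X Z i (\<pi> k Z a) = rst (T k) X Z i (\<pi> k Z b)"
          "rst (T k) Y Z j (\<pi> k Z a) = rst (T k) Y Z j (\<pi> k Z b)"
          using eq \<pi>D(6)[OF k D(1)] \<pi>D(6)[OF k D(2)] ab by (metis Pair_inject)+
        ultimately show "\<pi> k Z a = \<pi> k Z b"
          using \<pi>D(1)[OF k fin(2)[OF D(1)]] ab by (auto simp: bij_betw_def dest: inj_onD)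
      qed
    qed
    show "(\<lambda>a. (rst S X Z i a, rst S Y Z j a)) ` carrier (lev S Z) =
        carrier (lev S X) \<times> carrier (lev S Y)"
      using rst[OF D(1)] rst[OF D(2)] glue[OF C] by (fastforce simp: image_iff)
  qed
qed

end

section \<open>Transport to another type of elements\<close>

text \<open>Structure transported along \<open>e\<close> onto its image. Only \<open>d\<close> after
  \<open>e\<close> needs to be the identity on the levels of \<open>R\<close>; the levels of the
  result are images under \<open>e\<close>, so the other composite is then the identity
  there.\<close>

definition transport :: "('g gset \<Rightarrow> 'v \<Rightarrow> 'u) \<Rightarrow> ('g gset \<Rightarrow> 'u \<Rightarrow> 'v) \<Rightarrow> ('g, 'v) tamb \<Rightarrow> ('g, 'u) tamb" where
  "transport e d R = \<lparr>
     lev = (\<lambda>X. \<lparr>carrier = e X ` carrier (lev R X),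
       mult = (\<lambda>a b. e X (d X a \<otimes>\<^bsub>lev R X\<^esub> d X b)), one = e X \<one>\<^bsub>lev R X\<^esub>,
       zero = e X \<zero>\<^bsub>lev R X\<^esub>, add = (\<lambda>a b. e X (d X a \<oplus>\<^bsub>lev R X\<^esub> d X b))\<rparr>),
     rst = (\<lambda>X Y f a. e X (rst R X Y f (d Y a))),
     trf = (\<lambda>X Y f a. e Y (trf R X Y f (d X a))),
     nrm = (\<lambda>X Y f a. e Y (nrm R X Y f (d X a)))\<rparr>"

lemma transport_tambara:
  assumes "tambara G R"
    and de: "\<And>X a. fin_gset G X \<Longrightarrow> a \<in> carrier (lev R X) \<Longrightarrow> d X (e X a) = a"
  shows "tambara G (transport e d R)"
    and "levelwise_hom G R (transport e d R) e" "levelwise_hom G (transport e d R) R d"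
proof -
  interpret tambara G R by fact
  note [simp] = rst_closed trf_closed nrm_closed fin_src fin_tgt de
  have ring: "\<zero>\<^bsub>lev R X\<^esub> \<in> carrier (lev R X)" "\<one>\<^bsub>lev R X\<^esub> \<in> carrier (lev R X)"
    "a \<in> carrier (lev R X) \<Longrightarrow> b \<in> carrier (lev R X) \<Longrightarrow> a \<oplus>\<^bsub>lev R X\<^esub> b \<in> carrier (lev R X)"
    "a \<in> carrier (lev R X) \<Longrightarrow> b \<in> carrier (lev R X) \<Longrightarrow> a \<otimes>\<^bsub>lev R X\<^esub> b \<in> carrier (lev R X)"
    if "fin_gset G X" for X a b
  proof -
    interpret cring "lev R X" using level_cring[OF that] .
    show "\<zero>\<^bsub>lev R X\<^esub> \<in> carrier (lev R X)" "\<one>\<^bsub>lev R X\<^esub> \<in> carrier (lev R X)"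
      "a \<in> carrier (lev R X) \<Longrightarrow> b \<in> carrier (lev R X) \<Longrightarrow> a \<oplus>\<^bsub>lev R X\<^esub> b \<in> carrier (lev R X)"
      "a \<in> carrier (lev R X) \<Longrightarrow> b \<in> carrier (lev R X) \<Longrightarrow> a \<otimes>\<^bsub>lev R X\<^esub> b \<in> carrier (lev R X)"
      by simp_all
  qed
  show e: "levelwise_hom G R (transport e d R) e"
    by (rule levelwise_homI) (simp_all add: transport_def)
  show d: "levelwise_hom G (transport e d R) R d"
    by (rule levelwise_homI) (auto simp: transport_def ring)
  \<comment> \<open>A family with the single member \<open>d\<close>, which is injective on the
    images under \<open>e\<close>.\<close>
  interpret joint_embedding G "transport e d R" "{()}" "\<lambda>_. R" "\<lambda>_. d"
  proof
    fix X a assume X: "fin_gset G X" and a: "a \<in> carrier (lev (transport e d R) X)"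
    interpret cring "lev R X" using level_cring[OF X] .
    from a obtain b where b: "b \<in> carrier (lev R X)" "a = e X b" by (auto simp: transport_def)
    have "e X (\<ominus>\<^bsub>lev R X\<^esub> b) \<oplus>\<^bsub>lev (transport e d R) X\<^esub> a = \<zero>\<^bsub>lev (transport e d R) X\<^esub>"
      using b X by (simp add: transport_def l_neg)
    moreover have "e X (\<ominus>\<^bsub>lev R X\<^esub> b) \<in> carrier (lev (transport e d R) X)"
      using b by (simp add: transport_def)
    ultimately show "\<exists>b\<in>carrier (lev (transport e d R) X).
        b \<oplus>\<^bsub>lev (transport e d R) X\<^esub> a = \<zero>\<^bsub>lev (transport e d R) X\<^esub>" by blast
  next
    fix X Y Z i j a b
    assume C: "gcoproduct G X Y Z i j" and ab: "a \<in> carrier (lev (transport e d R) X)"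
      "b \<in> carrier (lev (transport e d R) Y)"
    note D = gcoproductD[OF C]
    from ab obtain a' b' where a': "a' \<in> carrier (lev R X)" "a = e X a'"
      and b': "b' \<in> carrier (lev R Y)" "b = e Y b'" by (auto simp: transport_def)
    then have "(a', b') \<in> (\<lambda>a. (rst R X Z i a, rst R Y Z j a)) ` carrier (lev R Z)"
      using additive[OF C] by (simp add: bij_betw_def)
    then obtain c where "c \<in> carrier (lev R Z)" "rst R X Z i c = a'" "rst R Y Z j c = b'" by auto
    then show "\<exists>c\<in>carrier (lev (transport e d R) Z).
        rst (transport e d R) X Z i c = a \<and> rst (transport e d R) Y Z j c = b"
      using a' b' fin_tgt[OF D(1)] by (auto simp: transport_def)
  qed (use d assms(1) in \<open>auto simp: transport_def ring\<close>)
  show "tambara G (transport e d R)" by (rule tambara)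
qed

text \<open>Since \<open>'u\<close> is infinite it contains a copy of the natural numbers, which is
  enough room for each countable level. All functors of the theorem and the free algebra reach the
  prescribed type in this way.\<close>

lemma tambara_in_universe:
  assumes R: "tambara G R" and "\<And>X. fin_gset G X \<Longrightarrow> countable (carrier (lev R X))"
  obtains R' :: "('g, 'u::infinite) tamb" and e d where "tambara G R'"
    "levelwise_hom G R R' e" "levelwise_hom G R' R d"
    "\<And>X a. fin_gset G X \<Longrightarrow> a \<in> carrier (lev R X) \<Longrightarrow> d X (e X a) = a"
    "\<And>X a. fin_gset G X \<Longrightarrow> a \<in> carrier (lev R' X) \<Longrightarrow> e X (d X a) = a"
proof -
  obtain f :: "nat \<Rightarrow> 'u" where f: "inj f"
    using infinite_countable_subset[OF infinite_UNIV] by blast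
  define e where "e X = f \<circ> to_nat_on (carrier (lev R X))" for X
  define d where "d X = the_inv_into (carrier (lev R X)) (e X)" for X
  have de: "d X (e X a) = a" if "fin_gset G X" "a \<in> carrier (lev R X)" for X a
  proof -
    have "inj_on (e X) (carrier (lev R X))"
      unfolding e_def using f inj_on_to_nat_on[OF assms(2)[OF that(1)]] by (auto intro: comp_inj_on inj_on_subset)
    then show ?thesis unfolding d_def using that(2) by (rule the_inv_into_f_f)
  qed
  have "e X (d X a) = a" if "fin_gset G X" "a \<in> carrier (lev (transport e d R) X)" for X a
    using that de by (auto simp: transport_def)
  then show ?thesis using that[of "transport e d R" e d] transport_tambara[of G R d e, OF R de] de by blast
qed

section \<open>Free algebras\<close>

text \<open>Formal terms over numbered operations of arbitrary list arity. There are countably many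
  of them, so their values form a countable set closed under the operations; terms without arguments
  provide its constants.\<close>

datatype op_tree = Op nat "op_tree list"

primrec eval_tree :: "(nat \<Rightarrow> 'b list \<Rightarrow> 'b) \<Rightarrow> op_tree \<Rightarrow> 'b" where
  "eval_tree F (Op n ts) = F n (map (eval_tree F) ts)"

instance op_tree :: countable
  by countable_datatype

lemma countable_operation_closure:
  assumes "countable F"
  obtains C where "countable C" "\<And>f xs. f \<in> F \<Longrightarrow> set xs \<subseteq> C \<Longrightarrow> f xs \<in> C"
proof
  let ?C = "range (eval_tree (from_nat_into F))"
  show "countable ?C" by simp
  fix f :: "'a list \<Rightarrow> 'a" and xs assume f: "f \<in> F" and xs: "set xs \<subseteq> ?C"
  obtain n where n: "from_nat_into F n = f" using from_nat_into_surj[OF assms f] by blast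
  have "\<exists>ts. xs = map (eval_tree (from_nat_into F)) ts"
    using xs by (auto simp: subset_iff image_iff ex_map_conv)
  then obtain ts where "xs = map (eval_tree (from_nat_into F)) ts" by blast
  then have "f xs = eval_tree (from_nat_into F) (Op n ts)" using n by simp
  then show "f xs \<in> ?C" by blast
qed

text \<open>An action on a finite set of natural numbers is a finite table. The bound is needed
  because the operations generating the free algebra are indexed by G-sets and their maps.\<close>

lemma (in finite_group) countable_gsets: "countable {X. fin_gset G X}"
proof -
  let ?h = "\<lambda>X. (pts X, \<lambda>p\<in>carrier G \<times> pts X. act X (fst p) (snd p))"
  have sub: "?h ` {X. fin_gset G X} \<subseteq> (SIGMA A:Collect (finite :: nat set \<Rightarrow> bool). PiE (carrier G \<times> A) (\<lambda>_. UNIV))"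
    by (rule image_subsetI) (simp add: gset_finite restrict_PiE_iff)
  have cnt: "countable (SIGMA A:Collect (finite :: nat set \<Rightarrow> bool). PiE (carrier G \<times> A) (\<lambda>_. UNIV :: nat set))"
    using countable_Collect_finite finite_carrier by (intro countable_SIGMA countable_PiE) auto
  have "inj_on ?h {X. fin_gset G X}"
  proof (rule inj_onI)
    fix X Y :: "'a gset" assume X: "X \<in> {X. fin_gset G X}" and Y: "Y \<in> {X. fin_gset G X}" and "?h X = ?h Y"
    then have pts: "pts X = pts Y"
      and eq: "(\<lambda>p\<in>carrier G \<times> pts X. act X (fst p) (snd p)) = (\<lambda>p\<in>carrier G \<times> pts Y. act Y (fst p) (snd p))"
      by auto
    have "act X = act Y"
    proof (rule extensionalityI[of _ "carrier G"])
      fix g assume g: "g \<in> carrier G"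
      show "act X g = act Y g"
      proof (rule extensionalityI[of _ "pts X"])
        fix x assume "x \<in> pts X"
        then show "act X g x = act Y g x" using fun_cong[OF eq, of "(g, x)"] g pts by simp
      qed (use gset_act_ext[OF _ g, of X] gset_act_ext[OF _ g, of Y] X Y pts in auto)
    qed (use X Y in \<open>auto simp: fin_gset_def\<close>)
    then show "X = Y" using pts by simp
  qed
  then show ?thesis by (rule countable_image_inj_on[OF countable_subset[OF sub cnt]])
qed

lemma (in finite_group) countable_gmaps: "countable {(X, Y, f). gmap G X Y f}"
proof -
  have "{(X, Y, f). gmap G X Y f} \<subseteq>
      (SIGMA X:{X. fin_gset G X}. SIGMA Y:{Y. fin_gset G Y}. pts X \<rightarrow>\<^sub>E pts Y)"
    by (auto simp: gmap_def)
  moreover have "countable (SIGMA X:{X. fin_gset G X}. SIGMA Y:{Y. fin_gset G Y}. pts X \<rightarrow>\<^sub>E pts Y)"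
    using countable_gsets by (intro countable_SIGMA countable_PiE) (auto simp: gset_finite)
  ultimately show ?thesis by (rule countable_subset)
qed

text \<open>An index of the product below: a test algebra with a candidate for the image of the
  generator. Test algebras have levels in \<open>'u\<close>, so these data form a type and the
  product over all of them exists, though with elements in a larger type.\<close>

datatype ('g, 'u) pointed =
  Pointed (alg: "('g, 'u) tamb") (str: "'g gset \<Rightarrow> 'u \<Rightarrow> 'u") (elt: 'u)

text \<open>The free algebra on a generator at the level \<open>U\<close> is the subalgebra generated by the diagonal element in the product
  of all algebras with a chosen element at this level. It is countable, hence isomorphic
  to one in the given universe.\<close>

locale free_construction = finite_group G + R: tambara G R
  for G :: "'a monoid" (structure) and R :: "('a, 'u::infinite) tamb" +
  fixes U :: "'a gset"
  assumes countable_level: "fin_gset G X \<Longrightarrow> countable (carrier (lev R X))"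
    and U: "trans_gset G U"
begin

definition Idx :: "('a, 'u) pointed set" where
  "Idx = {i. tambara_hom G R (alg i) (str i) \<and> elt i \<in> carrier (lev (alg i) U)}"

text \<open>The inverse of the additivity bijection, taken in each component. With it among the
  closure operations of \<open>gen\<close>, the generated subalgebra is additive by
  construction.\<close>

definition glued :: "'a gset \<Rightarrow> 'a gset \<Rightarrow> 'a gset \<Rightarrow> (nat \<Rightarrow> nat) \<Rightarrow> (nat \<Rightarrow> nat) \<Rightarrow>
    (('a, 'u) pointed \<Rightarrow> 'u) \<Rightarrow> (('a, 'u) pointed \<Rightarrow> 'u) \<Rightarrow> ('a, 'u) pointed \<Rightarrow> 'u" where
  "glued X Y Z j k a b = (\<lambda>i\<in>Idx. the_inv_into (carrier (lev (alg i) Z))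
     (\<lambda>c. (rst (alg i) X Z j c, rst (alg i) Y Z k c)) (a i, b i))"

definition diag :: "'a gset \<Rightarrow> 'u \<Rightarrow> ('a, 'u) pointed \<Rightarrow> 'u" where
  "diag X r = (\<lambda>i\<in>Idx. str i X r)"

definition generator :: "('a, 'u) pointed \<Rightarrow> 'u" where
  "generator = (\<lambda>i\<in>Idx. elt i)"

definition product :: "('a, ('a, 'u) pointed \<Rightarrow> 'u) tamb" where
  "product = \<lparr>
     lev = (\<lambda>X. \<lparr>carrier = (\<Pi>\<^sub>E i\<in>Idx. carrier (lev (alg i) X)),
       mult = (\<lambda>a b. \<lambda>i\<in>Idx. a i \<otimes>\<^bsub>lev (alg i) X\<^esub> b i),
       one = (\<lambda>i\<in>Idx. \<one>\<^bsub>lev (alg i) X\<^esub>), zero = (\<lambda>i\<in>Idx. \<zero>\<^bsub>lev (alg i) X\<^esub>),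
       add = (\<lambda>a b. \<lambda>i\<in>Idx. a i \<oplus>\<^bsub>lev (alg i) X\<^esub> b i)\<rparr>),
     rst = (\<lambda>X Y f a. \<lambda>i\<in>Idx. rst (alg i) X Y f (a i)),
     trf = (\<lambda>X Y f a. \<lambda>i\<in>Idx. trf (alg i) X Y f (a i)),
     nrm = (\<lambda>X Y f a. \<lambda>i\<in>Idx. nrm (alg i) X Y f (a i))\<rparr>"

text \<open>Zero, one and negatives need no clauses: the first two are values of
  \<open>diag\<close>, and a negative is a product with the image of -1 from
  \<open>R\<close>.\<close>

inductive gen :: "'a gset \<Rightarrow> (('a, 'u) pointed \<Rightarrow> 'u) \<Rightarrow> bool" where
  gen_diag: "fin_gset G X \<Longrightarrow> r \<in> carrier (lev R X) \<Longrightarrow> gen X (diag X r)"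
| gen_generator: "gen U generator"
| gen_add: "gen X a \<Longrightarrow> gen X b \<Longrightarrow> gen X (a \<oplus>\<^bsub>lev product X\<^esub> b)"
| gen_mult: "gen X a \<Longrightarrow> gen X b \<Longrightarrow> gen X (a \<otimes>\<^bsub>lev product X\<^esub> b)"
| gen_rst: "gmap G X Y f \<Longrightarrow> gen Y a \<Longrightarrow> gen X (rst product X Y f a)"
| gen_trf: "gmap G X Y f \<Longrightarrow> gen X a \<Longrightarrow> gen Y (trf product X Y f a)"
| gen_nrm: "gmap G X Y f \<Longrightarrow> gen X a \<Longrightarrow> gen Y (nrm product X Y f a)"
| gen_glued: "gcoproduct G X Y Z j k \<Longrightarrow> gen X a \<Longrightarrow> gen Y b \<Longrightarrow> gen Z (glued X Y Z j k a b)"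

definition free :: "('a, ('a, 'u) pointed \<Rightarrow> 'u) tamb" where
  "free = product\<lparr>lev := (\<lambda>X. (lev product X)\<lparr>carrier := {a. gen X a}\<rparr>)\<rparr>"

lemma free_simps [simp]: "carrier (lev free X) = {a. gen X a}"
    "mult (lev free X) = mult (lev product X)" "add (lev free X) = add (lev product X)"
    "one (lev free X) = one (lev product X)" "zero (lev free X) = zero (lev product X)"
    "rst free = rst product" "trf free = trf product" "nrm free = nrm product"
  by (simp_all add: free_def)

lemma product_apply:
  assumes "i \<in> Idx"
  shows "diag X r i = str i X r" "generator i = elt i"
    "(a \<otimes>\<^bsub>lev product X\<^esub> b) i = a i \<otimes>\<^bsub>lev (alg i) X\<^esub> b i"
    "(a \<oplus>\<^bsub>lev product X\<^esub> b) i = a i \<oplus>\<^bsub>lev (alg i) X\<^esub> b i"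
    "\<one>\<^bsub>lev product X\<^esub> i = \<one>\<^bsub>lev (alg i) X\<^esub>" "\<zero>\<^bsub>lev product X\<^esub> i = \<zero>\<^bsub>lev (alg i) X\<^esub>"
    "rst product X Y f a i = rst (alg i) X Y f (a i)"
    "trf product X Y f a i = trf (alg i) X Y f (a i)"
    "nrm product X Y f a i = nrm (alg i) X Y f (a i)"
  using assms by (simp_all add: product_def diag_def generator_def)

lemma product_extensional:
  "diag X r \<in> extensional Idx" "generator \<in> extensional Idx"
  "a \<otimes>\<^bsub>lev product X\<^esub> b \<in> extensional Idx" "a \<oplus>\<^bsub>lev product X\<^esub> b \<in> extensional Idx"
  "\<one>\<^bsub>lev product X\<^esub> \<in> extensional Idx" "\<zero>\<^bsub>lev product X\<^esub> \<in> extensional Idx"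
  "rst product X Y f a \<in> extensional Idx" "trf product X Y f a \<in> extensional Idx"
  "nrm product X Y f a \<in> extensional Idx" "glued X Y Z j k a b \<in> extensional Idx"
  by (simp_all add: product_def diag_def generator_def glued_def)

lemmas product_ext = extensionalityI[of _ Idx]

lemma Idx_D:
  assumes "i \<in> Idx"
  shows "tambara G (alg i)" "levelwise_hom G R (alg i) (str i)" "elt i \<in> carrier (lev (alg i) U)"
  using assms by (auto simp: Idx_def tambara_hom_iff)

lemma glued_props:
  assumes C: "gcoproduct G X Y Z j k" and i: "i \<in> Idx"
    and a: "a i \<in> carrier (lev (alg i) X)" and b: "b i \<in> carrier (lev (alg i) Y)"
  shows "glued X Y Z j k a b i \<in> carrier (lev (alg i) Z)"
    "rst (alg i) X Z j (glued X Y Z j k a b i) = a i"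
    "rst (alg i) Y Z k (glued X Y Z j k a b i) = b i"
proof -
  let ?h = "\<lambda>c. (rst (alg i) X Z j c, rst (alg i) Y Z k c)"
  have bij: "bij_betw ?h (carrier (lev (alg i) Z)) (carrier (lev (alg i) X) \<times> carrier (lev (alg i) Y))"
    using mackey_functor.additive[OF tambara.axioms(1)[OF Idx_D(1)[OF i]] C] .
  then have im: "(a i, b i) \<in> ?h ` carrier (lev (alg i) Z)" using a b by (simp add: bij_betw_def)
  have eq: "glued X Y Z j k a b i = the_inv_into (carrier (lev (alg i) Z)) ?h (a i, b i)"
    using i by (simp add: glued_def)
  show "glued X Y Z j k a b i \<in> carrier (lev (alg i) Z)"
    unfolding eq using bij im by (intro the_inv_into_into) (auto simp: bij_betw_def)
  have "?h (glued X Y Z j k a b i) = (a i, b i)"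
    unfolding eq using bij im by (intro f_the_inv_into_f) (auto simp: bij_betw_def)
  then show "rst (alg i) X Z j (glued X Y Z j k a b i) = a i"
    "rst (alg i) Y Z k (glued X Y Z j k a b i) = b i" by auto
qed

lemma gen_D:
  assumes "gen X a"
  shows "fin_gset G X \<and> a \<in> extensional Idx \<and> (\<forall>i\<in>Idx. a i \<in> carrier (lev (alg i) X))"
  using assms
proof induction
  case (gen_diag X r)
  then show ?case
    by (simp add: product_apply product_extensional levelwise_homD(1)[OF Idx_D(2)])
next
  case gen_generator
  then show ?case using trans_fin[OF U] by (simp add: product_apply product_extensional Idx_D(3))
next
  case (gen_add X a b)
  then show ?case
    by (simp add: product_apply product_extensional tambara.level_cring[OF Idx_D(1), THEN cring.axioms(1)]
        ring.ring_simprules(1))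
next
  case (gen_mult X a b)
  then show ?case
    by (simp add: product_apply product_extensional tambara.level_cring[OF Idx_D(1), THEN cring.axioms(1)]
        ring.ring_simprules(5))
next
  case (gen_rst X Y f a)
  then show ?case
    using gmap_src[OF gen_rst(1)] tambara.rst_closed[OF Idx_D(1) gen_rst(1)]
    by (simp add: product_apply product_extensional)
next
  case (gen_trf X Y f a)
  then show ?case
    using gmap_tgt[OF gen_trf(1)] tambara.trf_closed[OF Idx_D(1) gen_trf(1)]
    by (simp add: product_apply product_extensional)
next
  case (gen_nrm X Y f a)
  then show ?case
    using gmap_tgt[OF gen_nrm(1)] tambara.nrm_closed[OF Idx_D(1) gen_nrm(1)]
    by (simp add: product_apply product_extensional)
next
  case (gen_glued X Y Z j k a b)
  then show ?case
    using glued_props(1)[OF gen_glued(1)] gmap_tgt[OF gcoproductD(1)[OF gen_glued(1)]]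
    by (simp add: product_extensional)
qed

lemma diag_hom: "levelwise_hom G R product diag"
proof (rule levelwise_homI)
  note h = levelwise_homD[OF Idx_D(2)] and pr = product_apply product_extensional
  show "diag X a \<in> carrier (lev product X)" if "fin_gset G X" "a \<in> carrier (lev R X)" for X a
    using that h(1) by (simp add: product_def diag_def)
  show "diag X \<zero>\<^bsub>lev R X\<^esub> = \<zero>\<^bsub>lev product X\<^esub>" "diag X \<one>\<^bsub>lev R X\<^esub> = \<one>\<^bsub>lev product X\<^esub>"
    if "fin_gset G X" for X
    by (rule product_ext; simp add: pr h that)+
  show "diag X (a \<oplus>\<^bsub>lev R X\<^esub> b) = diag X a \<oplus>\<^bsub>lev product X\<^esub> diag X b"
    "diag X (a \<otimes>\<^bsub>lev R X\<^esub> b) = diag X a \<otimes>\<^bsub>lev product X\<^esub> diag X b"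
    if "fin_gset G X" "a \<in> carrier (lev R X)" "b \<in> carrier (lev R X)" for X a b
    by (rule product_ext; simp add: pr h that)+
  fix X Y f a assume f: "gmap G X Y f"
  show "diag X (rst R X Y f a) = rst product X Y f (diag Y a)" if "a \<in> carrier (lev R Y)"
    by (rule product_ext; simp add: pr h f that)
  show "diag Y (trf R X Y f a) = trf product X Y f (diag X a)"
    "diag Y (nrm R X Y f a) = nrm product X Y f (diag X a)" if "a \<in> carrier (lev R X)"
    by (rule product_ext; simp add: pr h f that)+
qed

lemma diag_hom_free: "levelwise_hom G R free diag"
  using levelwise_homD[OF diag_hom] gen_diag by (intro levelwise_homI) simp_all

lemma gen_one_zero:
  assumes X: "fin_gset G X" shows "gen X \<one>\<^bsub>lev product X\<^esub>" "gen X \<zero>\<^bsub>lev product X\<^esub>"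
proof -
  interpret cring "lev R X" using R.level_cring[OF X] .
  show "gen X \<one>\<^bsub>lev product X\<^esub>" "gen X \<zero>\<^bsub>lev product X\<^esub>"
    using gen_diag[OF X one_closed] gen_diag[OF X zero_closed] by (simp_all add: levelwise_homD[OF diag_hom] X)
qed

lemma gen_neg:
  assumes X: "fin_gset G X" and a: "gen X a"
  shows "\<exists>b. gen X b \<and> b \<oplus>\<^bsub>lev product X\<^esub> a = \<zero>\<^bsub>lev product X\<^esub>"
proof -
  interpret R: cring "lev R X" using R.level_cring[OF X] .
  let ?m = "diag X (\<ominus>\<^bsub>lev R X\<^esub> \<one>\<^bsub>lev R X\<^esub>)"
  have m: "gen X ?m" using gen_diag[OF X] by simp
  have "(?m \<otimes>\<^bsub>lev product X\<^esub> a) \<oplus>\<^bsub>lev product X\<^esub> a = \<zero>\<^bsub>lev product X\<^esub>"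
  proof (rule product_ext)
    fix i assume i: "i \<in> Idx"
    interpret cring "lev (alg i) X" using tambara.level_cring[OF Idx_D(1)[OF i] X] .
    note h = levelwise_homD(1-5)[OF Idx_D(2)[OF i] X]
    have mi: "str i X (\<ominus>\<^bsub>lev R X\<^esub> \<one>\<^bsub>lev R X\<^esub>) \<in> carrier (lev (alg i) X)" using h(1) by simp
    have ai: "a i \<in> carrier (lev (alg i) X)" using gen_D[OF a] i by blast
    have "str i X (\<ominus>\<^bsub>lev R X\<^esub> \<one>\<^bsub>lev R X\<^esub>) \<oplus>\<^bsub>lev (alg i) X\<^esub> \<one>\<^bsub>lev (alg i) X\<^esub> = \<zero>\<^bsub>lev (alg i) X\<^esub>"
      using h(4)[of "\<ominus>\<^bsub>lev R X\<^esub> \<one>\<^bsub>lev R X\<^esub>" "\<one>\<^bsub>lev R X\<^esub>"] h(2,3) by (simp add: R.l_neg)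
    then have "(str i X (\<ominus>\<^bsub>lev R X\<^esub> \<one>\<^bsub>lev R X\<^esub>) \<oplus>\<^bsub>lev (alg i) X\<^esub> \<one>\<^bsub>lev (alg i) X\<^esub>)
        \<otimes>\<^bsub>lev (alg i) X\<^esub> a i = \<zero>\<^bsub>lev (alg i) X\<^esub>" using ai by simp
    then show "((?m \<otimes>\<^bsub>lev product X\<^esub> a) \<oplus>\<^bsub>lev product X\<^esub> a) i = \<zero>\<^bsub>lev product X\<^esub> i"
      using mi ai by (simp add: product_apply i l_distr)
  qed (simp_all add: product_extensional)
  then show ?thesis using gen_mult[OF m a] by blast
qed

lemma glued_rst:
  assumes C: "gcoproduct G X Y Z j k" and a: "gen X a" and b: "gen Y b"
  shows "rst product X Z j (glued X Y Z j k a b) = a" "rst product Y Z k (glued X Y Z j k a b) = b"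
proof -
  note A = gen_D[OF a] and B = gen_D[OF b]
  show "rst product X Z j (glued X Y Z j k a b) = a"
    by (rule product_ext) (use A B glued_props(2)[OF C] in \<open>simp_all add: product_apply product_extensional\<close>)
  show "rst product Y Z k (glued X Y Z j k a b) = b"
    by (rule product_ext) (use A B glued_props(3)[OF C] in \<open>simp_all add: product_apply product_extensional\<close>)
qed

lemma projection_hom: "i \<in> Idx \<Longrightarrow> levelwise_hom G free (alg i) (\<lambda>X a. a i)"
  by (rule levelwise_homI) (simp_all add: product_apply gen_D)

lemma free_tambara: "tambara G free"
proof -
  have "joint_embedding G free Idx alg (\<lambda>i X a. a i)"
  proof (rule joint_embedding.intro)
    fix X a b assume "a \<in> carrier (lev free X)" "b \<in> carrier (lev free X)"
      and eq: "\<And>i. i \<in> Idx \<Longrightarrow> a i = b i"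
    then show "a = b" using gen_D eq by (intro product_ext) auto
  next
    fix X a assume "fin_gset G X" "a \<in> carrier (lev free X)"
    then show "\<exists>b\<in>carrier (lev free X). b \<oplus>\<^bsub>lev free X\<^esub> a = \<zero>\<^bsub>lev free X\<^esub>"
      using gen_neg by simp
  next
    fix X Y Z j k a b
    assume C: "gcoproduct G X Y Z j k" "a \<in> carrier (lev free X)" "b \<in> carrier (lev free Y)"
    then show "\<exists>c\<in>carrier (lev free Z). rst free X Z j c = a \<and> rst free Y Z k c = b"
      using glued_rst[OF C(1)] gen_glued[OF C(1)] by (metis free_simps(1,6) mem_Collect_eq)
  qed (simp_all add: gen.intros gen_one_zero projection_hom Idx_D(1))
  then show ?thesis by (rule joint_embedding.tambara)
qed

text \<open>Each clause of \<open>gen\<close> becomes an operation on lists of pairs of a level and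
  an element, so that one untyped closure covers all levels at once. Operations that
  \<open>gen\<close> would not allow, such as gluing along maps that form no coproduct, only enlarge
  the countable upper bound.\<close>

lemma countable_free: "countable (carrier (lev free X))"
proof -
  define o_diag where "o_diag = (\<lambda>(X, r) (xs :: ('a gset \<times> (('a, 'u) pointed \<Rightarrow> 'u)) list). (X, diag X r))"
  define o_gen where "o_gen = (\<lambda>(xs :: ('a gset \<times> (('a, 'u) pointed \<Rightarrow> 'u)) list). (U, generator))"
  define o_add where "o_add X xs = (X, snd (xs ! 0) \<oplus>\<^bsub>lev product X\<^esub> snd (xs ! 1))"
    for X and xs :: "('a gset \<times> (('a, 'u) pointed \<Rightarrow> 'u)) list"
  define o_mult where "o_mult X xs = (X, snd (xs ! 0) \<otimes>\<^bsub>lev product X\<^esub> snd (xs ! 1))"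
    for X and xs :: "('a gset \<times> (('a, 'u) pointed \<Rightarrow> 'u)) list"
  define o_rst where "o_rst = (\<lambda>(X, Y, f) (xs :: ('a gset \<times> (('a, 'u) pointed \<Rightarrow> 'u)) list).
    (X, rst product X Y f (snd (xs ! 0))))"
  define o_trf where "o_trf = (\<lambda>(X, Y, f) (xs :: ('a gset \<times> (('a, 'u) pointed \<Rightarrow> 'u)) list).
    (Y, trf product X Y f (snd (xs ! 0))))"
  define o_nrm where "o_nrm = (\<lambda>(X, Y, f) (xs :: ('a gset \<times> (('a, 'u) pointed \<Rightarrow> 'u)) list).
    (Y, nrm product X Y f (snd (xs ! 0))))"
  define o_glued where "o_glued = (\<lambda>((X, Z, j), (Y, Z' :: 'a gset, k)) (xs :: ('a gset \<times> (('a, 'u) pointed \<Rightarrow> 'u)) list).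
    (Z, glued X Y Z j k (snd (xs ! 0)) (snd (xs ! 1))))"
  note o_defs = o_diag_def o_gen_def o_add_def o_mult_def o_rst_def o_trf_def o_nrm_def o_glued_def
  let ?X = "{X. fin_gset G X}" and ?f = "{(X, Y, f). gmap G X Y f}"
  define F where "F = o_diag ` (SIGMA X:?X. carrier (lev R X)) \<union> {o_gen} \<union> o_add ` ?X \<union> o_mult ` ?X \<union>
      o_rst ` ?f \<union> o_trf ` ?f \<union> o_nrm ` ?f \<union> o_glued ` (?f \<times> ?f)"
  have "countable F"
    unfolding F_def
    by (intro countable_Un countable_image countable_SIGMA countable_gsets countable_gmaps) (simp_all add: countable_level)
  then obtain C where C: "countable C" "\<And>f xs. f \<in> F \<Longrightarrow> set xs \<subseteq> C \<Longrightarrow> f xs \<in> C"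
    using countable_operation_closure by blast
  have F: "fin_gset G X \<Longrightarrow> r \<in> carrier (lev R X) \<Longrightarrow> o_diag (X, r) \<in> F" "o_gen \<in> F"
    "fin_gset G X \<Longrightarrow> o_add X \<in> F" "fin_gset G X \<Longrightarrow> o_mult X \<in> F"
    "gmap G X Y f \<Longrightarrow> o_rst (X, Y, f) \<in> F" "gmap G X Y f \<Longrightarrow> o_trf (X, Y, f) \<in> F"
    "gmap G X Y f \<Longrightarrow> o_nrm (X, Y, f) \<in> F"
    "gmap G X Z f \<Longrightarrow> gmap G Y Z g \<Longrightarrow> o_glued ((X, Z, f), (Y, Z, g)) \<in> F" for X Y Z r f g
    unfolding F_def by simp_all
  have "(X, a) \<in> C" if "gen X a" for X a
    using that
  proof induction
    case (gen_diag X r)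
    then show ?case using C(2)[OF F(1), of X r "[]"] by (simp add: o_defs)
  next
    case gen_generator
    then show ?case using C(2)[OF F(2), of "[]"] by (simp add: o_defs)
  next
    case (gen_add X a b)
    then show ?case using gen_D C(2)[OF F(3), of X "[(X, a), (X, b)]"] by (simp add: o_defs)
  next
    case (gen_mult X a b)
    then show ?case using gen_D C(2)[OF F(4), of X "[(X, a), (X, b)]"] by (simp add: o_defs)
  next
    case (gen_rst X Y f a)
    then show ?case using C(2)[OF F(5)[OF gen_rst(1)], of "[(Y, a)]"] by (simp add: o_defs)
  next
    case (gen_trf X Y f a)
    then show ?case using C(2)[OF F(6)[OF gen_trf(1)], of "[(X, a)]"] by (simp add: o_defs)
  next
    case (gen_nrm X Y f a)
    then show ?case using C(2)[OF F(7)[OF gen_nrm(1)], of "[(X, a)]"] by (simp add: o_defs)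
  next
    case (gen_glued X Y Z j k a b)
    then show ?case
      using C(2)[OF F(8)[OF gcoproductD[OF gen_glued(1)]], of "[(X, a), (Y, b)]"] by (simp add: o_defs)
  qed
  then have "Pair X ` carrier (lev free X) \<subseteq> C" by auto
  then have "countable (Pair X ` carrier (lev free X))" using C(1) countable_subset by blast
  then show ?thesis by (rule countable_image_inj_on) (simp add: inj_on_def)
qed

text \<open>Induction on the generation of \<open>a\<close>. The values at a glued element are
  compared after the two restrictions, which is enough by additivity of \<open>T\<close>.\<close>

lemma free_unique:
  assumes h: "levelwise_hom G free T h" and h': "levelwise_hom G free T h'" and T: "tambara G T"
    and diag: "\<And>X r. fin_gset G X \<Longrightarrow> r \<in> carrier (lev R X) \<Longrightarrow> h X (diag X r) = h' X (diag X r)"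
    and generator: "h U generator = h' U generator"
    and a: "gen X a"
  shows "h X a = h' X a"
  using a
proof induction
  case (gen_add X a b)
  then have X: "fin_gset G X" using gen_D by blast
  show ?case using levelwise_homD(4)[OF h X, of a b] levelwise_homD(4)[OF h' X, of a b] gen_add by simp
next
  case (gen_mult X a b)
  then have X: "fin_gset G X" using gen_D by blast
  show ?case using levelwise_homD(5)[OF h X, of a b] levelwise_homD(5)[OF h' X, of a b] gen_mult by simp
next
  case (gen_rst X Y f a)
  then show ?case using levelwise_homD(6)[OF h gen_rst(1), of a] levelwise_homD(6)[OF h' gen_rst(1), of a] by simp
next
  case (gen_trf X Y f a)
  then show ?case using levelwise_homD(7)[OF h gen_trf(1), of a] levelwise_homD(7)[OF h' gen_trf(1), of a] by simp
next
  case (gen_nrm X Y f a)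
  then show ?case using levelwise_homD(8)[OF h gen_nrm(1), of a] levelwise_homD(8)[OF h' gen_nrm(1), of a] by simp
next
  case (gen_glued X Y Z j k a b)
  note C = gen_glued(1) and D = gcoproductD[OF gen_glued(1)]
  let ?c = "glued X Y Z j k a b"
  have c: "?c \<in> carrier (lev free Z)" using gen.gen_glued[OF C gen_glued(2,3)] by simp
  have "(rst T X Z j (h Z ?c), rst T Y Z k (h Z ?c)) = (rst T X Z j (h' Z ?c), rst T Y Z k (h' Z ?c))"
    using levelwise_homD(6)[OF h D(1) c] levelwise_homD(6)[OF h' D(1) c]
      levelwise_homD(6)[OF h D(2) c] levelwise_homD(6)[OF h' D(2) c]
      glued_rst[OF C gen_glued(2,3)] gen_glued(4,5) by simp
  moreover have "inj_on (\<lambda>a. (rst T X Z j a, rst T Y Z k a)) (carrier (lev T Z))"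
    using mackey_functor.additive[OF tambara.axioms(1)[OF T] C] by (simp add: bij_betw_def)
  ultimately show ?case
    using levelwise_homD(1)[OF h gmap_tgt[OF D(1)] c] levelwise_homD(1)[OF h' gmap_tgt[OF D(1)] c]
    by (auto dest: inj_onD)
qed (use diag generator in auto)

lemma ex_free_algebra: "\<exists>(F :: ('a, 'u) tamb) \<eta> x. is_free_algebra G R [U] F \<eta> [x]"
proof -
  obtain F :: "('a, 'u) tamb" and e d where F: "tambara G F"
    and e: "levelwise_hom G free F e" and d: "levelwise_hom G F free d"
    and de: "\<And>X a. fin_gset G X \<Longrightarrow> a \<in> carrier (lev free X) \<Longrightarrow> d X (e X a) = a"
    and ed: "\<And>X a. fin_gset G X \<Longrightarrow> a \<in> carrier (lev F X) \<Longrightarrow> e X (d X a) = a"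
    using tambara_in_universe[OF free_tambara countable_free] by blast
  define \<eta> where "\<eta> X r = e X (diag X r)" for X r
  define x where "x = e U generator"
  have \<eta>: "tambara_hom G R F \<eta>"
    unfolding tambara_hom_iff \<eta>_def using levelwise_hom_comp[OF diag_hom_free e] F R.tambara_axioms by blast
  have xF: "x \<in> carrier (lev F U)"
    unfolding x_def using levelwise_homD(1)[OF e trans_fin[OF U]] gen_generator by simp
  have "is_free_algebra G R [U] F \<eta> [x]"
    unfolding is_free_algebra_def Let_def
  proof (intro conjI allI impI)
    show "\<forall>X\<in>set [U]. trans_gset G X" using U by simp
    show "tambara_hom G R F \<eta>" by (fact \<eta>)
    show "elements_at F [U] [x]" using xF by (simp add: elements_at_def)
  next
    fix T \<theta> ts assume \<theta>: "tambara_hom G R T \<theta>" and "elements_at T [U] ts"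
    then obtain t where t: "ts = [t]" "t \<in> carrier (lev T U)"
      by (auto simp: elements_at_def list_all2_Cons1)
    \<comment> \<open>The test algebra with its chosen element is itself an index, and the
      projection to this coordinate is the required map.\<close>
    define i where "i = Pointed T \<theta> t"
    have i: "i \<in> Idx" using \<theta> t by (simp add: Idx_def i_def)
    have Ti: "alg i = T" "str i = \<theta>" "elt i = t" by (simp_all add: i_def)
    let ?k = "\<lambda>X a. d X a i"
    have k: "tambara_hom G F T ?k"
      using levelwise_hom_comp[OF d projection_hom[OF i]] F Idx_D(1)[OF i] by (simp add: tambara_hom_iff Ti)
    have "agree G (lev R) (\<lambda>X a. ?k X (\<eta> X a)) \<theta>"
      using de gen_diag by (simp add: agree_def \<eta>_def product_apply i Ti)
    moreover have "?k U x = t"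
      using de[OF trans_fin[OF U]] gen_generator by (simp add: x_def product_apply i Ti)
    ultimately show "\<exists>k. algebra_hom G R F \<eta> T \<theta> k \<and> (\<forall>i<length [U]. k ([U] ! i) ([x] ! i) = ts ! i)"
      using \<eta> \<theta> k t(1) by (intro exI[of _ ?k]) (simp add: algebra_hom_def)
  next
    fix T \<theta> ts k k' assume \<theta>: "tambara_hom G R T \<theta>" and "elements_at T [U] ts"
      and k: "algebra_hom G R F \<eta> T \<theta> k \<and> (\<forall>i<length [U]. k ([U] ! i) ([x] ! i) = ts ! i)"
      and k': "algebra_hom G R F \<eta> T \<theta> k' \<and> (\<forall>i<length [U]. k' ([U] ! i) ([x] ! i) = ts ! i)"
    have T: "tambara G T" using \<theta> by (simp add: tambara_hom_iff)
    have kl: "levelwise_hom G F T k" "levelwise_hom G F T k'"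
      using k k' by (simp_all add: algebra_hom_def tambara_hom_iff)
    have "k X (e X b) = k' X (e X b)" if "gen X b" for X b
    proof (rule free_unique[OF levelwise_hom_comp[OF e kl(1)] levelwise_hom_comp[OF e kl(2)] T _ _ that])
      show "k X (e X (diag X r)) = k' X (e X (diag X r))"
        if "fin_gset G X" "r \<in> carrier (lev R X)" for X r
        using k k' that by (simp add: algebra_hom_def agree_def \<eta>_def)
      show "k U (e U generator) = k' U (e U generator)"
        using k k' by (simp add: x_def)
    qed
    then show "agree G (lev F) k k'"
      unfolding agree_def using ed levelwise_homD(1)[OF d] by (metis free_simps(1) mem_Collect_eq)
  qed
  then show ?thesis by blast
qed

end

section \<open>Quotients by idempotents are etale\<close>

lemma alg_module_simps [simp]:
  "carrier (mlev (alg_module S \<phi>) X) = carrier (lev S X)"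
  "zero (mlev (alg_module S \<phi>) X) = zero (lev S X)"
  "add (mlev (alg_module S \<phi>) X) = add (lev S X)"
  "smult (mlev (alg_module S \<phi>) X) = (\<lambda>r s. \<phi> X r \<otimes>\<^bsub>lev S X\<^esub> s)"
  "mrst (alg_module S \<phi>) = rst S" "mtrf (alg_module S \<phi>) = trf S"
  by (simp_all add: alg_module_def ring.defs module.defs)

lemma gmodule_homI:
  assumes "tambara_module G R M" "tambara_module G R N"
    and "\<And>X m. fin_gset G X \<Longrightarrow> m \<in> carrier (mlev M X) \<Longrightarrow> h X m \<in> carrier (mlev N X)"
    and "\<And>X m n. fin_gset G X \<Longrightarrow> m \<in> carrier (mlev M X) \<Longrightarrow> n \<in> carrier (mlev M X) \<Longrightarrow>
      h X (m \<oplus>\<^bsub>mlev M X\<^esub> n) = h X m \<oplus>\<^bsub>mlev N X\<^esub> h X n"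
    and "\<And>X r m. fin_gset G X \<Longrightarrow> r \<in> carrier (lev R X) \<Longrightarrow> m \<in> carrier (mlev M X) \<Longrightarrow>
      h X (r \<odot>\<^bsub>mlev M X\<^esub> m) = r \<odot>\<^bsub>mlev N X\<^esub> h X m"
    and "\<And>X Y f m. gmap G X Y f \<Longrightarrow> m \<in> carrier (mlev M Y) \<Longrightarrow> h X (mrst M X Y f m) = mrst N X Y f (h Y m)"
    and "\<And>X Y f m. gmap G X Y f \<Longrightarrow> m \<in> carrier (mlev M X) \<Longrightarrow> h Y (mtrf M X Y f m) = mtrf N X Y f (h X m)"
  shows "gmodule_hom G R M N h"
  using assms unfolding gmodule_hom_def hom_def by auto

lemma gmodule_homD:
  assumes "gmodule_hom G R M N h"
  shows "tambara_module G R M" "tambara_module G R N"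
    and "fin_gset G X \<Longrightarrow> m \<in> carrier (mlev M X) \<Longrightarrow> h X m \<in> carrier (mlev N X)"
    and "fin_gset G X \<Longrightarrow> m \<in> carrier (mlev M X) \<Longrightarrow> n \<in> carrier (mlev M X) \<Longrightarrow>
      h X (m \<oplus>\<^bsub>mlev M X\<^esub> n) = h X m \<oplus>\<^bsub>mlev N X\<^esub> h X n"
    and "fin_gset G X \<Longrightarrow> r \<in> carrier (lev R X) \<Longrightarrow> m \<in> carrier (mlev M X) \<Longrightarrow>
      h X (r \<odot>\<^bsub>mlev M X\<^esub> m) = r \<odot>\<^bsub>mlev N X\<^esub> h X m"
    and "gmap G X Y f \<Longrightarrow> m \<in> carrier (mlev M Y) \<Longrightarrow> h X (mrst M X Y f m) = mrst N X Y f (h Y m)"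
    and "gmap G X Y f \<Longrightarrow> m \<in> carrier (mlev M X) \<Longrightarrow> h Y (mtrf M X Y f m) = mtrf N X Y f (h X m)"
  using assms unfolding gmodule_hom_def hom_def by auto

lemma dress_pairingI:
  assumes "tambara_module G R M" "tambara_module G R N" "tambara_module G R Q"
    and "\<And>X m n. fin_gset G X \<Longrightarrow> m \<in> carrier (mlev M X) \<Longrightarrow> n \<in> carrier (mlev N X) \<Longrightarrow>
      \<beta> X m n \<in> carrier (mlev Q X)"
    and "\<And>X m n n'. fin_gset G X \<Longrightarrow> m \<in> carrier (mlev M X) \<Longrightarrow> n \<in> carrier (mlev N X) \<Longrightarrow>
      n' \<in> carrier (mlev N X) \<Longrightarrow> \<beta> X m (n \<oplus>\<^bsub>mlev N X\<^esub> n') = \<beta> X m n \<oplus>\<^bsub>mlev Q X\<^esub> \<beta> X m n'"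
    and "\<And>X m m' n. fin_gset G X \<Longrightarrow> m \<in> carrier (mlev M X) \<Longrightarrow> m' \<in> carrier (mlev M X) \<Longrightarrow>
      n \<in> carrier (mlev N X) \<Longrightarrow> \<beta> X (m \<oplus>\<^bsub>mlev M X\<^esub> m') n = \<beta> X m n \<oplus>\<^bsub>mlev Q X\<^esub> \<beta> X m' n"
    and "\<And>X r m n. fin_gset G X \<Longrightarrow> r \<in> carrier (lev R X) \<Longrightarrow> m \<in> carrier (mlev M X) \<Longrightarrow>
      n \<in> carrier (mlev N X) \<Longrightarrow> \<beta> X (r \<odot>\<^bsub>mlev M X\<^esub> m) n = r \<odot>\<^bsub>mlev Q X\<^esub> \<beta> X m n"
    and "\<And>X r m n. fin_gset G X \<Longrightarrow> r \<in> carrier (lev R X) \<Longrightarrow> m \<in> carrier (mlev M X) \<Longrightarrow>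
      n \<in> carrier (mlev N X) \<Longrightarrow> \<beta> X m (r \<odot>\<^bsub>mlev N X\<^esub> n) = r \<odot>\<^bsub>mlev Q X\<^esub> \<beta> X m n"
    and "\<And>X Y f m n. gmap G X Y f \<Longrightarrow> m \<in> carrier (mlev M Y) \<Longrightarrow> n \<in> carrier (mlev N Y) \<Longrightarrow>
      mrst Q X Y f (\<beta> Y m n) = \<beta> X (mrst M X Y f m) (mrst N X Y f n)"
    and "\<And>X Y f m n. gmap G X Y f \<Longrightarrow> m \<in> carrier (mlev M X) \<Longrightarrow> n \<in> carrier (mlev N Y) \<Longrightarrow>
      mtrf Q X Y f (\<beta> X m (mrst N X Y f n)) = \<beta> Y (mtrf M X Y f m) n"
    and "\<And>X Y f m n. gmap G X Y f \<Longrightarrow> m \<in> carrier (mlev M Y) \<Longrightarrow> n \<in> carrier (mlev N X) \<Longrightarrow>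
      mtrf Q X Y f (\<beta> X (mrst M X Y f m) n) = \<beta> Y m (mtrf N X Y f n)"
  shows "dress_pairing G R M N Q \<beta>"
  unfolding dress_pairing_def using assms by (auto intro!: homI)

lemma dress_pairingD:
  assumes "dress_pairing G R M N Q \<beta>"
  shows "tambara_module G R M" "tambara_module G R N" "tambara_module G R Q"
    and "fin_gset G X \<Longrightarrow> m \<in> carrier (mlev M X) \<Longrightarrow> n \<in> carrier (mlev N X) \<Longrightarrow>
      \<beta> X m n \<in> carrier (mlev Q X)"
    and "fin_gset G X \<Longrightarrow> m \<in> carrier (mlev M X) \<Longrightarrow> n \<in> carrier (mlev N X) \<Longrightarrow>
      n' \<in> carrier (mlev N X) \<Longrightarrow> \<beta> X m (n \<oplus>\<^bsub>mlev N X\<^esub> n') = \<beta> X m n \<oplus>\<^bsub>mlev Q X\<^esub> \<beta> X m n'"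
    and "fin_gset G X \<Longrightarrow> m \<in> carrier (mlev M X) \<Longrightarrow> m' \<in> carrier (mlev M X) \<Longrightarrow>
      n \<in> carrier (mlev N X) \<Longrightarrow> \<beta> X (m \<oplus>\<^bsub>mlev M X\<^esub> m') n = \<beta> X m n \<oplus>\<^bsub>mlev Q X\<^esub> \<beta> X m' n"
    and "fin_gset G X \<Longrightarrow> r \<in> carrier (lev R X) \<Longrightarrow> m \<in> carrier (mlev M X) \<Longrightarrow>
      n \<in> carrier (mlev N X) \<Longrightarrow> \<beta> X (r \<odot>\<^bsub>mlev M X\<^esub> m) n = r \<odot>\<^bsub>mlev Q X\<^esub> \<beta> X m n"
    and "fin_gset G X \<Longrightarrow> r \<in> carrier (lev R X) \<Longrightarrow> m \<in> carrier (mlev M X) \<Longrightarrow>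
      n \<in> carrier (mlev N X) \<Longrightarrow> \<beta> X m (r \<odot>\<^bsub>mlev N X\<^esub> n) = r \<odot>\<^bsub>mlev Q X\<^esub> \<beta> X m n"
    and "gmap G X Y f \<Longrightarrow> m \<in> carrier (mlev M Y) \<Longrightarrow> n \<in> carrier (mlev N Y) \<Longrightarrow>
      mrst Q X Y f (\<beta> Y m n) = \<beta> X (mrst M X Y f m) (mrst N X Y f n)"
    and "gmap G X Y f \<Longrightarrow> m \<in> carrier (mlev M X) \<Longrightarrow> n \<in> carrier (mlev N Y) \<Longrightarrow>
      mtrf Q X Y f (\<beta> X m (mrst N X Y f n)) = \<beta> Y (mtrf M X Y f m) n"
    and "gmap G X Y f \<Longrightarrow> m \<in> carrier (mlev M Y) \<Longrightarrow> n \<in> carrier (mlev N X) \<Longrightarrow>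
      mtrf Q X Y f (\<beta> X (mrst M X Y f m) n) = \<beta> Y m (mtrf N X Y f n)"
  using assms unfolding dress_pairing_def hom_def by (auto simp: Pi_iff)

lemma (in mackey_functor)
  shows rst_add: "gmap G X Y f \<Longrightarrow> a \<in> carrier (A Y) \<Longrightarrow> b \<in> carrier (A Y) \<Longrightarrow>
      rst X Y f (a \<oplus>\<^bsub>A Y\<^esub> b) = rst X Y f a \<oplus>\<^bsub>A X\<^esub> rst X Y f b"
    and trf_add: "gmap G X Y f \<Longrightarrow> a \<in> carrier (A X) \<Longrightarrow> b \<in> carrier (A X) \<Longrightarrow>
      trf X Y f (a \<oplus>\<^bsub>A X\<^esub> b) = trf X Y f a \<oplus>\<^bsub>A Y\<^esub> trf X Y f b"
    and rst_closed: "gmap G X Y f \<Longrightarrow> a \<in> carrier (A Y) \<Longrightarrow> rst X Y f a \<in> carrier (A X)"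
    and trf_closed: "gmap G X Y f \<Longrightarrow> a \<in> carrier (A X) \<Longrightarrow> trf X Y f a \<in> carrier (A Y)"
  using rst_hom[of X Y f] trf_hom[of X Y f] by (auto simp: hom_def Pi_iff)

text \<open>\<open>S\<close> is the quotient of \<open>R\<close> by the complement of the idempotents \<open>\<epsilon> X = \<sigma> X 1\<close>, and \<open>\<sigma>\<close> is the
  non-unital section with image \<open>\<epsilon> R\<close>. The norms of \<open>R\<close> need not preserve \<open>\<epsilon> R\<close>, so that
  \<open>R\<close> need not be a product of Tambara functors.\<close>

locale idempotent_quotient = R: tambara G R + S: tambara G S
  for G :: "'g monoid" and R S :: "('g, 'u) tamb" +
  fixes \<phi> :: "'g gset \<Rightarrow> 'u \<Rightarrow> 'u" and \<sigma> :: "'g gset \<Rightarrow> 'u \<Rightarrow> 'u"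
  assumes \<phi>: "levelwise_hom G R S \<phi>"
    and frobenius: "gmap G X Y f \<Longrightarrow> a \<in> carrier (lev S Y) \<Longrightarrow> b \<in> carrier (lev S X) \<Longrightarrow>
      trf S X Y f (rst S X Y f a \<otimes>\<^bsub>lev S X\<^esub> b) = a \<otimes>\<^bsub>lev S Y\<^esub> trf S X Y f b"
    and \<sigma>_closed: "fin_gset G X \<Longrightarrow> s \<in> carrier (lev S X) \<Longrightarrow> \<sigma> X s \<in> carrier (lev R X)"
    and \<phi>_\<sigma>: "fin_gset G X \<Longrightarrow> s \<in> carrier (lev S X) \<Longrightarrow> \<phi> X (\<sigma> X s) = s"
    and \<sigma>_\<phi>: "fin_gset G X \<Longrightarrow> r \<in> carrier (lev R X) \<Longrightarrow>
      \<sigma> X (\<phi> X r) = \<sigma> X \<one>\<^bsub>lev S X\<^esub> \<otimes>\<^bsub>lev R X\<^esub> r"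
    and rst_\<sigma>_one: "gmap G X Y f \<Longrightarrow> rst R X Y f (\<sigma> Y \<one>\<^bsub>lev S Y\<^esub>) = \<sigma> X \<one>\<^bsub>lev S X\<^esub>"
begin

definition \<epsilon> :: "'g gset \<Rightarrow> 'u" where "\<epsilon> X = \<sigma> X \<one>\<^bsub>lev S X\<^esub>"

lemmas \<phi>D = levelwise_homD[OF \<phi>]

lemma \<phi>_hom: "tambara_hom G R S \<phi>"
  using \<phi> R.tambara_axioms S.tambara_axioms by (simp add: tambara_hom_iff)

lemma cringR: "fin_gset G X \<Longrightarrow> cring (lev R X)" and cringS: "fin_gset G X \<Longrightarrow> cring (lev S X)"
  by (rule R.level_cring, assumption, rule S.level_cring, assumption)

lemma one_S: "fin_gset G X \<Longrightarrow> \<one>\<^bsub>lev S X\<^esub> \<in> carrier (lev S X)"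
  using cringS[of X] by (simp add: cring.cring_simprules)

lemma \<epsilon>_closed: "fin_gset G X \<Longrightarrow> \<epsilon> X \<in> carrier (lev R X)"
  by (simp add: \<epsilon>_def \<sigma>_closed one_S)

lemma \<sigma>_\<phi>': "fin_gset G X \<Longrightarrow> r \<in> carrier (lev R X) \<Longrightarrow> \<sigma> X (\<phi> X r) = \<epsilon> X \<otimes>\<^bsub>lev R X\<^esub> r"
  by (simp add: \<epsilon>_def \<sigma>_\<phi>)

lemma rst_\<epsilon>: "gmap G X Y f \<Longrightarrow> rst R X Y f (\<epsilon> Y) = \<epsilon> X"
  by (simp add: \<epsilon>_def rst_\<sigma>_one)

lemma \<phi>_\<epsilon>: "fin_gset G X \<Longrightarrow> \<phi> X (\<epsilon> X) = \<one>\<^bsub>lev S X\<^esub>"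
  by (simp add: \<epsilon>_def \<phi>_\<sigma> one_S)

lemma \<epsilon>_\<sigma>: "fin_gset G X \<Longrightarrow> s \<in> carrier (lev S X) \<Longrightarrow> \<epsilon> X \<otimes>\<^bsub>lev R X\<^esub> \<sigma> X s = \<sigma> X s"
  using \<sigma>_\<phi>'[of X "\<sigma> X s"] by (simp add: \<sigma>_closed \<phi>_\<sigma>)

text \<open>Both sides have the same image under \<phi>, and \<sigma> after \<phi> is multiplication
  by \<epsilon>, which does nothing to values of \<sigma>. Linearity and compatibility with
  restrictions are obtained by the same device.\<close>

lemma \<sigma>_add:
  assumes X: "fin_gset G X" and s: "s \<in> carrier (lev S X)" "t \<in> carrier (lev S X)"
  shows "\<sigma> X (s \<oplus>\<^bsub>lev S X\<^esub> t) = \<sigma> X s \<oplus>\<^bsub>lev R X\<^esub> \<sigma> X t"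
proof -
  interpret cring "lev R X" using cringR[OF X] .
  have "\<sigma> X (s \<oplus>\<^bsub>lev S X\<^esub> t) = \<sigma> X (\<phi> X (\<sigma> X s \<oplus>\<^bsub>lev R X\<^esub> \<sigma> X t))"
    using assms by (simp add: \<phi>D(4) \<sigma>_closed \<phi>_\<sigma>)
  also have "\<dots> = \<sigma> X s \<oplus>\<^bsub>lev R X\<^esub> \<sigma> X t"
    using assms by (simp add: \<sigma>_\<phi>' \<sigma>_closed \<epsilon>_closed r_distr \<epsilon>_\<sigma>)
  finally show ?thesis .
qed

lemma \<sigma>_smult:
  assumes X: "fin_gset G X" and s: "s \<in> carrier (lev S X)" "r \<in> carrier (lev R X)"
  shows "\<sigma> X (\<phi> X r \<otimes>\<^bsub>lev S X\<^esub> s) = r \<otimes>\<^bsub>lev R X\<^esub> \<sigma> X s"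
proof -
  interpret cring "lev R X" using cringR[OF X] .
  have "\<sigma> X (\<phi> X r \<otimes>\<^bsub>lev S X\<^esub> s) = \<sigma> X (\<phi> X (r \<otimes>\<^bsub>lev R X\<^esub> \<sigma> X s))"
    using assms by (simp add: \<phi>D(5) \<sigma>_closed \<phi>_\<sigma>)
  also have "\<dots> = r \<otimes>\<^bsub>lev R X\<^esub> \<sigma> X s"
    using assms by (simp add: \<sigma>_\<phi>' \<sigma>_closed \<epsilon>_closed m_lcomm \<epsilon>_\<sigma>)
  finally show ?thesis .
qed

lemma rst_\<sigma>:
  assumes f: "gmap G X Y f" and s: "s \<in> carrier (lev S Y)"
  shows "rst R X Y f (\<sigma> Y s) = \<sigma> X (rst S X Y f s)"
proof -
  note X = R.fin_src[OF f] and Y = R.fin_tgt[OF f]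
  have "\<sigma> X (rst S X Y f s) = \<sigma> X (\<phi> X (rst R X Y f (\<sigma> Y s)))"
    using s Y by (simp add: \<phi>D(6)[OF f] \<sigma>_closed \<phi>_\<sigma>)
  also have "\<dots> = rst R X Y f (\<epsilon> Y \<otimes>\<^bsub>lev R Y\<^esub> \<sigma> Y s)"
    using s X Y by (simp add: \<sigma>_\<phi>' \<sigma>_closed R.rst_closed[OF f] R.rst_mult[OF f] rst_\<epsilon>[OF f] \<epsilon>_closed)
  also have "\<dots> = rst R X Y f (\<sigma> Y s)" using s Y by (simp add: \<epsilon>_\<sigma>)
  finally show ?thesis by (rule sym)
qed

lemma frobenius':
  assumes f: "gmap G X Y f" and "a \<in> carrier (lev S X)" "b \<in> carrier (lev S Y)"
  shows "trf S X Y f (a \<otimes>\<^bsub>lev S X\<^esub> rst S X Y f b) = trf S X Y f a \<otimes>\<^bsub>lev S Y\<^esub> b"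
proof -
  interpret X: cring "lev S X" using cringS[OF R.fin_src[OF f]] .
  interpret Y: cring "lev S Y" using cringS[OF R.fin_tgt[OF f]] .
  show ?thesis
    using frobenius[OF f assms(3,2)] assms
    by (simp add: X.m_comm Y.m_comm S.rst_closed[OF f] S.trf_closed[OF f])
qed

section \<open>\<open>S\<close> as an \<open>R\<close>-module, base change to \<open>S\<close>, and
  flatness\<close>

lemma alg_tambara_module: "tambara_module G R (alg_module S \<phi>)"
proof (rule tambara_module.intro[OF R.tambara_axioms _ tambara_module_axioms.intro])
  have ab: "abelian_group (mlev (alg_module S \<phi>) X)" if X: "fin_gset G X" for X
  proof -
    interpret cring "lev S X" using cringS[OF X] .
    show ?thesis
    proof (rule abelian_groupI)
      show "\<exists>b\<in>carrier (mlev (alg_module S \<phi>) X). b \<oplus>\<^bsub>mlev (alg_module S \<phi>) X\<^esub> a = \<zero>\<^bsub>mlev (alg_module S \<phi>) X\<^esub>"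
        if "a \<in> carrier (mlev (alg_module S \<phi>) X)" for a
        using that l_neg by (intro bexI[of _ "\<ominus>\<^bsub>lev S X\<^esub> a"]) simp_all
    qed (simp_all add: a_ac)
  qed
  show "mackey_functor G (mlev (alg_module S \<phi>)) (mrst (alg_module S \<phi>)) (mtrf (alg_module S \<phi>))"
  proof (rule mackey_functor.intro)
    show "mrst (alg_module S \<phi>) X Y f \<in> hom (add_monoid (mlev (alg_module S \<phi>) Y)) (add_monoid (mlev (alg_module S \<phi>) X))"
      "mtrf (alg_module S \<phi>) X Y f \<in> hom (add_monoid (mlev (alg_module S \<phi>) X)) (add_monoid (mlev (alg_module S \<phi>) Y))"
      if "gmap G X Y f" for X Y f
      using S.rst_hom[OF that] S.trf_hom[OF that] by (simp_all add: hom_def)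
  qed (use ab S.rst_id S.trf_id S.rst_comp S.trf_comp S.additive S.rst_trf in simp_all)
  show "Module.module (lev R X) (mlev (alg_module S \<phi>) X)" if X: "fin_gset G X" for X
  proof -
    interpret cring "lev S X" using cringS[OF X] .
    show ?thesis
      by (rule moduleI[OF cringR[OF X] ab[OF X]])
        (simp_all add: \<phi>D X l_distr r_distr m_assoc)
  qed
  fix X Y f assume f: "gmap G X Y f"
  note X = R.fin_src[OF f] and Y = R.fin_tgt[OF f]
  show "mrst (alg_module S \<phi>) X Y f (r \<odot>\<^bsub>mlev (alg_module S \<phi>) Y\<^esub> m) =
      rst R X Y f r \<odot>\<^bsub>mlev (alg_module S \<phi>) X\<^esub> mrst (alg_module S \<phi>) X Y f m"
    if "r \<in> carrier (lev R Y)" "m \<in> carrier (mlev (alg_module S \<phi>) Y)" for r m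
    using that by (simp add: S.rst_mult[OF f] \<phi>D(6)[OF f] \<phi>D(1)[OF Y])
  show "mtrf (alg_module S \<phi>) X Y f (rst R X Y f r \<odot>\<^bsub>mlev (alg_module S \<phi>) X\<^esub> m) =
      r \<odot>\<^bsub>mlev (alg_module S \<phi>) Y\<^esub> mtrf (alg_module S \<phi>) X Y f m"
    if "r \<in> carrier (lev R Y)" "m \<in> carrier (mlev (alg_module S \<phi>) X)" for r m
    using that by (simp add: frobenius[OF f] \<phi>D(6)[OF f] \<phi>D(1)[OF Y])
  show "mtrf (alg_module S \<phi>) X Y f (r \<odot>\<^bsub>mlev (alg_module S \<phi>) X\<^esub> mrst (alg_module S \<phi>) X Y f m) =
      trf R X Y f r \<odot>\<^bsub>mlev (alg_module S \<phi>) Y\<^esub> m"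
    if "r \<in> carrier (lev R X)" "m \<in> carrier (mlev (alg_module S \<phi>) Y)" for r m
    using that by (simp add: frobenius'[OF f] \<phi>D(7)[OF f] \<phi>D(1)[OF X])
qed

text \<open>The summand of \<open>M\<close> on which the idempotent acts as the identity, with the
  operations of \<open>M\<close>. It realises the box product of \<open>S\<close> and
  \<open>M\<close>, as eR tensored with M is eM for an idempotent e of a ring.\<close>

definition cut :: "('g, 'u) gmodule \<Rightarrow> ('g, 'u) gmodule" where
  "cut M = M\<lparr>mlev := (\<lambda>X. (mlev M X)\<lparr>carrier := {m \<in> carrier (mlev M X). \<epsilon> X \<odot>\<^bsub>mlev M X\<^esub> m = m}\<rparr>)\<rparr>"

lemma cut_simps [simp]:
  "carrier (mlev (cut M) X) = {m \<in> carrier (mlev M X). \<epsilon> X \<odot>\<^bsub>mlev M X\<^esub> m = m}"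
  "zero (mlev (cut M) X) = zero (mlev M X)" "add (mlev (cut M) X) = add (mlev M X)"
  "smult (mlev (cut M) X) = smult (mlev M X)" "mrst (cut M) = mrst M" "mtrf (cut M) = mtrf M"
  by (simp_all add: cut_def)

text \<open>Restrictions preserve the summand because they send \<epsilon> to \<epsilon>. For a
  transfer, the Frobenius relation moves \<epsilon> from the target to the source.\<close>

lemma cut_rst_trf:
  assumes "tambara_module G R M" "gmap G X Y f"
  shows "m \<in> carrier (mlev (cut M) Y) \<Longrightarrow> mrst M X Y f m \<in> carrier (mlev (cut M) X)"
    and "m \<in> carrier (mlev (cut M) X) \<Longrightarrow> mtrf M X Y f m \<in> carrier (mlev (cut M) Y)"
proof -
  interpret M: tambara_module G R M by fact
  note X = R.fin_src[OF assms(2)] and Y = R.fin_tgt[OF assms(2)]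
  show "m \<in> carrier (mlev (cut M) Y) \<Longrightarrow> mrst M X Y f m \<in> carrier (mlev (cut M) X)"
    using M.mrst_smult[OF assms(2) \<epsilon>_closed[OF Y], of m] M.M.rst_closed[OF assms(2)]
    by (simp add: rst_\<epsilon>[OF assms(2)])
  show "m \<in> carrier (mlev (cut M) X) \<Longrightarrow> mtrf M X Y f m \<in> carrier (mlev (cut M) Y)"
    using M.frobenius_left[OF assms(2) \<epsilon>_closed[OF Y], of m] M.M.trf_closed[OF assms(2)]
    by (simp add: rst_\<epsilon>[OF assms(2)])
qed

lemma \<epsilon>_smult:
  assumes "tambara_module G R M" "fin_gset G X" "m \<in> carrier (mlev M X)" "s \<in> carrier (lev S X)"
  shows "\<sigma> X s \<odot>\<^bsub>mlev M X\<^esub> m \<in> carrier (mlev (cut M) X)"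
proof -
  interpret M: tambara_module G R M by fact
  interpret module "lev R X" "mlev M X" using M.level_module[OF assms(2)] .
  show ?thesis
    using assms by (simp add: smult_assoc1[symmetric] \<sigma>_closed \<epsilon>_closed \<epsilon>_\<sigma>)
qed

lemma cut_tambara_module:
  assumes "tambara_module G R M" shows "tambara_module G R (cut M)"
proof -
  interpret M: tambara_module G R M by fact
  have ab: "abelian_group (mlev (cut M) X)" if X: "fin_gset G X" for X
  proof -
    interpret module "lev R X" "mlev M X" using M.level_module[OF X] .
    show ?thesis
    proof (rule abelian_groupI)
      show "\<exists>b\<in>carrier (mlev (cut M) X). b \<oplus>\<^bsub>mlev (cut M) X\<^esub> a = \<zero>\<^bsub>mlev (cut M) X\<^esub>"
        if "a \<in> carrier (mlev (cut M) X)" for a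
        using that smult_r_minus[OF \<epsilon>_closed[OF X], of a]
        by (intro bexI[of _ "\<ominus>\<^bsub>mlev M X\<^esub> a"]) (simp_all add: M.l_neg)
    qed (simp_all add: smult_r_distr \<epsilon>_closed X M.a_ac)
  qed
  have md: "Module.module (lev R X) (mlev (cut M) X)" if X: "fin_gset G X" for X
  proof -
    interpret module "lev R X" "mlev M X" using M.level_module[OF X] .
    have "\<epsilon> X \<odot>\<^bsub>mlev M X\<^esub> (r \<odot>\<^bsub>mlev M X\<^esub> m) = r \<odot>\<^bsub>mlev M X\<^esub> m"
      if "r \<in> carrier (lev R X)" "m \<in> carrier (mlev M X)" "\<epsilon> X \<odot>\<^bsub>mlev M X\<^esub> m = m" for r m
      using that smult_assoc1[of "\<epsilon> X" r m] smult_assoc1[of r "\<epsilon> X" m] \<epsilon>_closed[OF X]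
      by (simp add: m_comm)
    then show ?thesis
      by (intro moduleI[OF cringR[OF X] ab[OF X]]) (simp_all add: smult_l_distr smult_r_distr smult_assoc1)
  qed
  have "mackey_functor G (mlev (cut M)) (mrst (cut M)) (mtrf (cut M))"
  proof (rule mackey_functor.intro)
    show "mrst (cut M) X Y f \<in> hom (add_monoid (mlev (cut M) Y)) (add_monoid (mlev (cut M) X))"
      "mtrf (cut M) X Y f \<in> hom (add_monoid (mlev (cut M) X)) (add_monoid (mlev (cut M) Y))"
      if f: "gmap G X Y f" for X Y f
      using cut_rst_trf[OF assms f] M.M.rst_add[OF f] M.M.trf_add[OF f] by (auto intro!: homI)
  next
    fix X Y Z i j assume C: "gcoproduct G X Y Z i j"
    note D = gcoproductD[OF C] and cl = cut_rst_trf(1)[OF assms]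
    note X = R.fin_src[OF D(1)] and Y = R.fin_src[OF D(2)] and Z = R.fin_tgt[OF D(1)]
    let ?h = "\<lambda>a. (mrst M X Z i a, mrst M Y Z j a)"
    have bij: "bij_betw ?h (carrier (mlev M Z)) (carrier (mlev M X) \<times> carrier (mlev M Y))"
      using M.M.additive[OF C] .
    have "?h ` carrier (mlev (cut M) Z) = carrier (mlev (cut M) X) \<times> carrier (mlev (cut M) Y)"
    proof (intro equalityI subsetI)
      fix p assume p: "p \<in> carrier (mlev (cut M) X) \<times> carrier (mlev (cut M) Y)"
      then have "p \<in> ?h ` carrier (mlev M Z)" using bij by (auto simp: bij_betw_def)
      then obtain c where c: "c \<in> carrier (mlev M Z)" "p = ?h c" by blast
      interpret module "lev R Z" "mlev M Z" using M.level_module[OF Z] .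
      \<comment> \<open>The glued element \<open>c\<close> and its \<epsilon>-multiple have the same
        restrictions, so they agree and \<open>c\<close> lies in the summand.\<close>
      have "?h (\<epsilon> Z \<odot>\<^bsub>mlev M Z\<^esub> c) = ?h c"
        using p c M.mrst_smult[OF D(1) \<epsilon>_closed[OF Z] c(1)] M.mrst_smult[OF D(2) \<epsilon>_closed[OF Z] c(1)]
        by (simp add: rst_\<epsilon>[OF D(1)] rst_\<epsilon>[OF D(2)])
      then have "\<epsilon> Z \<odot>\<^bsub>mlev M Z\<^esub> c = c"
        using bij c(1) \<epsilon>_closed[OF Z] by (auto simp: bij_betw_def dest: inj_onD)
      then show "p \<in> ?h ` carrier (mlev (cut M) Z)" using c by auto
    qed (use cl[OF D(1)] cl[OF D(2)] in auto)
    moreover have "inj_on ?h (carrier (mlev (cut M) Z))"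
      using bij by (auto simp: bij_betw_def inj_on_def)
    ultimately show "bij_betw (\<lambda>a. (mrst (cut M) X Z i a, mrst (cut M) Y Z j a)) (carrier (mlev (cut M) Z))
        (carrier (mlev (cut M) X) \<times> carrier (mlev (cut M) Y))"
      by (simp add: bij_betw_def)
  qed (use ab M.M.rst_id M.M.trf_id M.M.rst_comp M.M.trf_comp M.M.rst_trf in simp_all)
  then show ?thesis
    by (rule tambara_module.intro[OF R.tambara_axioms _ tambara_module_axioms.intro])
      (use md M.mrst_smult M.frobenius_left M.frobenius_right in simp_all)
qed

lemma cut_pairing:
  assumes "tambara_module G R M"
  shows "dress_pairing G R (alg_module S \<phi>) M (cut M) (\<lambda>X s m. \<sigma> X s \<odot>\<^bsub>mlev M X\<^esub> m)"
proof (rule dress_pairingI[OF alg_tambara_module assms cut_tambara_module[OF assms]])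
  interpret M: tambara_module G R M by fact
  fix X assume X: "fin_gset G X"
  interpret module "lev R X" "mlev M X" using M.level_module[OF X] .
  fix m s assume m: "m \<in> carrier (mlev M X)" and s: "s \<in> carrier (mlev (alg_module S \<phi>) X)"
  then show "\<sigma> X s \<odot>\<^bsub>mlev M X\<^esub> m \<in> carrier (mlev (cut M) X)" using \<epsilon>_smult[OF assms X] by simp
  show "\<sigma> X s \<odot>\<^bsub>mlev M X\<^esub> (m \<oplus>\<^bsub>mlev M X\<^esub> m') = \<sigma> X s \<odot>\<^bsub>mlev M X\<^esub> m \<oplus>\<^bsub>mlev (cut M) X\<^esub> \<sigma> X s \<odot>\<^bsub>mlev M X\<^esub> m'"
    if "m' \<in> carrier (mlev M X)" for m'
    using that m s X by (simp add: smult_r_distr \<sigma>_closed)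
  show "\<sigma> X (s \<oplus>\<^bsub>mlev (alg_module S \<phi>) X\<^esub> s') \<odot>\<^bsub>mlev M X\<^esub> m
      = \<sigma> X s \<odot>\<^bsub>mlev M X\<^esub> m \<oplus>\<^bsub>mlev (cut M) X\<^esub> \<sigma> X s' \<odot>\<^bsub>mlev M X\<^esub> m"
    if "s' \<in> carrier (mlev (alg_module S \<phi>) X)" for s'
    using that m s X by (simp add: smult_l_distr \<sigma>_closed \<sigma>_add)
  show "\<sigma> X (r \<odot>\<^bsub>mlev (alg_module S \<phi>) X\<^esub> s) \<odot>\<^bsub>mlev M X\<^esub> m = r \<odot>\<^bsub>mlev (cut M) X\<^esub> (\<sigma> X s \<odot>\<^bsub>mlev M X\<^esub> m)"
    if "r \<in> carrier (lev R X)" for r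
    using that m s X by (simp add: \<sigma>_smult smult_assoc1 \<sigma>_closed)
  show "\<sigma> X s \<odot>\<^bsub>mlev M X\<^esub> (r \<odot>\<^bsub>mlev M X\<^esub> m) = r \<odot>\<^bsub>mlev (cut M) X\<^esub> (\<sigma> X s \<odot>\<^bsub>mlev M X\<^esub> m)"
    if "r \<in> carrier (lev R X)" for r
    using that m s X smult_assoc1[of "\<sigma> X s" r m] smult_assoc1[of r "\<sigma> X s" m]
    by (simp add: \<sigma>_closed m_comm)
next
  interpret M: tambara_module G R M by fact
  fix X Y f assume f: "gmap G X Y f"
  note X = R.fin_src[OF f] and Y = R.fin_tgt[OF f]
  show "mrst (cut M) X Y f (\<sigma> Y s \<odot>\<^bsub>mlev M Y\<^esub> m) =
      \<sigma> X (mrst (alg_module S \<phi>) X Y f s) \<odot>\<^bsub>mlev M X\<^esub> mrst M X Y f m"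
    if "s \<in> carrier (mlev (alg_module S \<phi>) Y)" "m \<in> carrier (mlev M Y)" for s m
    using that Y by (simp add: M.mrst_smult[OF f] \<sigma>_closed rst_\<sigma>[OF f])
  show "mtrf (cut M) X Y f (\<sigma> X (mrst (alg_module S \<phi>) X Y f s) \<odot>\<^bsub>mlev M X\<^esub> m) =
      \<sigma> Y s \<odot>\<^bsub>mlev M Y\<^esub> mtrf M X Y f m"
    if "s \<in> carrier (mlev (alg_module S \<phi>) Y)" "m \<in> carrier (mlev M X)" for s m
    using that Y by (simp add: M.frobenius_left[OF f] \<sigma>_closed rst_\<sigma>[OF f, symmetric])
  show "mtrf (cut M) X Y f (\<sigma> X s \<odot>\<^bsub>mlev M X\<^esub> mrst M X Y f m) =
      \<sigma> Y (mtrf (alg_module S \<phi>) X Y f s) \<odot>\<^bsub>mlev M Y\<^esub> m"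
    if s: "s \<in> carrier (mlev (alg_module S \<phi>) X)" and m: "m \<in> carrier (mlev M Y)" for s m
  proof -
    interpret Y: module "lev R Y" "mlev M Y" using M.level_module[OF Y] .
    have s': "\<sigma> X s \<in> carrier (lev R X)" using s \<sigma>_closed[OF X] by simp
    have t: "trf R X Y f (\<sigma> X s) \<in> carrier (lev R Y)" using R.trf_closed[OF f s'] .
    let ?t = "mtrf M X Y f (\<sigma> X s \<odot>\<^bsub>mlev M X\<^esub> mrst M X Y f m)"
    \<comment> \<open>There is no rule for \<sigma> and transfers in \<open>R\<close>, so the
      comparison is made in \<open>M\<close>. The transferred element lies in the summand, so it may
      be multiplied by \<epsilon>, and this replaces the transfer in \<open>R\<close> of the lift of
      \<open>s\<close> by the lift of the transfer of \<open>s\<close> in \<open>S\<close>.\<close>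
    have "?t \<in> carrier (mlev (cut M) Y)"
      using cut_rst_trf(2)[OF assms f \<epsilon>_smult[OF assms X M.M.rst_closed[OF f m]]] s by simp
    then have \<epsilon>t: "\<epsilon> Y \<odot>\<^bsub>mlev M Y\<^esub> ?t = ?t" by simp
    have t_eq: "?t = trf R X Y f (\<sigma> X s) \<odot>\<^bsub>mlev M Y\<^esub> m" by (rule M.frobenius_right[OF f s' m])
    also have "\<dots> = \<epsilon> Y \<odot>\<^bsub>mlev M Y\<^esub> (trf R X Y f (\<sigma> X s) \<odot>\<^bsub>mlev M Y\<^esub> m)"
      using \<epsilon>t unfolding t_eq by (rule sym)
    also have "\<epsilon> Y \<odot>\<^bsub>mlev M Y\<^esub> (trf R X Y f (\<sigma> X s) \<odot>\<^bsub>mlev M Y\<^esub> m) =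
        \<sigma> Y (\<phi> Y (trf R X Y f (\<sigma> X s))) \<odot>\<^bsub>mlev M Y\<^esub> m"
      using t m by (simp add: Y.smult_assoc1 \<sigma>_\<phi>'[OF Y] \<epsilon>_closed[OF Y])
    also have "\<phi> Y (trf R X Y f (\<sigma> X s)) = trf S X Y f s"
      using s by (simp add: \<phi>D(7)[OF f s'] \<phi>_\<sigma>[OF X])
    finally show ?thesis by simp
  qed
qed

text \<open>Every \<open>s\<close> is the scalar \<sigma> \<open>s\<close> acting on 1. Hence a
  bilinear pairing \<gamma> satisfies \<gamma>(s, m) = \<gamma>(1, \<sigma>(s) m) and is determined
  by m \<mapsto> \<gamma>(1, m), which is the factorization. It is unique since each element of the
  summand is its own \<epsilon>-multiple, hence a value of the pairing at 1.\<close>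

lemma cut_box_product:
  assumes M: "tambara_module G R M"
  shows "is_box_product G R (alg_module S \<phi>) M (cut M) (\<lambda>X s m. \<sigma> X s \<odot>\<^bsub>mlev M X\<^esub> m)"
  unfolding is_box_product_def Let_def
proof (intro conjI allI impI)
  show "dress_pairing G R (alg_module S \<phi>) M (cut M) (\<lambda>X s m. \<sigma> X s \<odot>\<^bsub>mlev M X\<^esub> m)"
    by (rule cut_pairing[OF M])
next
  interpret M: tambara_module G R M by fact
  fix Q \<gamma> assume \<gamma>: "dress_pairing G R (alg_module S \<phi>) M Q \<gamma>"
  note \<gamma>D = dress_pairingD[OF \<gamma>]
  have one: "\<one>\<^bsub>lev S X\<^esub> \<in> carrier (mlev (alg_module S \<phi>) X)" if "fin_gset G X" for X
    using one_S[OF that] by simp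
  let ?h = "\<lambda>X m. \<gamma> X \<one>\<^bsub>lev S X\<^esub> m"
  have "gmodule_hom G R (cut M) Q ?h"
  proof (rule gmodule_homI[OF cut_tambara_module[OF M] \<gamma>D(3)])
    fix X Y f m assume f: "gmap G X Y f"
    note X = R.fin_src[OF f] and Y = R.fin_tgt[OF f]
    show "\<gamma> X \<one>\<^bsub>lev S X\<^esub> (mrst (cut M) X Y f m) = mrst Q X Y f (\<gamma> Y \<one>\<^bsub>lev S Y\<^esub> m)"
      if "m \<in> carrier (mlev (cut M) Y)"
      using \<gamma>D(9)[OF f one[OF Y], of m] that by (simp add: S.rst_one[OF f])
    show "\<gamma> Y \<one>\<^bsub>lev S Y\<^esub> (mtrf (cut M) X Y f m) = mtrf Q X Y f (\<gamma> X \<one>\<^bsub>lev S X\<^esub> m)"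
      if "m \<in> carrier (mlev (cut M) X)"
      using \<gamma>D(11)[OF f one[OF Y], of m] that by (simp add: S.rst_one[OF f])
  qed (use \<gamma>D(4)[OF _ one] \<gamma>D(5)[OF _ one] \<gamma>D(8)[OF _ _ one] in simp_all)
  moreover have "\<gamma> X \<one>\<^bsub>lev S X\<^esub> (\<sigma> X s \<odot>\<^bsub>mlev M X\<^esub> m) = \<gamma> X s m"
    if X: "fin_gset G X" and s: "s \<in> carrier (lev S X)" and m: "m \<in> carrier (mlev M X)" for X s m
  proof -
    interpret cring "lev S X" using cringS[OF X] .
    show ?thesis
      using \<gamma>D(8)[OF X \<sigma>_closed[OF X s] one[OF X] m] \<gamma>D(7)[OF X \<sigma>_closed[OF X s] one[OF X] m] s
      by (simp add: \<phi>_\<sigma>[OF X s])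
  qed
  ultimately show "\<exists>h. gmodule_hom G R (cut M) Q h \<and> (\<forall>X. fin_gset G X \<longrightarrow>
      (\<forall>s\<in>carrier (mlev (alg_module S \<phi>) X). \<forall>m\<in>carrier (mlev M X). h X (\<sigma> X s \<odot>\<^bsub>mlev M X\<^esub> m) = \<gamma> X s m))"
    by (intro exI[of _ ?h]) simp
next
  fix Q \<gamma> h h'
  assume h: "gmodule_hom G R (cut M) Q h \<and> (\<forall>X. fin_gset G X \<longrightarrow>
      (\<forall>s\<in>carrier (mlev (alg_module S \<phi>) X). \<forall>m\<in>carrier (mlev M X). h X (\<sigma> X s \<odot>\<^bsub>mlev M X\<^esub> m) = \<gamma> X s m))"
    and h': "gmodule_hom G R (cut M) Q h' \<and> (\<forall>X. fin_gset G X \<longrightarrow>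
      (\<forall>s\<in>carrier (mlev (alg_module S \<phi>) X). \<forall>m\<in>carrier (mlev M X). h' X (\<sigma> X s \<odot>\<^bsub>mlev M X\<^esub> m) = \<gamma> X s m))"
  have "h X m = h' X m" if X: "fin_gset G X" and m: "m \<in> carrier (mlev M X)" "\<epsilon> X \<odot>\<^bsub>mlev M X\<^esub> m = m" for X m
  proof -
    have "h X (\<epsilon> X \<odot>\<^bsub>mlev M X\<^esub> m) = h' X (\<epsilon> X \<odot>\<^bsub>mlev M X\<^esub> m)"
      using h h' X m(1) one_S[OF X] unfolding \<epsilon>_def by simp
    then show ?thesis using m(2) by simp
  qed
  then show "agree G (mlev (cut M)) h h'" by (simp add: agree_def)
qed

lemma cut_hom:
  assumes "gmodule_hom G R M N h" shows "gmodule_hom G R (cut M) (cut N) h"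
  by (rule gmodule_homI)
    (use gmodule_homD[OF assms] gmodule_homD(5)[OF assms _ \<epsilon>_closed, symmetric] in
      \<open>simp_all add: cut_tambara_module\<close>)

text \<open>Passing to the summand is exact: if m = \<epsilon> m and m = h l, then also m = h
  (\<epsilon> l), so a preimage can be found in the summand. The induced maps are restrictions of
  the given ones.\<close>

lemma flat: "flat_algebra G R S \<phi>"
  unfolding flat_algebra_def
proof (intro conjI allI impI)
  show "tambara_hom G R S \<phi>" by (rule \<phi>_hom)
  fix L M N h k assume ex: "gmodule_exact G R L M N h k"
  then have h: "gmodule_hom G R L M h" and k: "gmodule_hom G R M N k"
    and im: "\<And>X. fin_gset G X \<Longrightarrow> h X ` carrier (mlev L X) = {m \<in> carrier (mlev M X). k X m = \<zero>\<^bsub>mlev N X\<^esub>}"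
    by (simp_all add: gmodule_exact_def)
  note hD = gmodule_homD[OF h] and kD = gmodule_homD[OF k]
  have "h X ` carrier (mlev (cut L) X) = {m \<in> carrier (mlev (cut M) X). k X m = \<zero>\<^bsub>mlev (cut N) X\<^esub>}"
    if X: "fin_gset G X" for X
  proof (intro equalityI subsetI)
    fix m assume "m \<in> h X ` carrier (mlev (cut L) X)"
    then show "m \<in> {m \<in> carrier (mlev (cut M) X). k X m = \<zero>\<^bsub>mlev (cut N) X\<^esub>}"
      using im[OF X] gmodule_homD(3)[OF cut_hom[OF h] X] by auto
  next
    fix m assume m: "m \<in> {m \<in> carrier (mlev (cut M) X). k X m = \<zero>\<^bsub>mlev (cut N) X\<^esub>}"
    then have "m \<in> h X ` carrier (mlev L X)" using im[OF X] by simp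
    then obtain l where l: "l \<in> carrier (mlev L X)" "m = h X l" by blast
    have "m = h X (\<epsilon> X \<odot>\<^bsub>mlev L X\<^esub> l)" using m l hD(5)[OF X \<epsilon>_closed[OF X] l(1)] by simp
    moreover have "\<epsilon> X \<odot>\<^bsub>mlev L X\<^esub> l \<in> carrier (mlev (cut L) X)"
      using \<epsilon>_smult[OF hD(1) X l(1) one_S[OF X]] by (simp add: \<epsilon>_def)
    ultimately show "m \<in> h X ` carrier (mlev (cut L) X)" by blast
  qed
  then have exact: "gmodule_exact G R (cut L) (cut M) (cut N) h k"
    using cut_hom[OF h] cut_hom[OF k] by (simp add: gmodule_exact_def)
  have ind: "induced_box_map G R (alg_module S \<phi>) M f (cut M) (\<lambda>X s m. \<sigma> X s \<odot>\<^bsub>mlev M X\<^esub> m)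
      (cut N) (\<lambda>X s m. \<sigma> X s \<odot>\<^bsub>mlev N X\<^esub> m) f" if "gmodule_hom G R M N f" for M N f
    using cut_hom[OF that] gmodule_homD(5)[OF that] by (simp add: induced_box_map_def \<sigma>_closed)
  show "\<exists>P\<^sub>1 \<beta>\<^sub>1 P\<^sub>2 \<beta>\<^sub>2 P\<^sub>3 \<beta>\<^sub>3 h\<^sub>1 h\<^sub>2.
      is_box_product G R (alg_module S \<phi>) L P\<^sub>1 \<beta>\<^sub>1 \<and> is_box_product G R (alg_module S \<phi>) M P\<^sub>2 \<beta>\<^sub>2 \<and>
      is_box_product G R (alg_module S \<phi>) N P\<^sub>3 \<beta>\<^sub>3 \<and>
      induced_box_map G R (alg_module S \<phi>) L h P\<^sub>1 \<beta>\<^sub>1 P\<^sub>2 \<beta>\<^sub>2 h\<^sub>1 \<and>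
      induced_box_map G R (alg_module S \<phi>) M k P\<^sub>2 \<beta>\<^sub>2 P\<^sub>3 \<beta>\<^sub>3 h\<^sub>2 \<and>
      gmodule_exact G R P\<^sub>1 P\<^sub>2 P\<^sub>3 h\<^sub>1 h\<^sub>2"
    using cut_box_product[OF hD(1)] cut_box_product[OF hD(2)] cut_box_product[OF kD(2)] ind[OF h] ind[OF k]
      exact by blast
qed

section \<open>The box square of \<open>S\<close> and its Kaehler differentials\<close>

lemma self_box: "is_self_box G R S \<phi> S (\<lambda>X a. a) (\<lambda>X a. a)"
  unfolding is_self_box_def
proof (intro conjI)
  show "tambara_hom G R S \<phi>" by (rule \<phi>_hom)
  show "tambara_hom G S S (\<lambda>X a. a)" "tambara_hom G S S (\<lambda>X a. a)"
    using S.tambara_axioms by (simp_all add: tambara_hom_iff levelwise_hom_id)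
  show "agree G (lev R) (\<lambda>X a. \<phi> X a) (\<lambda>X a. \<phi> X a)" by (simp add: agree_def)
  let ?S = "alg_module S \<phi>"
  have eta: "alg_module S (\<lambda>X a. \<phi> X a) = ?S" by simp
  have pair: "dress_pairing G R ?S ?S ?S (\<lambda>X s t. s \<otimes>\<^bsub>lev S X\<^esub> t)"
  proof (rule dress_pairingI[OF alg_tambara_module alg_tambara_module alg_tambara_module])
    fix X assume X: "fin_gset G X"
    interpret cring "lev S X" using cringS[OF X] .
    fix m n assume mn: "m \<in> carrier (mlev ?S X)" "n \<in> carrier (mlev ?S X)"
    then show "m \<otimes>\<^bsub>lev S X\<^esub> n \<in> carrier (mlev ?S X)" by simp
    show "m \<otimes>\<^bsub>lev S X\<^esub> (n \<oplus>\<^bsub>mlev ?S X\<^esub> n') = m \<otimes>\<^bsub>lev S X\<^esub> n \<oplus>\<^bsub>mlev ?S X\<^esub> m \<otimes>\<^bsub>lev S X\<^esub> n'"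
      if "n' \<in> carrier (mlev ?S X)" for n' using mn that by (simp add: r_distr)
    show "(m \<oplus>\<^bsub>mlev ?S X\<^esub> m') \<otimes>\<^bsub>lev S X\<^esub> n = m \<otimes>\<^bsub>lev S X\<^esub> n \<oplus>\<^bsub>mlev ?S X\<^esub> m' \<otimes>\<^bsub>lev S X\<^esub> n"
      if "m' \<in> carrier (mlev ?S X)" for m' using mn that by (simp add: l_distr)
    show "(r \<odot>\<^bsub>mlev ?S X\<^esub> m) \<otimes>\<^bsub>lev S X\<^esub> n = r \<odot>\<^bsub>mlev ?S X\<^esub> (m \<otimes>\<^bsub>lev S X\<^esub> n)"
      if "r \<in> carrier (lev R X)" for r using mn that by (simp add: m_assoc \<phi>D(1)[OF X])
    show "m \<otimes>\<^bsub>lev S X\<^esub> (r \<odot>\<^bsub>mlev ?S X\<^esub> n) = r \<odot>\<^bsub>mlev ?S X\<^esub> (m \<otimes>\<^bsub>lev S X\<^esub> n)"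
      if "r \<in> carrier (lev R X)" for r using mn that by (simp add: m_lcomm \<phi>D(1)[OF X])
  qed (use S.rst_mult frobenius frobenius' in simp_all)
  have "is_box_product G R ?S ?S ?S (\<lambda>X s t. s \<otimes>\<^bsub>lev S X\<^esub> t)"
    unfolding is_box_product_def Let_def
  proof (intro conjI allI impI)
    fix Q \<gamma> assume \<gamma>: "dress_pairing G R ?S ?S Q \<gamma>"
    note \<gamma>D = dress_pairingD[OF \<gamma>]
    have one: "\<one>\<^bsub>lev S X\<^esub> \<in> carrier (mlev ?S X)" if "fin_gset G X" for X using one_S[OF that] by simp
    have "gmodule_hom G R ?S Q (\<lambda>X s. \<gamma> X s \<one>\<^bsub>lev S X\<^esub>)"
    proof (rule gmodule_homI[OF alg_tambara_module \<gamma>D(3)])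
      fix X Y f m assume f: "gmap G X Y f"
      note Y = R.fin_tgt[OF f]
      show "\<gamma> X (mrst ?S X Y f m) \<one>\<^bsub>lev S X\<^esub> = mrst Q X Y f (\<gamma> Y m \<one>\<^bsub>lev S Y\<^esub>)"
        if "m \<in> carrier (mlev ?S Y)"
        using \<gamma>D(9)[OF f that one[OF Y]] by (simp add: S.rst_one[OF f])
      show "\<gamma> Y (mtrf ?S X Y f m) \<one>\<^bsub>lev S Y\<^esub> = mtrf Q X Y f (\<gamma> X m \<one>\<^bsub>lev S X\<^esub>)"
        if "m \<in> carrier (mlev ?S X)"
        using \<gamma>D(10)[OF f that one[OF Y]] by (simp add: S.rst_one[OF f])
    qed (use \<gamma>D(4)[OF _ _ one] \<gamma>D(6)[OF _ _ _ one] \<gamma>D(7)[OF _ _ _ one] in simp_all)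
    moreover have "\<gamma> X (s \<otimes>\<^bsub>lev S X\<^esub> t) \<one>\<^bsub>lev S X\<^esub> = \<gamma> X s t"
      if X: "fin_gset G X" and st: "s \<in> carrier (lev S X)" "t \<in> carrier (lev S X)" for X s t
    proof -
      interpret cring "lev S X" using cringS[OF X] .
      \<comment> \<open>The second argument is the image of a scalar from \<open>R\<close>, its
        lift, and so can be moved across the pairing. Thus \<gamma> depends only on the product of
        its arguments.\<close>
      have "\<gamma> X (t \<otimes>\<^bsub>lev S X\<^esub> s) \<one>\<^bsub>lev S X\<^esub> = \<gamma> X s (t \<otimes>\<^bsub>lev S X\<^esub> \<one>\<^bsub>lev S X\<^esub>)"
        using \<gamma>D(7)[OF X \<sigma>_closed[OF X st(2)], of s "\<one>\<^bsub>lev S X\<^esub>"]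
          \<gamma>D(8)[OF X \<sigma>_closed[OF X st(2)], of s "\<one>\<^bsub>lev S X\<^esub>"] st
        by (simp add: \<phi>_\<sigma>[OF X])
      then show ?thesis using st by (simp add: m_comm)
    qed
    ultimately show "\<exists>h. gmodule_hom G R ?S Q h \<and> (\<forall>X. fin_gset G X \<longrightarrow>
        (\<forall>s\<in>carrier (mlev ?S X). \<forall>t\<in>carrier (mlev ?S X). h X (s \<otimes>\<^bsub>lev S X\<^esub> t) = \<gamma> X s t))"
      by (intro exI[of _ "\<lambda>X s. \<gamma> X s \<one>\<^bsub>lev S X\<^esub>"]) simp
  next
    fix Q \<gamma> h h'
    assume h: "gmodule_hom G R ?S Q h \<and> (\<forall>X. fin_gset G X \<longrightarrow>
        (\<forall>s\<in>carrier (mlev ?S X). \<forall>t\<in>carrier (mlev ?S X). h X (s \<otimes>\<^bsub>lev S X\<^esub> t) = \<gamma> X s t))"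
      and h': "gmodule_hom G R ?S Q h' \<and> (\<forall>X. fin_gset G X \<longrightarrow>
        (\<forall>s\<in>carrier (mlev ?S X). \<forall>t\<in>carrier (mlev ?S X). h' X (s \<otimes>\<^bsub>lev S X\<^esub> t) = \<gamma> X s t))"
    have "h X s = h' X s" if X: "fin_gset G X" and s: "s \<in> carrier (lev S X)" for X s
    proof -
      interpret cring "lev S X" using cringS[OF X] .
      have "h X (s \<otimes>\<^bsub>lev S X\<^esub> \<one>\<^bsub>lev S X\<^esub>) = h' X (s \<otimes>\<^bsub>lev S X\<^esub> \<one>\<^bsub>lev S X\<^esub>)"
        using h h' X s one_closed unfolding alg_module_simps by metis
      then show ?thesis using s by simp
    qed
    then show "agree G (mlev ?S) h h'" by (simp add: agree_def)
  qed (rule pair)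
  then show "is_box_product G R (alg_module S \<phi>) (alg_module S \<phi>) (alg_module S (\<lambda>X a. \<phi> X a))
      (\<lambda>X s t. s \<otimes>\<^bsub>lev S X\<^esub> t)" by simp
qed

text \<open>With the box square identified with \<open>S\<close>, multiplication is the identity and
  its kernel is zero, so the quotient has a single coset.\<close>

lemma kaehler_zero: "kaehler_vanishes G R S \<phi>"
proof -
  let ?I = "tambara_kernel G S S (\<lambda>X a. a)"
  let ?N = "norm_power G S ?I"
  have I: "?I X = {\<zero>\<^bsub>lev S X\<^esub>}" if X: "fin_gset G X" for X
  proof -
    interpret cring "lev S X" using cringS[OF X] .
    show ?thesis using X by (auto simp: tambara_kernel_def)
  qed
  have "?N \<le> unit_tideal G S"
    unfolding norm_power_def
  proof (rule tideal_gen_least[OF unit_tideal_ideal[OF S.tambara_axioms]])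
    show "(\<lambda>Y. {nrm S X Y h a | X h a.
        gmap G X Y h \<and> (\<forall>y\<in>pts Y. 2 \<le> card {x \<in> pts X. h x = y}) \<and> a \<in> ?I X}) \<le> unit_tideal G S"
      using S.nrm_closed by (auto simp: le_fun_def unit_tideal_def tambara_kernel_def gmap_def)
  qed
  then have N: "?N X \<subseteq> carrier (lev S X)" if "fin_gset G X" for X
    using that by (auto simp: le_fun_def unit_tideal_def split: if_splits)
  have "kaehler G S ?I X = {?N X}" if X: "fin_gset G X" for X
  proof -
    interpret cring "lev S X" using cringS[OF X] .
    show ?thesis unfolding kaehler_def I[OF X] using a_coset_add_zero[OF N[OF X]] by simp
  qed
  moreover have "multiplication_map G S S (\<lambda>X a. a) (\<lambda>X a. a) (\<lambda>X a. a)"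
    using S.tambara_axioms by (simp add: multiplication_map_def tambara_hom_iff levelwise_hom_id)
  ultimately show ?thesis unfolding kaehler_vanishes_def Let_def using self_box by blast
qed

end

section \<open>Finite presentation\<close>

lemma free_algebra_single:
  assumes "is_free_algebra G R [U] F \<eta> [x]"
  shows "tambara_hom G R F \<eta>" "x \<in> carrier (lev F U)"
    and "tambara_hom G R T \<theta> \<Longrightarrow> t \<in> carrier (lev T U) \<Longrightarrow> \<exists>k. algebra_hom G R F \<eta> T \<theta> k \<and> k U x = t"
    and "algebra_hom G R F \<eta> T \<theta> k \<Longrightarrow> algebra_hom G R F \<eta> T \<theta> k' \<Longrightarrow> k U x = k' U x \<Longrightarrow>
      k U x \<in> carrier (lev T U) \<Longrightarrow> agree G (lev F) k k'"
proof -
  show "tambara_hom G R F \<eta>" "x \<in> carrier (lev F U)"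
    using assms by (auto simp: is_free_algebra_def elements_at_def)
  have univ: "(\<exists>k. algebra_hom G R F \<eta> T \<theta> k \<and> k U x = t) \<and>
      (\<forall>k k'. algebra_hom G R F \<eta> T \<theta> k \<and> k U x = t \<longrightarrow> algebra_hom G R F \<eta> T \<theta> k' \<and> k' U x = t \<longrightarrow>
        agree G (lev F) k k')"
    if "tambara_hom G R T \<theta>" "t \<in> carrier (lev T U)" for T \<theta> t
  proof -
    have "elements_at T [U] [t]" using that(2) by (simp add: elements_at_def)
    with assms that(1) show ?thesis
      unfolding is_free_algebra_def Let_def by (auto dest!: spec[of _ T] spec[of _ \<theta>] spec[of _ "[t]"])
  qed
  show "tambara_hom G R T \<theta> \<Longrightarrow> t \<in> carrier (lev T U) \<Longrightarrow> \<exists>k. algebra_hom G R F \<eta> T \<theta> k \<and> k U x = t"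
    using univ by blast
  show "agree G (lev F) k k'" if "algebra_hom G R F \<eta> T \<theta> k" "algebra_hom G R F \<eta> T \<theta> k'" "k U x = k' U x"
      "k U x \<in> carrier (lev T U)"
  proof -
    have "tambara_hom G R T \<theta>" using that(1) by (simp add: algebra_hom_def)
    from univ[OF this that(4)] that show ?thesis by metis
  qed
qed

text \<open>This lets \<open>R\<close> itself be the target of the two maps whose coequalizer
  presents \<open>S\<close>.\<close>

lemma free_algebra_empty:
  assumes "tambara G R" shows "is_free_algebra G R [] R (\<lambda>X a. a) []"
proof -
  have id: "tambara_hom G R R (\<lambda>X a. a)" using assms by (simp add: tambara_hom_iff levelwise_hom_id)
  have "algebra_hom G R R (\<lambda>X a. a) T \<theta> \<theta>" if "tambara_hom G R T \<theta>" for T \<theta>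
    using that id by (simp add: algebra_hom_def agree_def)
  moreover have "agree G (lev R) k k'"
    if "algebra_hom G R R (\<lambda>X a. a) T \<theta> k" "algebra_hom G R R (\<lambda>X a. a) T \<theta> k'" for T \<theta> k k'
    using that by (simp add: algebra_hom_def agree_def)
  ultimately show ?thesis using id by (auto simp: is_free_algebra_def Let_def elements_at_def)
qed

text \<open>\<open>S\<close> is presented by the one relation 1 - \<epsilon> = 0 at the level
  \<open>U\<close>: the generator is sent to 1 - \<epsilon> by one map and to 0 by the other. A map
  that equalizes the two sends \<epsilon> to 1 at \<open>U\<close>, hence at every level
  \<open>X\<close>, by restriction along a map from \<open>X\<close> to \<open>U\<close>. This is
  why each \<open>X\<close> must map to \<open>U\<close>.\<close>

lemma (in idempotent_quotient) finitely_presented: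
  assumes free: "is_free_algebra G R [U] A \<eta> [x]" and U: "\<And>X. fin_gset G X \<Longrightarrow> \<exists>f. gmap G X U f"
    and finU: "fin_gset G U"
  shows "finitely_presented G R S \<phi>"
proof -
  let ?id = "\<lambda>(X :: 'g gset) (a :: 'u). a"
  have id: "tambara_hom G R R ?id" using R.tambara_axioms by (simp add: tambara_hom_iff levelwise_hom_id)
  note F = free_algebra_single[OF free]
  interpret RU: cring "lev R U" using cringR[OF finU] .
  interpret SU: cring "lev S U" using cringS[OF finU] .
  define e where "e = \<one>\<^bsub>lev R U\<^esub> \<ominus>\<^bsub>lev R U\<^esub> \<epsilon> U"
  have eU: "e \<in> carrier (lev R U)" "e \<oplus>\<^bsub>lev R U\<^esub> \<epsilon> U = \<one>\<^bsub>lev R U\<^esub>"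
    using \<epsilon>_closed[OF finU] by (simp_all add: e_def RU.minus_eq RU.a_assoc RU.l_neg)
  have \<phi>e: "\<phi> U e = \<zero>\<^bsub>lev S U\<^esub>"
  proof -
    have "\<phi> U e \<oplus>\<^bsub>lev S U\<^esub> \<one>\<^bsub>lev S U\<^esub> = \<one>\<^bsub>lev S U\<^esub>"
      using \<phi>D(4)[OF finU eU(1) \<epsilon>_closed[OF finU]] eU(2) \<phi>D(3)[OF finU] \<phi>_\<epsilon>[OF finU] by simp
    then show ?thesis using \<phi>D(1)[OF finU eU(1)] by (metis SU.add.r_cancel_one SU.one_closed)
  qed
  obtain u where u: "algebra_hom G R A \<eta> R ?id u" "u U x = e" using F(3)[OF id eU(1)] by blast
  obtain v where v: "algebra_hom G R A \<eta> R ?id v" "v U x = \<zero>\<^bsub>lev R U\<^esub>"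
    using F(3)[OF id RU.zero_closed] by blast
  have comp: "algebra_hom G R A \<eta> S \<phi> (\<lambda>X a. \<phi> X (w X a))" if w: "algebra_hom G R A \<eta> R ?id w" for w
  proof -
    have "levelwise_hom G A S (\<lambda>X a. \<phi> X (w X a))"
      using w by (intro levelwise_hom_comp[OF _ \<phi>]) (simp add: algebra_hom_def tambara_hom_iff)
    then show ?thesis using w \<phi>_hom by (simp add: algebra_hom_def tambara_hom_iff agree_def)
  qed
  have "is_algebra_coequalizer G R A \<eta> R ?id u v S \<phi> \<phi>"
    unfolding is_algebra_coequalizer_def Let_def
  proof (intro conjI allI impI)
    show "algebra_hom G R R ?id S \<phi> \<phi>" using id \<phi>_hom by (simp add: algebra_hom_def agree_def)
    show "agree G (lev A) (\<lambda>X a. \<phi> X (u X a)) (\<lambda>X a. \<phi> X (v X a))"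
      using F(4)[OF comp[OF u(1)] comp[OF v(1)]] u(2) v(2) \<phi>e \<phi>D(2)[OF finU] by simp
  next
    fix T \<theta> d
    assume d: "algebra_hom G R R ?id T \<theta> d"
      and eq: "agree G (lev A) (\<lambda>X a. d X (u X a)) (\<lambda>X a. d X (v X a))"
    have dl: "levelwise_hom G R T d" and T: "tambara G T" and \<theta>: "tambara_hom G R T \<theta>"
      using d by (simp_all add: algebra_hom_def tambara_hom_iff)
    have d\<theta>: "d X r = \<theta> X r" if "fin_gset G X" "r \<in> carrier (lev R X)" for X r
      using d that by (simp add: algebra_hom_def agree_def)
    note dD = levelwise_homD[OF dl]
    have cT: "cring (lev T X)" if "fin_gset G X" for X using tambara.level_cring[OF T that] .
    interpret TU: cring "lev T U" using cT[OF finU] .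
    have "d U e = \<zero>\<^bsub>lev T U\<^esub>"
      using eq F(2) finU u(2) v(2) dD(2)[OF finU] by (auto simp: agree_def)
    then have "d U (\<epsilon> U) = \<one>\<^bsub>lev T U\<^esub>"
      using dD(4)[OF finU eU(1) \<epsilon>_closed[OF finU]] eU(2) dD(3)[OF finU] dD(1)[OF finU \<epsilon>_closed[OF finU]]
      by simp
    then have d\<epsilon>: "d X (\<epsilon> X) = \<one>\<^bsub>lev T X\<^esub>" if X: "fin_gset G X" for X
    proof -
      obtain f where f: "gmap G X U f" using U[OF X] by blast
      show ?thesis
        using dD(6)[OF f \<epsilon>_closed[OF finU]] \<open>d U (\<epsilon> U) = _\<close> tambara.rst_one[OF T f] by (simp add: rst_\<epsilon>[OF f])
    qed
    let ?k = "\<lambda>X s. d X (\<sigma> X s)"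
    \<comment> \<open>This identity carries the argument, as \<sigma> need not commute with norms. A
      norm in \<open>S\<close> is the \<phi>-image of the norm of a lift, and on \<phi>-images the
      candidate is just \<open>d\<close>, which commutes with norms; transfers are treated
      alike.\<close>
    have k\<phi>: "?k X (\<phi> X r) = d X r" if X: "fin_gset G X" and r: "r \<in> carrier (lev R X)" for X r
    proof -
      interpret cring "lev T X" using cT[OF X] .
      show ?thesis using dD(5)[OF X \<epsilon>_closed[OF X] r] dD(1)[OF X r] by (simp add: \<sigma>_\<phi>'[OF X r] d\<epsilon>[OF X])
    qed
    have "levelwise_hom G S T ?k"
    proof (rule levelwise_homI)
      fix X assume X: "fin_gset G X"
      interpret RX: cring "lev R X" using cringR[OF X] .
      show "?k X s \<in> carrier (lev T X)" if "s \<in> carrier (lev S X)" for s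
        using dD(1)[OF X \<sigma>_closed[OF X that]] .
      show "?k X \<zero>\<^bsub>lev S X\<^esub> = \<zero>\<^bsub>lev T X\<^esub>" using k\<phi>[OF X RX.zero_closed] by (simp add: \<phi>D(2)[OF X] dD(2)[OF X])
      show "?k X \<one>\<^bsub>lev S X\<^esub> = \<one>\<^bsub>lev T X\<^esub>" using d\<epsilon>[OF X] by (simp add: \<epsilon>_def)
      show "?k X (s \<oplus>\<^bsub>lev S X\<^esub> t) = ?k X s \<oplus>\<^bsub>lev T X\<^esub> ?k X t"
        if "s \<in> carrier (lev S X)" "t \<in> carrier (lev S X)" for s t
        using that by (simp add: \<sigma>_add[OF X] dD(4)[OF X] \<sigma>_closed[OF X])
      show "?k X (s \<otimes>\<^bsub>lev S X\<^esub> t) = ?k X s \<otimes>\<^bsub>lev T X\<^esub> ?k X t"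
        if "s \<in> carrier (lev S X)" "t \<in> carrier (lev S X)" for s t
        using that \<sigma>_smult[OF X that(2) \<sigma>_closed[OF X that(1)]]
        by (simp add: \<phi>_\<sigma>[OF X] dD(5)[OF X] \<sigma>_closed[OF X])
    next
      fix X Y f assume f: "gmap G X Y f"
      note X = R.fin_src[OF f] and Y = R.fin_tgt[OF f]
      show "?k X (rst S X Y f s) = rst T X Y f (?k Y s)" if "s \<in> carrier (lev S Y)" for s
        using that by (simp add: rst_\<sigma>[OF f, symmetric] dD(6)[OF f] \<sigma>_closed[OF Y])
      show "?k Y (trf S X Y f s) = trf T X Y f (?k X s)" if s: "s \<in> carrier (lev S X)" for s
        using k\<phi>[OF Y R.trf_closed[OF f \<sigma>_closed[OF X s]]]
        by (simp add: \<phi>D(7)[OF f] dD(7)[OF f] \<sigma>_closed[OF X s] \<phi>_\<sigma>[OF X s])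
      show "?k Y (nrm S X Y f s) = nrm T X Y f (?k X s)" if s: "s \<in> carrier (lev S X)" for s
        using k\<phi>[OF Y R.nrm_closed[OF f \<sigma>_closed[OF X s]]]
        by (simp add: \<phi>D(8)[OF f] dD(8)[OF f] \<sigma>_closed[OF X s] \<phi>_\<sigma>[OF X s])
    qed
    then have "algebra_hom G R S \<phi> T \<theta> ?k"
      using \<phi>_hom \<theta> T S.tambara_axioms k\<phi> d\<theta> by (simp add: algebra_hom_def tambara_hom_iff agree_def)
    then show "\<exists>k. algebra_hom G R S \<phi> T \<theta> k \<and> agree G (lev R) (\<lambda>X b. k X (\<phi> X b)) d"
      using k\<phi> by (intro exI[of _ ?k]) (simp add: agree_def)
  next
    fix T \<theta> d k k'
    assume "algebra_hom G R S \<phi> T \<theta> k \<and> agree G (lev R) (\<lambda>X b. k X (\<phi> X b)) d"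
      and "algebra_hom G R S \<phi> T \<theta> k' \<and> agree G (lev R) (\<lambda>X b. k' X (\<phi> X b)) d"
    then show "agree G (lev S) k k'"
      unfolding agree_def using \<sigma>_closed \<phi>_\<sigma> by metis
  qed (rule u(1), rule v(1))
  then show ?thesis
    unfolding finitely_presented_def using free free_algebra_empty[OF R.tambara_axioms] by blast
qed

lemma (in idempotent_quotient) etale:
  assumes "is_free_algebra G R [U] A \<eta> [x]" "\<And>X. fin_gset G X \<Longrightarrow> \<exists>f. gmap G X U f" "fin_gset G U"
  shows "etale G R S \<phi>"
  unfolding etale_def using \<phi>_hom finitely_presented[OF assms] flat kaehler_zero by blast

section \<open>Closed points of the Nakaoka spectrum\<close>

lemma tambara_ideal_mem:
  assumes "tambara_ideal G R I"
  shows "a \<in> I X \<longleftrightarrow> fin_gset G X \<and> a \<in> carrier (lev R X) \<and>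
    (\<forall>Q i. trans_gset G Q \<longrightarrow> gmap G Q X i \<longrightarrow> rst R Q X i a \<in> I Q)"
  by (subst tambara_ideal_eq[OF assms]) simp

lemma topspace_nakaoka_spec:
  assumes "tambara G R" shows "topspace (nakaoka_spec G R) = Spec G R"
proof -
  have "vanishing G R (unit_tideal G R) = {}"
    using tambara_ideal_le_unit[of G R] unfolding vanishing_def Spec_def tambara_prime_def
    by (metis (mono_tags, lifting) antisym empty_Collect_eq mem_Collect_eq)
  then have "openin (nakaoka_spec G R) (Spec G R)"
    unfolding openin_nakaoka_spec[OF assms] using unit_tideal_ideal[OF assms] by blast
  moreover have "topspace (nakaoka_spec G R) \<subseteq> Spec G R"
    using openin_topspace[of "nakaoka_spec G R"] unfolding openin_nakaoka_spec[OF assms] by fast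
  ultimately show ?thesis using openin_subset by (metis antisym)
qed

context finite_group
begin

text \<open>Restriction from the point brings 1 into the ideal at every orbit. Hence a proper
  Tambara ideal does not contain 1 at the point.\<close>

lemma prime_top:
  assumes "tambara_ideal G R P" "tambara G R" "\<one>\<^bsub>lev R pt\<^esub> \<in> P pt"
  shows "P = unit_tideal G R"
proof (rule antisym[OF tambara_ideal_le_unit[OF assms(1)]], intro le_funI subsetI)
  interpret tambara G R by fact
  fix X a assume "a \<in> unit_tideal G R X"
  then have X: "fin_gset G X" and a: "a \<in> carrier (lev R X)" by (auto simp: unit_tideal_def split: if_splits)
  have "rst R Q X i a \<in> P Q" if Q: "trans_gset G Q" and i: "gmap G Q X i" for Q i
  proof -
    interpret I: ideal "P Q" "lev R Q" using tambara_ideal_level[OF assms(1) Q] .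
    note t = gmap_to_pt[OF trans_fin[OF Q]]
    have "rst R Q pt (to_pt Q) \<one>\<^bsub>lev R pt\<^esub> \<in> P Q"
      using tambara_ideal_closed[OF assms(1) Q trans_pt t] assms(3) by blast
    then have "\<one>\<^bsub>lev R Q\<^esub> \<in> P Q" using rst_one[OF t] by simp
    then show ?thesis using I.one_imp_carrier rst_closed[OF i a] by simp
  qed
  then show "a \<in> P X" using X a by (subst tambara_ideal_mem[OF assms(1)]) blast
qed

text \<open>Elements of ideals at arbitrary levels are brought to the point in this way, where
  elements of two ideals can be multiplied.\<close>

lemma norm_restriction_mem:
  assumes "tambara_ideal G R I" "a \<in> I X" "trans_gset G Q" "gmap G Q X i"
  shows "nrm R Q pt (to_pt Q) (rst R Q X i a) \<in> I pt"
proof -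
  have "rst R Q X i a \<in> I Q"
    using iffD1[OF tambara_ideal_mem[OF assms(1)] assms(2)] assms(3,4) by blast
  then show ?thesis
    using tambara_ideal_closed[OF assms(1,3) trans_pt gmap_to_pt[OF trans_fin[OF assms(3)]]] by blast
qed

lemma tideal_prod_mem:
  assumes R: "tambara G R" and "tambara_ideal G R I" "tambara_ideal G R J" "a \<in> I pt" "b \<in> J pt"
    and "tideal_prod G R I J \<le> P"
  shows "a \<otimes>\<^bsub>lev R pt\<^esub> b \<in> P pt"
proof -
  have "a \<otimes>\<^bsub>lev R pt\<^esub> b \<in> ideal_prod (lev R pt) (I pt) (J pt)"
    using assms ideal_prod.prod by metis
  then have "a \<otimes>\<^bsub>lev R pt\<^esub> b \<in> tideal_prod G R I J pt"
    using le_funD[OF tideal_gen_superset[of "\<lambda>X. if trans_gset G X then ideal_prod (lev R X) (I X) (J X) else {}" G R],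
      of pt] trans_pt unfolding tideal_prod_def by auto
  then show ?thesis using le_funD[OF assms(6), of pt] by blast
qed

text \<open>The predicate \<open>D\<close> stands for nonvanishing at a chosen coordinate. Each
  nonzero ideal has an element with \<open>D\<close> at the point, and two such elements have a
  nonzero product, even if the level at the point has zero divisors.\<close>

lemma zero_prime:
  assumes R: "tambara G R"
    and zero: "\<And>X Y f. trans_gset G X \<Longrightarrow> trans_gset G Y \<Longrightarrow> gmap G X Y f \<Longrightarrow>
      nrm R X Y f \<zero>\<^bsub>lev R X\<^esub> = \<zero>\<^bsub>lev R Y\<^esub>"
    and test: "\<And>X a. fin_gset G X \<Longrightarrow> a \<in> carrier (lev R X) \<Longrightarrow> a \<noteq> \<zero>\<^bsub>lev R X\<^esub> \<Longrightarrow>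
      \<exists>Q i. trans_gset G Q \<and> gmap G Q X i \<and> D (nrm R Q pt (to_pt Q) (rst R Q X i a))"
    and D: "\<And>a b. D a \<Longrightarrow> D b \<Longrightarrow> a \<otimes>\<^bsub>lev R pt\<^esub> b \<noteq> \<zero>\<^bsub>lev R pt\<^esub>"
    and nontriv: "\<one>\<^bsub>lev R pt\<^esub> \<noteq> \<zero>\<^bsub>lev R pt\<^esub>"
  shows "(\<lambda>X. if fin_gset G X then {\<zero>\<^bsub>lev R X\<^esub>} else {}) \<in> Spec G R" (is "?O \<in> _")
proof -
  interpret tambara G R by fact
  have ring: "ring (lev R X)" if "fin_gset G X" for X using level_cring[OF that] cring.axioms(1) by blast
  have zc: "\<zero>\<^bsub>lev R X\<^esub> \<in> carrier (lev R X)" if "fin_gset G X" for X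
    using ring[OF that] by (simp add: ring.ring_simprules)
  have D0: "\<not> D \<zero>\<^bsub>lev R pt\<^esub>"
  proof -
    interpret cring "lev R pt" using level_cring[OF fin_pt] .
    show ?thesis using D[of "\<zero>\<^bsub>lev R pt\<^esub>" "\<zero>\<^bsub>lev R pt\<^esub>"] by auto
  qed
  have trf0: "trf R X Y f \<zero>\<^bsub>lev R X\<^esub> = \<zero>\<^bsub>lev R Y\<^esub>" if f: "gmap G X Y f" for X Y f
  proof -
    interpret X: cring "lev R X" using level_cring[OF fin_src[OF f]] .
    interpret Y: cring "lev R Y" using level_cring[OF fin_tgt[OF f]] .
    show ?thesis using trf_add[OF f X.zero_closed X.zero_closed] trf_closed[OF f X.zero_closed]
      by (metis X.l_zero X.zero_closed Y.add.r_cancel_one')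
  qed
  \<comment> \<open>The last clause of \<open>tambara_ideal\<close> requires that an element be zero
    once all its restrictions to orbits are. The test assumption gives this, since the norm of zero
    is zero and zero fails \<open>D\<close>.\<close>
  have sep: "a = \<zero>\<^bsub>lev R X\<^esub>" if Xa: "fin_gset G X" "a \<in> carrier (lev R X)"
    and z: "\<And>Q i. trans_gset G Q \<Longrightarrow> gmap G Q X i \<Longrightarrow> rst R Q X i a = \<zero>\<^bsub>lev R Q\<^esub>" for X a
  proof (rule ccontr)
    assume "a \<noteq> \<zero>\<^bsub>lev R X\<^esub>"
    then obtain Q i where Q: "trans_gset G Q" "gmap G Q X i" "D (nrm R Q pt (to_pt Q) (rst R Q X i a))"
      using test[OF Xa] by blast
    then show False
      using z[OF Q(1,2)] zero[OF Q(1) trans_pt gmap_to_pt[OF trans_fin[OF Q(1)]]] D0 by simp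
  qed
  have ideal: "tambara_ideal G R ?O"
    unfolding tambara_ideal_def
  proof (intro conjI allI impI)
    fix X assume "trans_gset G X"
    then show "ideal (?O X) (lev R X)" using ring.zeroideal[OF ring] trans_fin by simp
  next
    fix X Y f assume h: "trans_gset G X" "trans_gset G Y" "gmap G X Y f"
    show "rst R X Y f ` ?O Y \<subseteq> ?O X" "trf R X Y f ` ?O X \<subseteq> ?O Y" "nrm R X Y f ` ?O X \<subseteq> ?O Y"
      using h trans_fin rst_zero[OF h(3)] trf0[OF h(3)] zero[OF h] by simp_all
  next
    fix X
    show "?O X = (if fin_gset G X then {a \<in> carrier (lev R X).
        \<forall>Q i. trans_gset G Q \<longrightarrow> gmap G Q X i \<longrightarrow> rst R Q X i a \<in> ?O Q} else {})"
      using sep[of X] zc[of X] rst_zero trans_fin by (auto split: if_splits)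
  qed
  have "?O \<noteq> unit_tideal G R"
  proof
    assume "?O = unit_tideal G R"
    from fun_cong[OF this, of pt] show False
      using nontriv ring[OF fin_pt] ring.ring_simprules(6)[OF ring[OF fin_pt]]
      by (auto simp: unit_tideal_def)
  qed
  moreover have "I \<le> ?O \<or> J \<le> ?O"
    if I: "tambara_ideal G R I" and J: "tambara_ideal G R J" and IJ: "tideal_prod G R I J \<le> ?O" for I J
  proof -
    have ex: "\<exists>b\<in>I pt. D b" if I: "tambara_ideal G R I" and n: "\<not> I \<le> ?O" for I
    proof -
      obtain X a where a: "a \<in> I X" "a \<notin> ?O X" using n by (auto simp: le_fun_def)
      then have "fin_gset G X" "a \<in> carrier (lev R X)"
        using iffD1[OF tambara_ideal_mem[OF I]] by blast+
      then obtain Q i where "trans_gset G Q" "gmap G Q X i" "D (nrm R Q pt (to_pt Q) (rst R Q X i a))"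
        using test[of X a] a by auto
      then show ?thesis using norm_restriction_mem[OF I a(1)] by blast
    qed
    show ?thesis
    proof (rule ccontr)
      assume "\<not> (I \<le> ?O \<or> J \<le> ?O)"
      then obtain b c where b: "b \<in> I pt" "D b" and c: "c \<in> J pt" "D c" using ex I J by blast
      have "b \<otimes>\<^bsub>lev R pt\<^esub> c \<in> ?O pt" by (rule tideal_prod_mem[OF R I J b(1) c(1) IJ])
      then show False using D[OF b(2) c(2)] by simp
    qed
  qed
  ultimately show ?thesis using ideal by (simp add: Spec_def tambara_prime_def)
qed

text \<open>The assumption \<open>unit\<close> makes \<open>S\<close> behave like a field: an ideal
  with a nonzero element contains 1 at the point. Likewise, an ideal of \<open>R\<close> not inside
  \<open>K\<close> has at the point an element with \<phi>-value 1, and this makes \<open>K\<close>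
  both prime and maximal.\<close>

lemma field_point:
  assumes R: "tambara G R" and S: "tambara G S" and \<phi>: "levelwise_hom G R S \<phi>"
    and zero: "\<And>X Y f. trans_gset G X \<Longrightarrow> trans_gset G Y \<Longrightarrow> gmap G X Y f \<Longrightarrow>
      nrm S X Y f \<zero>\<^bsub>lev S X\<^esub> = \<zero>\<^bsub>lev S Y\<^esub>"
    and unit: "\<And>X a. fin_gset G X \<Longrightarrow> a \<in> carrier (lev S X) \<Longrightarrow> a \<noteq> \<zero>\<^bsub>lev S X\<^esub> \<Longrightarrow>
      \<exists>Q i. trans_gset G Q \<and> gmap G Q X i \<and> nrm S Q pt (to_pt Q) (rst S Q X i a) = \<one>\<^bsub>lev S pt\<^esub>"
    and nontriv: "\<one>\<^bsub>lev S pt\<^esub> \<noteq> \<zero>\<^bsub>lev S pt\<^esub>"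
  defines "K \<equiv> spec_map G R \<phi> (\<lambda>X. if fin_gset G X then {\<zero>\<^bsub>lev S X\<^esub>} else {})"
  shows "Spec G S = {\<lambda>X. if fin_gset G X then {\<zero>\<^bsub>lev S X\<^esub>} else {}}" (is "_ = {?O}")
    and "tambara_ideal G R K" "K \<in> Spec G R" "vanishing G R K = {K}"
proof -
  interpret R: tambara G R by fact
  interpret S: tambara G S by fact
  interpret Rp: cring "lev R pt" using R.level_cring[OF fin_pt] .
  interpret Sp: cring "lev S pt" using S.level_cring[OF fin_pt] .
  note \<phi>D = levelwise_homD[OF \<phi>]
  have O: "?O \<in> Spec G S"
  proof (rule zero_prime[OF S zero unit])
    show "a \<otimes>\<^bsub>lev S pt\<^esub> b \<noteq> \<zero>\<^bsub>lev S pt\<^esub>" if "a = \<one>\<^bsub>lev S pt\<^esub>" "b = \<one>\<^bsub>lev S pt\<^esub>" for a b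
      using that nontriv by simp
  qed (use nontriv in simp_all)
  then have OI: "tambara_ideal G S ?O" by (simp add: Spec_def tambara_prime_def)
  have "P = ?O" if P: "P \<in> Spec G S" for P
  proof (rule antisym)
    have I: "tambara_ideal G S P" and ne: "P \<noteq> unit_tideal G S"
      using P by (simp_all add: Spec_def tambara_prime_def)
    show "P \<le> ?O"
    proof (rule ccontr)
      assume "\<not> P \<le> ?O"
      then obtain X a where a: "a \<in> P X" "a \<notin> ?O X" by (auto simp: le_fun_def)
      then have "fin_gset G X" "a \<in> carrier (lev S X)" using iffD1[OF tambara_ideal_mem[OF I]] by blast+
      then obtain Q i where Q: "trans_gset G Q" "gmap G Q X i"
        "nrm S Q pt (to_pt Q) (rst S Q X i a) = \<one>\<^bsub>lev S pt\<^esub>"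
        using unit[of X a] a by auto
      then have "\<one>\<^bsub>lev S pt\<^esub> \<in> P pt" using norm_restriction_mem[OF I a(1) Q(1,2)] by simp
      then show False using prime_top[OF I S] ne by blast
    qed
    show "?O \<le> P"
    proof (intro le_funI subsetI)
      fix X a assume "a \<in> ?O X"
      then have X: "fin_gset G X" and a: "a = \<zero>\<^bsub>lev S X\<^esub>" by (auto split: if_splits)
      interpret cring "lev S X" using S.level_cring[OF X] .
      have "\<zero>\<^bsub>lev S Q\<^esub> \<in> P Q" if Q: "trans_gset G Q" for Q
      proof -
        interpret ideal "P Q" "lev S Q" using tambara_ideal_level[OF I Q] .
        show ?thesis by simp
      qed
      then show "a \<in> P X" using X a S.rst_zero by (subst tambara_ideal_mem[OF I]) simp
    qed
  qed
  then show SpecS: "Spec G S = {?O}" using O by blast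
  have K_mem: "a \<in> K X \<longleftrightarrow> fin_gset G X \<and> a \<in> carrier (lev R X) \<and> \<phi> X a = \<zero>\<^bsub>lev S X\<^esub>" for a X
    by (simp add: K_def spec_map_def)
  show K: "tambara_ideal G R K"
    unfolding tambara_ideal_def
  proof (intro conjI allI impI)
    fix X assume X: "trans_gset G X"
    interpret RX: cring "lev R X" using R.level_cring[OF trans_fin[OF X]] .
    interpret SX: cring "lev S X" using S.level_cring[OF trans_fin[OF X]] .
    have hom: "\<phi> X \<in> ring_hom (lev R X) (lev S X)" using \<phi> trans_fin[OF X] by (simp add: levelwise_hom_def)
    have "K X = a_kernel (lev R X) (lev S X) (\<phi> X)"
      using K_mem[of _ X] trans_fin[OF X] unfolding a_kernel_def' by blast
    then show "ideal (K X) (lev R X)" 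
      using ring_hom_ring.kernel_is_ideal[OF ring_hom_ringI2[OF RX.ring_axioms SX.ring_axioms hom]] by simp
  next
    fix X Y f assume h: "trans_gset G X" "trans_gset G Y" "gmap G X Y f"
    note cl = tambara_ideal_closed[OF OI h]
    note X = trans_fin[OF h(1)] and Y = trans_fin[OF h(2)]
    show "rst R X Y f ` K Y \<subseteq> K X" "trf R X Y f ` K X \<subseteq> K Y" "nrm R X Y f ` K X \<subseteq> K Y"
      using cl X Y by (auto simp: K_mem \<phi>D h(3) R.rst_closed R.trf_closed R.nrm_closed)
  next
    fix X
    show "K X = (if fin_gset G X then {a \<in> carrier (lev R X).
        \<forall>Q i. trans_gset G Q \<longrightarrow> gmap G Q X i \<longrightarrow> rst R Q X i a \<in> K Q} else {})"
    proof (cases "fin_gset G X")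
      case X: True
      have "\<phi> X a = \<zero>\<^bsub>lev S X\<^esub> \<longleftrightarrow> (\<forall>Q i. trans_gset G Q \<longrightarrow> gmap G Q X i \<longrightarrow> rst R Q X i a \<in> K Q)"
        if a: "a \<in> carrier (lev R X)" for a
      proof -
        have "\<phi> X a = \<zero>\<^bsub>lev S X\<^esub> \<longleftrightarrow> \<phi> X a \<in> ?O X" using X by simp
        also have "\<dots> \<longleftrightarrow> (\<forall>Q i. trans_gset G Q \<longrightarrow> gmap G Q X i \<longrightarrow> rst S Q X i (\<phi> X a) \<in> ?O Q)"
          using X \<phi>D(1)[OF X a] by (subst tambara_ideal_mem[OF OI]) simp
        also have "\<dots> \<longleftrightarrow> (\<forall>Q i. trans_gset G Q \<longrightarrow> gmap G Q X i \<longrightarrow> rst R Q X i a \<in> K Q)"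
          using a by (auto simp: K_mem \<phi>D trans_fin R.rst_closed)
        finally show ?thesis .
      qed
      then show ?thesis using X by (auto simp: K_mem)
    qed (auto simp: K_mem)
  qed
  have ex: "\<exists>b\<in>I pt. b \<in> carrier (lev R pt) \<and> \<phi> pt b = \<one>\<^bsub>lev S pt\<^esub>"
    if I: "tambara_ideal G R I" and n: "\<not> I \<le> K" for I
  proof -
    obtain X a where a: "a \<in> I X" "a \<notin> K X" using n by (auto simp: le_fun_def)
    then have X: "fin_gset G X" and aR: "a \<in> carrier (lev R X)" using iffD1[OF tambara_ideal_mem[OF I]] by blast+
    then obtain Q i where Q: "trans_gset G Q" "gmap G Q X i"
      "nrm S Q pt (to_pt Q) (rst S Q X i (\<phi> X a)) = \<one>\<^bsub>lev S pt\<^esub>"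
      using unit[OF X \<phi>D(1)[OF X aR]] a by (auto simp: K_mem)
    note t = gmap_to_pt[OF trans_fin[OF Q(1)]]
    have "\<phi> pt (nrm R Q pt (to_pt Q) (rst R Q X i a)) = \<one>\<^bsub>lev S pt\<^esub>"
      using Q aR by (simp add: \<phi>D t R.rst_closed)
    then show ?thesis
      using norm_restriction_mem[OF I a(1) Q(1,2)] R.nrm_closed[OF t R.rst_closed[OF Q(2) aR]] by blast
  qed
  have "K \<noteq> unit_tideal G R"
  proof
    assume "K = unit_tideal G R"
    then have "\<one>\<^bsub>lev R pt\<^esub> \<in> K pt" by (simp add: unit_tideal_def)
    then show False using nontriv by (simp add: K_mem \<phi>D)
  qed
  moreover have "I \<le> K \<or> J \<le> K"
    if I: "tambara_ideal G R I" and J: "tambara_ideal G R J" and IJ: "tideal_prod G R I J \<le> K" for I J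
  proof (rule ccontr)
    assume "\<not> (I \<le> K \<or> J \<le> K)"
    then obtain b c where b: "b \<in> I pt" "b \<in> carrier (lev R pt)" "\<phi> pt b = \<one>\<^bsub>lev S pt\<^esub>"
      and c: "c \<in> J pt" "c \<in> carrier (lev R pt)" "\<phi> pt c = \<one>\<^bsub>lev S pt\<^esub>" using ex I J by blast
    have "b \<otimes>\<^bsub>lev R pt\<^esub> c \<in> K pt" by (rule tideal_prod_mem[OF R I J b(1) c(1) IJ])
    then show False using b c nontriv by (simp add: K_mem \<phi>D)
  qed
  ultimately show KS: "K \<in> Spec G R" using K by (simp add: Spec_def tambara_prime_def)
  have "P = K" if P: "P \<in> Spec G R" and le: "K \<le> P" for P
  proof (rule ccontr)
    have I: "tambara_ideal G R P" and ne: "P \<noteq> unit_tideal G R"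
      using P by (simp_all add: Spec_def tambara_prime_def)
    assume "P \<noteq> K"
    then have "\<not> P \<le> K" using le by (metis antisym)
    then obtain b where b: "b \<in> P pt" "b \<in> carrier (lev R pt)" "\<phi> pt b = \<one>\<^bsub>lev S pt\<^esub>" using ex I by blast
    interpret P: ideal "P pt" "lev R pt" using tambara_ideal_level[OF I trans_pt] .
    \<comment> \<open>With \<phi> \<open>b\<close> equal to 1, the difference 1 - \<open>b\<close>
      lies in \<open>K\<close> and so in \<open>P\<close>; adding \<open>b\<close> gives 1.\<close>
    define d where "d = \<one>\<^bsub>lev R pt\<^esub> \<ominus>\<^bsub>lev R pt\<^esub> b"
    have d: "d \<in> carrier (lev R pt)" "d \<oplus>\<^bsub>lev R pt\<^esub> b = \<one>\<^bsub>lev R pt\<^esub>"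
      using b by (simp_all add: d_def Rp.minus_eq Rp.a_assoc Rp.l_neg)
    have "\<phi> pt d \<oplus>\<^bsub>lev S pt\<^esub> \<one>\<^bsub>lev S pt\<^esub> = \<one>\<^bsub>lev S pt\<^esub>"
      using \<phi>D(4)[OF fin_pt d(1) b(2)] d(2) b(3) \<phi>D(3)[OF fin_pt] by simp
    then have "\<phi> pt d = \<zero>\<^bsub>lev S pt\<^esub>"
      using \<phi>D(1)[OF fin_pt d(1)] by (metis Sp.add.r_cancel_one Sp.one_closed)
    then have "d \<in> P pt" using d(1) le_funD[OF le, of pt] by (auto simp: K_mem)
    then have "\<one>\<^bsub>lev R pt\<^esub> \<in> P pt" using d(2) b(1) P.a_closed by metis
    then show False using prime_top[OF I R] ne by blast
  qed
  then show "vanishing G R K = {K}" using KS by (auto simp: vanishing_def)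
qed

lemma field_point_closed_not_open:
  assumes R: "tambara G R" and S: "tambara G S" and \<phi>: "levelwise_hom G R S \<phi>"
    and zero: "\<And>X Y f. trans_gset G X \<Longrightarrow> trans_gset G Y \<Longrightarrow> gmap G X Y f \<Longrightarrow>
      nrm S X Y f \<zero>\<^bsub>lev S X\<^esub> = \<zero>\<^bsub>lev S Y\<^esub>"
    and unit: "\<And>X a. fin_gset G X \<Longrightarrow> a \<in> carrier (lev S X) \<Longrightarrow> a \<noteq> \<zero>\<^bsub>lev S X\<^esub> \<Longrightarrow>
      \<exists>Q i. trans_gset G Q \<and> gmap G Q X i \<and> nrm S Q pt (to_pt Q) (rst S Q X i a) = \<one>\<^bsub>lev S pt\<^esub>"
    and nontriv: "\<one>\<^bsub>lev S pt\<^esub> \<noteq> \<zero>\<^bsub>lev S pt\<^esub>"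
    and zero_prime: "(\<lambda>X. if fin_gset G X then {\<zero>\<^bsub>lev R X\<^esub>} else {}) \<in> Spec G R"
    and ker: "e \<in> carrier (lev R pt)" "e \<noteq> \<zero>\<^bsub>lev R pt\<^esub>" "\<phi> pt e = \<zero>\<^bsub>lev S pt\<^esub>"
  shows "closed_map (nakaoka_spec G S) (nakaoka_spec G R) (spec_map G R \<phi>)"
    and "\<not> open_map (nakaoka_spec G S) (nakaoka_spec G R) (spec_map G R \<phi>)"
proof -
  let ?O = "\<lambda>X. if fin_gset G X then {\<zero>\<^bsub>lev S X\<^esub>} else {}"
  let ?Z = "\<lambda>X. if fin_gset G X then {\<zero>\<^bsub>lev R X\<^esub>} else {}"
  define K where "K = spec_map G R \<phi> ?O"
  note fp' = field_point[OF R S \<phi> zero unit nontriv]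
  have SpecS: "Spec G S = {?O}" by (rule fp'(1))
  have img: "spec_map G R \<phi> ` {?O} = {K}" by (simp only: K_def image_insert image_empty)
  have K: "tambara_ideal G R K" unfolding K_def by (rule fp'(2))
  have KS: "K \<in> Spec G R" unfolding K_def by (rule fp'(3))
  have VK: "vanishing G R K = {K}" unfolding K_def by (rule fp'(4))
  note top = topspace_nakaoka_spec
  show "closed_map (nakaoka_spec G S) (nakaoka_spec G R) (spec_map G R \<phi>)"
    unfolding closed_map_def
  proof (intro allI impI)
    fix C assume "closedin (nakaoka_spec G S) C"
    from closedin_subset[OF this] have "C \<subseteq> {?O}" by (simp only: top[OF S] SpecS)
    then have "C = {} \<or> C = {?O}" by (rule subset_singletonD)
    moreover have "closedin (nakaoka_spec G R) {K}"
    proof -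
      have "openin (nakaoka_spec G R) (Spec G R - {K})"
        unfolding openin_nakaoka_spec[OF R] using K VK by metis
      then show ?thesis using KS top[OF R] by (simp add: closedin_def)
    qed
    ultimately show "closedin (nakaoka_spec G R) (spec_map G R \<phi> ` C)"
      using img by (elim disjE) (simp_all only: image_empty closedin_empty)
  qed
  show "\<not> open_map (nakaoka_spec G S) (nakaoka_spec G R) (spec_map G R \<phi>)"
  proof
    assume "open_map (nakaoka_spec G S) (nakaoka_spec G R) (spec_map G R \<phi>)"
    moreover have "openin (nakaoka_spec G S) {?O}"
      using openin_topspace[of "nakaoka_spec G S"] unfolding top[OF S] SpecS .
    ultimately have "openin (nakaoka_spec G R) (spec_map G R \<phi> ` {?O})" unfolding open_map_def by blast
    then have "openin (nakaoka_spec G R) {K}" by (simp only: img)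
    then obtain J where J: "tambara_ideal G R J" "{K} = Spec G R - vanishing G R J"
      unfolding openin_nakaoka_spec[OF R] by blast
    have "?Z \<le> K"
    proof (rule le_funI)
      fix X
      show "?Z X \<le> K X"
      proof (cases "fin_gset G X")
        case True
        interpret cring "lev R X" using tambara.level_cring[OF R True] .
        show ?thesis using True levelwise_homD(2)[OF \<phi> True] by (simp add: K_def spec_map_def)
      qed simp
    qed
    \<comment> \<open>An ideal \<open>J\<close> not inside \<open>K\<close> is not inside the
      smaller zero ideal either. So the zero ideal also lies off the vanishing locus of
      \<open>J\<close> and would have to be \<open>K\<close>, which contains the nonzero
      \<open>e\<close>.\<close>
    moreover have "\<not> J \<le> K" using J(2) KS by (auto simp: vanishing_def)
    ultimately have "\<not> J \<le> ?Z" using order_trans[of J ?Z K] by blast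
    then have "?Z \<in> {K}" unfolding J(2) using zero_prime by (simp add: vanishing_def)
    then have "K pt = {\<zero>\<^bsub>lev R pt\<^esub>}" by auto
    moreover have "e \<in> K pt" using ker by (simp add: K_def spec_map_def)
    ultimately show False using ker(2) by blast
  qed
qed

end

section \<open>Ghost functors of two families of subgroups\<close>

context subgroup_family
begin

lemma nrm_zero_ghost:
  assumes "trans_gset G X" "trans_gset G Y" "gmap G X Y f"
  shows "gnrm X Y f {} = {}"
proof -
  have "\<exists>x\<in>pts X. f x = y" if "(H, y) \<in> fixed_pairs Y" for H y
    using gmap_trans_surj[OF assms(3,1,2) pairs_D(2)[OF that]] .
  then show ?thesis by (fastforce simp: mem_nrm)
qed

lemma countable_ghost: "fin_gset G X \<Longrightarrow> countable (carrier (lev ghost X))"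
proof -
  assume X: "fin_gset G X"
  have "F \<subseteq> Pow (carrier G)" using family_subgroup subgroup.subset by blast
  then have "finite (F \<times> pts X)" using finite_carrier gset_finite[OF X] finite_subset by blast
  then have "finite (fixed_pairs X)" by (rule finite_subset[rotated]) (auto simp: fixed_pairs_def)
  then have "finite (invariant_sets X)"
    using finite_subset[of "invariant_sets X" "Pow (fixed_pairs X)"] by (auto simp: invariant_sets_def)
  then show ?thesis by (simp add: countable_finite)
qed

text \<open>The value of the norm to a point at the pair \<open>(G, 0)\<close> is a product over the single \<open>G\<close>-orbit of \<open>Q\<close>.\<close>

lemma norm_detects:
  assumes G: "carrier G \<in> F" and X: "fin_gset G X" and a: "a \<in> invariant_sets X" and Hx: "(H, x) \<in> a"
  shows "\<exists>Q i. trans_gset G Q \<and> gmap G Q X i \<and> (carrier G, 0) \<in> gnrm Q pt (to_pt Q) (grst Q X i a)"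
proof -
  note P = inv_D(1)[OF a Hx] and D = pairs_D[OF inv_D(1)[OF a Hx]]
  obtain Q i q where Q: "trans_gset G Q" "gmap G Q X i" and q: "q \<in> pts Q" "i q = x" "stab Q (carrier G) q = H"
    using orbit_through[OF family_subgroup[OF D(1)] X D(2)] D(3) by metis
  note finQ = trans_fin[OF Q(1)]
  \<comment> \<open>Any point of the orbit is a translate of \<open>q\<close>, whose stabilizer is
    exactly \<open>H\<close>. Its pair is then a conjugate of \<open>(H, x)\<close>, which lies in
    \<open>a\<close> by invariance, so every factor of the norm is 1.\<close>
  have "(stab Q (carrier G) z, z) \<in> grst Q X i a" if z: "z \<in> pts Q" for z
  proof -
    obtain g where g: "g \<in> carrier G" "act Q g q = z" using trans_act[OF Q(1) q(1) z] by blast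
    have "stab Q (carrier G) z = conj_by g H"
      using stab_conj[OF finQ g(1) subset_refl q(1)] conj_by_self[OF subgroup_self g(1)] g(2) q(3) by simp
    moreover have "(conj_by g H, i z) \<in> a"
      using inv_D(2)[OF a g(1) Hx] gmap_act[OF Q(2) g(1) q(1)] g(2) q(2) by simp
    ultimately show ?thesis using pairs_stab[OF finQ G z] by (simp add: mem_rst)
  qed
  moreover have "(carrier G, 0) \<in> fixed_pairs pt" using G by (simp add: fixed_pairs_def)
  ultimately have "(carrier G, 0) \<in> gnrm Q pt (to_pt Q) (grst Q X i a)" by (simp add: mem_nrm)
  then show ?thesis using Q by blast
qed

end

section \<open>Comparing families of subgroups\<close>

lemma (in finite_group) trivial_family: "subgroup_family G {{\<one>}}"
proof (rule subgroup_family.intro[OF finite_group_axioms subgroup_family_axioms.intro])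
  show "subgroup H G" if "H \<in> {{\<one>}}" for H using that triv_subgroup by simp
  show "conj_by g H \<in> {{\<one>}}" if "H \<in> {{\<one>}}" "g \<in> carrier G" for H g using that by (simp add: conj_by_def)
  show "K \<in> {{\<one>}}" if "H \<in> {{\<one>}}" "subgroup K G" "K \<subseteq> H" for H K
    using that subgroup.one_closed[OF that(2)] by auto
qed

lemma (in finite_group) full_family: "subgroup_family G {H. subgroup H G}"
  by (rule subgroup_family.intro[OF finite_group_axioms subgroup_family_axioms.intro])
    (simp_all add: conj_by_subgroup)

locale subgroup_subfamily = A: subgroup_family G F + B: subgroup_family G F'
  for G :: "'a monoid" (structure) and F F' :: "'a set set" +
  assumes subfamily: "F' \<subseteq> F"
begin

lemma pairs_sub: "(H, x) \<in> B.fixed_pairs X \<longleftrightarrow> H \<in> F' \<and> (H, x) \<in> A.fixed_pairs X"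
  using subfamily by (auto simp: A.fixed_pairs_def B.fixed_pairs_def)

lemma inv_sub: "B.invariant_sets X \<subseteq> A.invariant_sets X"
  by (auto simp: A.invariant_sets_def B.invariant_sets_def pairs_sub subset_iff)

definition cut_down :: "'a gset \<Rightarrow> ('a set \<times> nat) set \<Rightarrow> ('a set \<times> nat) set" where
  "cut_down X a = a \<inter> B.fixed_pairs X"

lemma mem_cut_down: "a \<in> A.invariant_sets X \<Longrightarrow> (H, x) \<in> cut_down X a \<longleftrightarrow> H \<in> F' \<and> (H, x) \<in> a"
  using A.inv_D(1) by (auto simp: cut_down_def pairs_sub)

text \<open>Restricting to a smaller family commutes with norms because that family is itself closed
  under subgroups: for \<open>H\<close> in it, all stabilizers inside \<open>H\<close> are in it
  too.\<close>

lemma cut_down_hom: "levelwise_hom G A.ghost B.ghost cut_down"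
proof (rule levelwise_homI)
  fix X a assume X: "fin_gset G X" and a: "a \<in> carrier (lev A.ghost X)"
  show "cut_down X a \<in> carrier (lev B.ghost X)"
    using a A.inv_D(2)[of a X] B.pairs_act[OF X] by (auto intro!: B.inv_I simp: cut_down_def)
next
  fix X assume "fin_gset G X"
  show "cut_down X \<zero>\<^bsub>lev A.ghost X\<^esub> = \<zero>\<^bsub>lev B.ghost X\<^esub>" by (simp add: cut_down_def)
  show "cut_down X \<one>\<^bsub>lev A.ghost X\<^esub> = \<one>\<^bsub>lev B.ghost X\<^esub>" by (auto simp: cut_down_def pairs_sub)
  fix a b
  show "cut_down X (a \<oplus>\<^bsub>lev A.ghost X\<^esub> b) = cut_down X a \<oplus>\<^bsub>lev B.ghost X\<^esub> cut_down X b"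
    "cut_down X (a \<otimes>\<^bsub>lev A.ghost X\<^esub> b) = cut_down X a \<otimes>\<^bsub>lev B.ghost X\<^esub> cut_down X b"
    by (auto simp: cut_down_def)
next
  fix X Y f assume f: "gmap G X Y f"
  note X = A.gmap_src[OF f] and Y = A.gmap_tgt[OF f]
  show "cut_down X (A.grst X Y f a) = B.grst X Y f (cut_down Y a)" if "a \<in> carrier (lev A.ghost Y)" for a
    using B.pairs_gmap[OF f] by (auto simp: cut_down_def A.mem_rst B.mem_rst pairs_sub)
  show "cut_down Y (A.gtrf X Y f a) = B.gtrf X Y f (cut_down X a)" if a: "a \<in> carrier (lev A.ghost X)" for a
  proof -
    have "{x \<in> pts X. f x = y \<and> (H, x) \<in> cut_down X a} = {x \<in> pts X. f x = y \<and> (H, x) \<in> a}"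
      if "(H, y) \<in> B.fixed_pairs Y" for H y
      using that a by (auto simp: mem_cut_down B.pairs_D(1))
    then show ?thesis by (auto simp: cut_down_def[of Y] A.mem_trf B.mem_trf pairs_sub)
  qed
  show "cut_down Y (A.gnrm X Y f a) = B.gnrm X Y f (cut_down X a)" if a: "a \<in> carrier (lev A.ghost X)" for a
  proof -
    have "(A.stab X H x, x) \<in> cut_down X a \<longleftrightarrow> (A.stab X H x, x) \<in> a"
      if "(H, y) \<in> B.fixed_pairs Y" "x \<in> pts X" for H y x
      using B.pairs_stab[OF X B.pairs_D(1)[OF that(1)] that(2)] by (auto simp: cut_down_def)
    then show ?thesis by (auto simp: cut_down_def[of Y] A.mem_nrm B.mem_nrm pairs_sub)
  qed
qed

text \<open>Up to transport, the section is extension by zero, that is, inclusion of sets of pairs,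
  and \<epsilon> is the set of pairs whose subgroup lies in the smaller family. Restriction
  preserves this set, as it does not change the subgroup of a pair.\<close>

lemma ghost_idempotent_quotient:
  assumes R: "tambara G R" and eR: "levelwise_hom G A.ghost R eR" and dR: "levelwise_hom G R A.ghost dR"
    and dReR: "\<And>X a. fin_gset G X \<Longrightarrow> a \<in> carrier (lev A.ghost X) \<Longrightarrow> dR X (eR X a) = a"
    and eRdR: "\<And>X a. fin_gset G X \<Longrightarrow> a \<in> carrier (lev R X) \<Longrightarrow> eR X (dR X a) = a"
    and S: "tambara G S" and eS: "levelwise_hom G B.ghost S eS" and dS: "levelwise_hom G S B.ghost dS"
    and dSeS: "\<And>X a. fin_gset G X \<Longrightarrow> a \<in> carrier (lev B.ghost X) \<Longrightarrow> dS X (eS X a) = a"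
    and eSdS: "\<And>X a. fin_gset G X \<Longrightarrow> a \<in> carrier (lev S X) \<Longrightarrow> eS X (dS X a) = a"
  shows "idempotent_quotient G R S (\<lambda>X a. eS X (cut_down X (dR X a))) (\<lambda>X s. eR X (dS X s))"
proof (rule idempotent_quotient.intro[OF R S idempotent_quotient_axioms.intro])
  note eRD = levelwise_homD[OF eR] and dRD = levelwise_homD[OF dR]
    and eSD = levelwise_homD[OF eS] and dSD = levelwise_homD[OF dS] and cD = levelwise_homD[OF cut_down_hom]
  show "levelwise_hom G R S (\<lambda>X a. eS X (cut_down X (dR X a)))"
    using levelwise_hom_comp[OF levelwise_hom_comp[OF dR cut_down_hom] eS] .
  have sub: "dS X s \<in> carrier (lev A.ghost X)" if "fin_gset G X" "s \<in> carrier (lev S X)" for X s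
    using dSD(1)[OF that] inv_sub by auto
  have one: "\<one>\<^bsub>lev S X\<^esub> \<in> carrier (lev S X)" if "fin_gset G X" for X
    using tambara.level_cring[OF S that] by (simp add: cring.cring_simprules)
  have dS1: "dS X \<one>\<^bsub>lev S X\<^esub> = B.fixed_pairs X" if "fin_gset G X" for X using dSD(3)[OF that] by simp
  show "eR X (dS X s) \<in> carrier (lev R X)" if "fin_gset G X" "s \<in> carrier (lev S X)" for X s
    by (rule eRD(1)[OF that(1) sub[OF that]])
  show "eS X (cut_down X (dR X (eR X (dS X s)))) = s" if X: "fin_gset G X" and s: "s \<in> carrier (lev S X)" for X s
  proof -
    have "cut_down X (dS X s) = dS X s"
      using dSD(1)[OF X s] by (auto simp: cut_down_def dest: B.inv_D(1))
    then show ?thesis using dReR[OF X sub[OF X s]] eSdS[OF X s] by simp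
  qed
  show "eR X (dS X (eS X (cut_down X (dR X r)))) = eR X (dS X \<one>\<^bsub>lev S X\<^esub>) \<otimes>\<^bsub>lev R X\<^esub> r"
    if X: "fin_gset G X" and r: "r \<in> carrier (lev R X)" for X r
  proof -
    have r': "dR X r \<in> carrier (lev A.ghost X)" by (rule dRD(1)[OF X r])
    have "eR X (dS X \<one>\<^bsub>lev S X\<^esub>) \<otimes>\<^bsub>lev R X\<^esub> r = eR X (dS X \<one>\<^bsub>lev S X\<^esub> \<otimes>\<^bsub>lev A.ghost X\<^esub> dR X r)"
      by (simp only: eRD(5)[OF X sub[OF X one[OF X]] r'] eRdR[OF X r])
    also have "dS X \<one>\<^bsub>lev S X\<^esub> \<otimes>\<^bsub>lev A.ghost X\<^esub> dR X r = cut_down X (dR X r)"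
      by (auto simp: dS1[OF X] cut_down_def)
    also have "cut_down X (dR X r) = dS X (eS X (cut_down X (dR X r)))"
      by (rule dSeS[OF X cD(1)[OF X r'], symmetric])
    finally show ?thesis by (rule sym)
  qed
  fix X Y f assume f: "gmap G X Y f"
  note X = A.gmap_src[OF f] and Y = A.gmap_tgt[OF f]
  show "rst R X Y f (eR Y (dS Y \<one>\<^bsub>lev S Y\<^esub>)) = eR X (dS X \<one>\<^bsub>lev S X\<^esub>)"
  proof -
    have "A.grst X Y f (B.fixed_pairs Y) = B.fixed_pairs X"
      using A.pairs_gmap[OF f] by (auto simp: A.mem_rst pairs_sub)
    then show ?thesis using eRD(6)[OF f sub[OF Y one[OF Y]]] by (simp add: dS1 X Y)
  qed
  show "trf S X Y f (rst S X Y f a \<otimes>\<^bsub>lev S X\<^esub> b) = a \<otimes>\<^bsub>lev S Y\<^esub> trf S X Y f b"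
    if a: "a \<in> carrier (lev S Y)" and b: "b \<in> carrier (lev S X)" for a b
  proof -
    interpret S: tambara G S by fact
    interpret SX: cring "lev S X" using S.level_cring[OF X] .
    interpret SY: cring "lev S Y" using S.level_cring[OF Y] .
    have l: "rst S X Y f a \<otimes>\<^bsub>lev S X\<^esub> b \<in> carrier (lev S X)" using S.rst_closed[OF f a] b by simp
    have "dS Y (trf S X Y f (rst S X Y f a \<otimes>\<^bsub>lev S X\<^esub> b)) = B.gtrf X Y f (B.grst X Y f (dS Y a) \<inter> dS X b)"
      by (simp add: dSD(7)[OF f l] dSD(5)[OF X S.rst_closed[OF f a] b] dSD(6)[OF f a])
    also have "\<dots> = dS Y a \<inter> B.gtrf X Y f (dS X b)" using B.frobenius_ghost[OF f] dSD(1)[OF X b] by simp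
    also have "\<dots> = dS Y (a \<otimes>\<^bsub>lev S Y\<^esub> trf S X Y f b)"
      by (simp add: dSD(5)[OF Y a S.trf_closed[OF f b]] dSD(7)[OF f b])
    finally have "eS Y (dS Y (trf S X Y f (rst S X Y f a \<otimes>\<^bsub>lev S X\<^esub> b))) = eS Y (dS Y (a \<otimes>\<^bsub>lev S Y\<^esub> trf S X Y f b))"
      by simp
    then show ?thesis using eSdS[OF Y] S.trf_closed[OF f l] S.trf_closed[OF f b] a by simp
  qed
qed

end

section \<open>The etale map\<close>

lemma (in finite_group) ex_etale_closed_not_open:
  assumes nontrivial: "carrier G \<noteq> {\<one>}"
  shows "\<exists>(R :: ('a, 'u::infinite) tamb) S \<phi>. etale G R S \<phi> \<and>
    \<not> open_map (nakaoka_spec G S) (nakaoka_spec G R) (spec_map G R \<phi>) \<and>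
    closed_map (nakaoka_spec G S) (nakaoka_spec G R) (spec_map G R \<phi>)"
proof -
  interpret A: subgroup_family G "{H. subgroup H G}" by (rule full_family)
  interpret B: subgroup_family G "{{\<one>}}" by (rule trivial_family)
  interpret AB: subgroup_subfamily G "{H. subgroup H G}" "{{\<one>}}"
    by unfold_locales (simp add: triv_subgroup)
  obtain R :: "('a, 'u) tamb" and eR dR where R: "tambara G R"
    and eR: "levelwise_hom G A.ghost R eR" and dR: "levelwise_hom G R A.ghost dR"
    and dReR: "\<And>X a. fin_gset G X \<Longrightarrow> a \<in> carrier (lev A.ghost X) \<Longrightarrow> dR X (eR X a) = a"
    and eRdR: "\<And>X a. fin_gset G X \<Longrightarrow> a \<in> carrier (lev R X) \<Longrightarrow> eR X (dR X a) = a"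
    using tambara_in_universe[OF A.tambara_ghost A.countable_ghost] by blast
  obtain S :: "('a, 'u) tamb" and eS dS where S: "tambara G S"
    and eS: "levelwise_hom G B.ghost S eS" and dS: "levelwise_hom G S B.ghost dS"
    and dSeS: "\<And>X a. fin_gset G X \<Longrightarrow> a \<in> carrier (lev B.ghost X) \<Longrightarrow> dS X (eS X a) = a"
    and eSdS: "\<And>X a. fin_gset G X \<Longrightarrow> a \<in> carrier (lev S X) \<Longrightarrow> eS X (dS X a) = a"
    using tambara_in_universe[OF B.tambara_ghost B.countable_ghost] by blast
  note eRD = levelwise_homD[OF eR] and dRD = levelwise_homD[OF dR]
    and eSD = levelwise_homD[OF eS] and dSD = levelwise_homD[OF dS]
  interpret R: tambara G R by fact
  interpret S: tambara G S by fact
  define \<phi> where "\<phi> X a = eS X (AB.cut_down X (dR X a))" for X a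
  interpret Q: idempotent_quotient G R S \<phi> "\<lambda>X s. eR X (dS X s)"
    unfolding \<phi>_def[abs_def]
    by (rule AB.ghost_idempotent_quotient[OF R eR dR dReR eRdR S eS dS dSeS eSdS])
  have "countable (carrier (lev R X))" if X: "fin_gset G X" for X
  proof -
    have "carrier (lev R X) \<subseteq> eR X ` carrier (lev A.ghost X)"
    proof
      fix a assume a: "a \<in> carrier (lev R X)"
      show "a \<in> eR X ` carrier (lev A.ghost X)"
        using dRD(1)[OF X a] eRdR[OF X a, symmetric] by (rule image_eqI[rotated])
    qed
    then show ?thesis by (rule countable_subset) (rule countable_image[OF A.countable_ghost[OF X]])
  qed
  \<comment> \<open>The generator is placed at the point because every finite G-set maps to
    it.\<close>
  then interpret free_construction G R pt by unfold_locales simp_all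
  obtain F \<eta> x where "is_free_algebra G R [pt] (F :: ('a, 'u) tamb) \<eta> [x]" using ex_free_algebra by blast
  then have et: "etale G R S \<phi>" by (rule Q.etale) (use gmap_to_pt in auto)
  have zero_iff: "a = \<zero>\<^bsub>lev R X\<^esub> \<longleftrightarrow> dR X a = {}" if X: "fin_gset G X" and a: "a \<in> carrier (lev R X)" for X a
    using dRD(2)[OF X] eRD(2)[OF X] eRdR[OF X a] unfolding A.ghost_lev by metis
  have zero_iff': "a = \<zero>\<^bsub>lev S X\<^esub> \<longleftrightarrow> dS X a = {}" if X: "fin_gset G X" and a: "a \<in> carrier (lev S X)" for X a
    using dSD(2)[OF X] eSD(2)[OF X] eSdS[OF X a] unfolding B.ghost_lev by metis
  interpret Rp: cring "lev R pt" using R.level_cring[OF fin_pt] .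
  interpret Sp: cring "lev S pt" using S.level_cring[OF fin_pt] .
  \<comment> \<open>The coordinate chosen for \<open>D\<close> is the pair of \<open>G\<close> and
    the point: \<open>norm_detects\<close> makes it nonzero, and multiplication is intersection, so
    it stays nonzero in products.\<close>
  have zpR: "(\<lambda>X. if fin_gset G X then {\<zero>\<^bsub>lev R X\<^esub>} else {}) \<in> Spec G R"
  proof (rule zero_prime[OF R, where D = "\<lambda>b. b \<in> carrier (lev R pt) \<and> (carrier G, 0) \<in> dR pt b"])
    fix X Y f assume f: "trans_gset G X" "trans_gset G Y" "gmap G X Y f"
    note X = trans_fin[OF f(1)] and Y = trans_fin[OF f(2)]
    show "nrm R X Y f \<zero>\<^bsub>lev R X\<^esub> = \<zero>\<^bsub>lev R Y\<^esub>"
      using eRD(8)[OF f(3), of "{}"] eRD(2)[OF X] eRD(2)[OF Y] A.nrm_zero_ghost[OF f] A.inv_zero by simp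
  next
    fix X a assume X: "fin_gset G X" and a: "a \<in> carrier (lev R X)" "a \<noteq> \<zero>\<^bsub>lev R X\<^esub>"
    have inv: "dR X a \<in> A.invariant_sets X" using dRD(1)[OF X a(1)] by simp
    obtain H x where "(H, x) \<in> dR X a" using a zero_iff[OF X a(1)] by auto
    then obtain Q i where Q: "trans_gset G Q" "gmap G Q X i"
      "(carrier G, 0) \<in> A.gnrm Q pt (to_pt Q) (A.grst Q X i (dR X a))"
      using A.norm_detects[OF _ X inv] subgroup_self by blast
    note t = gmap_to_pt[OF trans_fin[OF Q(1)]] and r = R.rst_closed[OF Q(2) a(1)]
    have "(carrier G, 0) \<in> dR pt (nrm R Q pt (to_pt Q) (rst R Q X i a))"
      using Q(3) by (simp add: dRD(8)[OF t r] dRD(6)[OF Q(2) a(1)])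
    then show "\<exists>Q i. trans_gset G Q \<and> gmap G Q X i \<and>
        nrm R Q pt (to_pt Q) (rst R Q X i a) \<in> carrier (lev R pt) \<and>
        (carrier G, 0) \<in> dR pt (nrm R Q pt (to_pt Q) (rst R Q X i a))"
      using Q R.nrm_closed[OF t r] by blast
  next
    fix a b
    assume ab: "a \<in> carrier (lev R pt) \<and> (carrier G, 0) \<in> dR pt a"
      "b \<in> carrier (lev R pt) \<and> (carrier G, 0) \<in> dR pt b"
    then have "(carrier G, 0) \<in> dR pt (a \<otimes>\<^bsub>lev R pt\<^esub> b)" by (simp add: dRD(5))
    then show "a \<otimes>\<^bsub>lev R pt\<^esub> b \<noteq> \<zero>\<^bsub>lev R pt\<^esub>" using dRD(2)[OF fin_pt] by auto
  next
    have "(carrier G, 0) \<in> dR pt \<one>\<^bsub>lev R pt\<^esub>"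
      using dRD(3)[OF fin_pt] subgroup_self by (simp add: A.fixed_pairs_def)
    then show "\<one>\<^bsub>lev R pt\<^esub> \<noteq> \<zero>\<^bsub>lev R pt\<^esub>" using dRD(2)[OF fin_pt] by auto
  qed
  have zS: "nrm S X Y f \<zero>\<^bsub>lev S X\<^esub> = \<zero>\<^bsub>lev S Y\<^esub>" if f: "trans_gset G X" "trans_gset G Y" "gmap G X Y f" for X Y f
    using eSD(8)[OF f(3), of "{}"] eSD(2)[OF trans_fin[OF f(1)]] eSD(2)[OF trans_fin[OF f(2)]]
      B.nrm_zero_ghost[OF f] B.inv_zero by simp
  have unit: "\<exists>Q i. trans_gset G Q \<and> gmap G Q X i \<and> nrm S Q pt (to_pt Q) (rst S Q X i a) = \<one>\<^bsub>lev S pt\<^esub>"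
    if X: "fin_gset G X" and a: "a \<in> carrier (lev S X)" "a \<noteq> \<zero>\<^bsub>lev S X\<^esub>" for X a
  proof -
    have inv: "dS X a \<in> B.invariant_sets X" using dSD(1)[OF X a(1)] by simp
    obtain H x where Hx: "(H, x) \<in> dS X a" using a zero_iff'[OF X a(1)] by auto
    note D = B.pairs_D[OF B.inv_D(1)[OF inv Hx]]
    have H: "H = {\<one>}" using D(1) by simp
    \<comment> \<open>With \<open>H\<close> trivial, \<open>Q\<close> is the free orbit. The norm
      multiplies the values at all translates of \<open>x\<close>, which are 1 by
      invariance.\<close>
    obtain Q i q where Q: "trans_gset G Q" "gmap G Q X i" and q: "q \<in> pts Q" "i q = x"
      using orbit_through[OF triv_subgroup X D(2)] gset_act_one[OF X D(2)] by (metis singletonD)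
    note t = gmap_to_pt[OF trans_fin[OF Q(1)]] and r = S.rst_closed[OF Q(2) a(1)]
    have "({\<one>}, z) \<in> B.grst Q X i (dS X a)" if z: "z \<in> pts Q" for z
    proof -
      obtain g where g: "g \<in> carrier G" "act Q g q = z" using trans_act[OF Q(1) q(1) z] by blast
      have "(conj_by g H, act X g x) \<in> dS X a" by (rule B.inv_D(2)[OF inv g(1) Hx])
      then have "({\<one>}, i z) \<in> dS X a"
        using gmap_act[OF Q(2) g(1) q(1)] g q(2) by (simp add: H conj_by_def)
      then show ?thesis using z gset_act_one[OF trans_fin[OF Q(1)]] by (simp add: B.mem_rst B.fixed_pairs_def)
    qed
    moreover have "stab Q {\<one>} z = {\<one>}" if "z \<in> pts Q" for z
      using gset_act_one[OF trans_fin[OF Q(1)] that] by (auto simp: stab_def)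
    ultimately have "B.gnrm Q pt (to_pt Q) (B.grst Q X i (dS X a)) = B.fixed_pairs pt"
      by (auto simp: B.mem_nrm B.fixed_pairs_def)
    then have "dS pt (nrm S Q pt (to_pt Q) (rst S Q X i a)) = dS pt \<one>\<^bsub>lev S pt\<^esub>"
      using dSD(3)[OF fin_pt] by (simp add: dSD(8)[OF t r] dSD(6)[OF Q(2) a(1)])
    then have "eS pt (dS pt (nrm S Q pt (to_pt Q) (rst S Q X i a))) = eS pt (dS pt \<one>\<^bsub>lev S pt\<^esub>)"
      by (rule arg_cong)
    then have "nrm S Q pt (to_pt Q) (rst S Q X i a) = \<one>\<^bsub>lev S pt\<^esub>"
      by (simp only: eSdS[OF fin_pt S.nrm_closed[OF t r]] eSdS[OF fin_pt Sp.one_closed])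
    then show ?thesis using Q by blast
  qed
  have nontriv: "\<one>\<^bsub>lev S pt\<^esub> \<noteq> \<zero>\<^bsub>lev S pt\<^esub>"
  proof
    assume "\<one>\<^bsub>lev S pt\<^esub> = \<zero>\<^bsub>lev S pt\<^esub>"
    then have "B.fixed_pairs pt = {}"
      using dSD(3)[OF fin_pt] dSD(2)[OF fin_pt] unfolding B.ghost_lev by metis
    moreover have "({\<one>}, 0) \<in> B.fixed_pairs pt" by (simp add: B.fixed_pairs_def)
    ultimately show False by blast
  qed
  \<comment> \<open>This is 1 - \<epsilon>, the set of pairs at the point with nontrivial subgroup,
    written as a sum so that \<open>A.inv_sym_diff\<close> applies. It contains the pair of
    \<open>G\<close> and the point because \<open>G\<close> is nontrivial.\<close>
  define e0 where "e0 = (A.fixed_pairs pt - B.fixed_pairs pt) \<union> (B.fixed_pairs pt - A.fixed_pairs pt)"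
  have e0: "e0 \<in> carrier (lev A.ghost pt)"
    unfolding e0_def A.ghost_lev
    by (rule A.inv_sym_diff[OF fin_pt A.inv_one[OF fin_pt] subsetD[OF AB.inv_sub B.inv_one[OF fin_pt]]])
  have "(carrier G, 0) \<in> e0"
    using nontrivial subgroup_self by (simp add: e0_def A.fixed_pairs_def B.fixed_pairs_def)
  then have ne: "eR pt e0 \<noteq> \<zero>\<^bsub>lev R pt\<^esub>"
    unfolding zero_iff[OF fin_pt eRD(1)[OF fin_pt e0]] dReR[OF fin_pt e0] by blast
  have "AB.cut_down pt e0 = {}" by (auto simp: AB.cut_down_def e0_def AB.pairs_sub)
  then have \<phi>e: "\<phi> pt (eR pt e0) = \<zero>\<^bsub>lev S pt\<^esub>"
    unfolding \<phi>_def dReR[OF fin_pt e0] using eSD(2)[OF fin_pt] unfolding B.ghost_lev by simp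
  show ?thesis
    using et field_point_closed_not_open[OF R S Q.\<phi> zS unit nontriv zpR eRD(1)[OF fin_pt e0] ne \<phi>e] by blast
qed

theorem corollaryD:
  fixes G :: "'g monoid"
  assumes "group G" and "finite (carrier G)" and "carrier G \<noteq> {\<one>\<^bsub>G\<^esub>}"
  shows "(\<exists>(R :: ('g, 'u::infinite) tamb) S \<phi>.
            etale G R S \<phi> \<and>
            \<not> open_map (nakaoka_spec G S) (nakaoka_spec G R) (spec_map G R \<phi>)) \<and>
         (dedekind_group G \<longrightarrow>
           (\<exists>(R :: ('g, 'u) tamb) S \<phi>.
              etale G R S \<phi> \<and>
              \<not> open_map (nakaoka_spec G S) (nakaoka_spec G R) (spec_map G R \<phi>) \<and>
              closed_map (nakaoka_spec G S) (nakaoka_spec G R) (spec_map G R \<phi>)))"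
proof -
  interpret finite_group G
    using assms by (simp add: finite_group_def finite_group_axioms_def)
  show ?thesis using ex_etale_closed_not_open[OF assms(3), where 'u = 'u] by blast
qed

end
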